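(* Let $\mathscr{A}$ be a unital C*-algebra, $\mathcal{H}$ a Hilbert space, and let $\phi=(\phi_k)_{k\in\mathbb{N}} \in c_0(B(\mathscr{A}))$ be a sequence of *-maps on $\mathscr{A}$. Denote $\xi(a) = \operatorname{diag}\{\phi_k (a)\}_{k}$ for $a\in\mathscr{A}$ and $\mathscr{X} = \xi(\mathscr{A})$. If $\mathscr{X}$ is a C*-algebra, then a map $\varphi \in B(\mathscr{A},B(\mathcal{H}))$ is $\phi$-decomposable if and only if for every $n\in\mathbb{N}$ and every $[a_{ij}]_{i,j}\in \mathbb{M}_n(\mathscr{A})$, $$[a_{ij}]_{i,j} \in \Gamma_{n}^{+}(\phi) \ \Longrightarrow\ [\varphi(a_{ij})]_{i,j} \in \mathbb{M}_n(B(\mathcal{H}))^+ .$$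
   Context: For a C*-algebra $\mathscr{M}$, $\mathscr{M}^+$ denotes its convex cone of positive elements and $\mathbb{M}_n(\mathscr{M})\simeq \mathbb{M}_n(\mathbb{C})\otimes\mathscr{M}$ the C*-algebra of $n\times n$ matrices over $\mathscr{M}$. A *-map is a linear map $f$ with $f(a^* )=f(a)^*$ for all $a$. A map $\psi:\mathscr{A}\to B(\mathcal{H})$ is completely positive (c.p.) if it is a bounded *-map and $\mathrm{id}_n\otimes\psi:\mathbb{M}_n(\mathscr{A})\to\mathbb{M}_n(B(\mathcal{H}))$, $[a_{ij}]\mapsto[\psi(a_{ij})]$, maps positive elements to positive elements for all $n\in\mathbb{N}$. $B(\mathscr{A},B(\mathcal{H}))$ denotes the bounded linear maps from $\mathscr{A}$ to $B(\mathcal{H})$, and $B(\mathscr{A})$ the bounded linear maps on $\mathscr{A}$. $\phi=(\phi_k)_k\in c_0(B(\mathscr{A}))$ means that the $\phi_k$ are bounded linear maps on $\mathscr{A}$ with $(\|\phi_k\|)_k$ uniformly bounded and $\|\phi_k\|\to0$ as $k\to\infty$ (a vanishing sequence). A map $\varphi\in B(\mathscr{A},B(\mathcal{H}))$ is $\phi$-decomposable (countably decomposable with respect to $\phi$) if there is a sequence $(\psi_k)_k$ of c.p. maps $\mathscr{A}\to B(\mathcal{H})$ such that $\varphi(a)=\sum_{k=1}^\infty\psi_k(\phi_k(a))$ for every $a\in\mathscr{A}$, the series converging in the norm of $B(\mathcal{H})$. For $n\in\mathbb{N}$, $\Gamma_n^+(\phi)=\{[a_{ij}]_{i,j}\in\mathbb{M}_n(\mathscr{A})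 : [\phi_k(a_{ij})]_{i,j}\in\mathbb{M}_n(\mathscr{A})^+ \text{ for all } k\}$. For a sequence $(a_k)_k$ in $\mathscr{A}$ with $\|a_k\|\to0$, $\operatorname{diag}\{a_k\}_k=\sum_{k}E_{kk}\otimes a_k$ is an element of the spatial tensor product $B(l^2)\hat{\otimes}_{\min}\mathscr{A}$, where $E_{kk}$ is the rank-one projection onto the $k$-th standard basis vector of $l^2$; its norm is $\sup_k\|a_k\|$. The set of all such elements is thereby identified with $c_0(\mathscr{A})$, the norm-vanishing sequences in $\mathscr{A}$ with entrywise operations and supremum norm. "$\mathscr{X}$ is a C*-algebra" refers to the operations and norm inherited from this C*-algebra. *)

theory Defs
  imports "HOL-Analysis.Analysis" "Jordan_Normal_Form.Matrix"
begin

section \<open>Complex Banach and Hilbert spaces, C*-algebras\<close>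

class complex_normed_space = real_normed_vector +
  fixes scaleC :: "complex \<Rightarrow> 'a \<Rightarrow> 'a"  (infixr \<open>*\<^sub>C\<close> 75)
  assumes scaleC_add_right: "c *\<^sub>C (x + y) = c *\<^sub>C x + c *\<^sub>C y"
    and scaleC_add_left: "(c + d) *\<^sub>C x = c *\<^sub>C x + d *\<^sub>C x"
    and scaleC_scaleC: "c *\<^sub>C d *\<^sub>C x = (c * d) *\<^sub>C x"
    and scaleC_of_real: "complex_of_real r *\<^sub>C x = r *\<^sub>R x"
    and norm_scaleC: "norm (c *\<^sub>C x) = cmod c * norm x"

text \<open>The inner product is linear in its second argument.\<close>

class complex_hilbert_space = complex_normed_space + banach +
  fixes cinner :: "'a \<Rightarrow> 'a \<Rightarrow> complex"
  assumes cinner_commute: "cinner x y = cnj (cinner y x)"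
    and cinner_add_right: "cinner x (y + z) = cinner x y + cinner x z"
    and cinner_scaleC_right: "cinner x (c *\<^sub>C y) = c * cinner x y"
    and cinner_self: "cinner x x = complex_of_real ((norm x)\<^sup>2)"

class cstar_algebra = complex_normed_space + real_normed_algebra + banach +
  fixes star :: "'a \<Rightarrow> 'a"
  assumes scaleC_mult_left: "(c *\<^sub>C a) * b = c *\<^sub>C (a * b)"
    and scaleC_mult_right: "a * (c *\<^sub>C b) = c *\<^sub>C (a * b)"
    and star_star: "star (star a) = a"
    and star_add: "star (a + b) = star a + star b"
    and star_mult: "star (a * b) = star b * star a"
    and star_scaleC: "star (c *\<^sub>C a) = cnj c *\<^sub>C star a"
    and cstar_identity: "norm (star a * a) = (norm a)\<^sup>2"

text \<open>The zero algebra is admitted as a unital C*-algebra, whence \<open>monoid_mult\<close>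
  rather than \<open>ring_1\<close>.\<close>

class unital_cstar_algebra = cstar_algebra + monoid_mult


section \<open>Bounded complex-linear maps\<close>

definition clinear :: "('a::complex_normed_space \<Rightarrow> 'b::complex_normed_space) \<Rightarrow> bool" where
  "clinear f \<longleftrightarrow> (\<forall>x y. f (x + y) = f x + f y) \<and> (\<forall>c x. f (c *\<^sub>C x) = c *\<^sub>C f x)"

definition bounded_clinear :: "('a::complex_normed_space \<Rightarrow> 'b::complex_normed_space) \<Rightarrow> bool" where
  "bounded_clinear f \<longleftrightarrow> clinear f \<and> (\<exists>K. \<forall>x. norm (f x) \<le> K * norm x)"

lemma bounded_clinear_iff:
  "bounded_clinear f \<longleftrightarrow> bounded_linear f \<and> (\<forall>c x. f (c *\<^sub>C x) = c *\<^sub>C f x)"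
proof
  assume f: "bounded_clinear f"
  then obtain K where K: "\<And>x. norm (f x) \<le> K * norm x"
    unfolding bounded_clinear_def by blast
  have "bounded_linear f"
  proof (rule bounded_linear_intro[where K = K])
    show "f (x + y) = f x + f y" for x y
      using f by (auto simp: bounded_clinear_def clinear_def)
    show "f (r *\<^sub>R x) = r *\<^sub>R f x" for r x
      using f unfolding bounded_clinear_def clinear_def by (metis scaleC_of_real)
    show "norm (f x) \<le> norm x * K" for x
      using K by (simp add: mult.commute)
  qed
  then show "bounded_linear f \<and> (\<forall>c x. f (c *\<^sub>C x) = c *\<^sub>C f x)"
    using f by (auto simp: bounded_clinear_def clinear_def)
next
  assume f: "bounded_linear f \<and> (\<forall>c x. f (c *\<^sub>C x) = c *\<^sub>C f x)"
  then obtain K where "\<forall>x. norm (f x) \<le> norm x * K"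
    using bounded_linear.bounded by blast
  then show "bounded_clinear f"
    using f unfolding bounded_clinear_def clinear_def
    by (auto simp: linear_simps mult.commute)
qed

lemma bounded_linear_scaleC_right: "bounded_linear (\<lambda>x::'a::complex_normed_space. c *\<^sub>C x)"
proof (rule bounded_linear_intro[where K = "cmod c"])
  show "c *\<^sub>C (r *\<^sub>R x) = r *\<^sub>R (c *\<^sub>C x)" for r and x :: 'a
    by (metis scaleC_of_real scaleC_scaleC mult.commute)
qed (auto simp: scaleC_add_right norm_scaleC mult.commute)

lemma scaleC_zero_right [simp]: "c *\<^sub>C (0::'a::complex_normed_space) = 0"
  using linear_simps(3)[OF bounded_linear_scaleC_right] .

lemma scaleC_minus_right: "c *\<^sub>C (- x) = - (c *\<^sub>C (x::'a::complex_normed_space))"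
  using linear_simps(4)[OF bounded_linear_scaleC_right] .

lemma scaleC_one [simp]: "1 *\<^sub>C (x::'a::complex_normed_space) = x"
  using scaleC_of_real[of 1 x] by simp


section \<open>Riesz representation and adjoints\<close>

lemma cinner_add_left: "cinner (x + y) (z::'a::complex_hilbert_space) = cinner x z + cinner y z"
  by (metis cinner_add_right cinner_commute complex_cnj_add)

lemma cinner_scaleC_left: "cinner (c *\<^sub>C x) (z::'a::complex_hilbert_space) = cnj c * cinner x z"
  by (metis cinner_scaleC_right cinner_commute complex_cnj_mult)

lemma cinner_minus_right: "cinner x (- y) = - cinner x (y::'a::complex_hilbert_space)"
  using cinner_scaleC_right[of x "-1" y] scaleC_of_real[of "-1" y] by simp

lemma cinner_minus_left: "cinner (- x) y = - cinner x (y::'a::complex_hilbert_space)"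
  using cinner_scaleC_left[of "-1" x y] scaleC_of_real[of "-1" x] by simp

lemma cinner_diff_right: "cinner x (y - z) = cinner x y - cinner x (z::'a::complex_hilbert_space)"
  using cinner_add_right[of x y "- z"] by (simp add: cinner_minus_right)

lemma cinner_diff_left: "cinner (x - y) z = cinner x z - cinner y (z::'a::complex_hilbert_space)"
  using cinner_add_left[of x "- y" z] by (simp add: cinner_minus_left)

lemma cinner_zero_left [simp]: "cinner 0 (x::'a::complex_hilbert_space) = 0"
  using cinner_diff_left[of 0 0 x] by simp

lemma cinner_zero_right [simp]: "cinner (x::'a::complex_hilbert_space) 0 = 0"
  using cinner_diff_right[of x 0 0] by simp

lemma cinner_extensionality:
  fixes x y :: "'a::complex_hilbert_space"
  assumes "\<And>z. cinner z x = cinner z y"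
  shows "x = y"
proof -
  have "cinner (x - y) (x - y) = 0"
    using assms by (simp add: cinner_diff_right)
  then have "(norm (x - y))\<^sup>2 = 0"
    unfolding cinner_self by (simp only: of_real_eq_0_iff)
  then show ?thesis by simp
qed

lemma norm_add_square:
  fixes x y :: "'a::complex_hilbert_space"
  shows "(norm (x + y))\<^sup>2 = (norm x)\<^sup>2 + 2 * Re (cinner x y) + (norm y)\<^sup>2"
proof -
  have "cinner (x + y) (x + y) = cinner x x + cinner x y + cnj (cinner x y) + cinner y y"
    using cinner_commute[of y x] by (simp add: cinner_add_left cinner_add_right)
  then have "Re (cinner (x + y) (x + y)) = Re (cinner x x) + 2 * Re (cinner x y) + Re (cinner y y)"
    by simp
  then show ?thesis
    unfolding cinner_self Re_complex_of_real .
qed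

lemma norm_diff_square:
  fixes x y :: "'a::complex_hilbert_space"
  shows "(norm (x - y))\<^sup>2 = (norm x)\<^sup>2 - 2 * Re (cinner x y) + (norm y)\<^sup>2"
  using norm_add_square[of x "- y"] by (simp add: cinner_minus_right)

lemma cinner_Cauchy_Schwarz: "cmod (cinner x y) \<le> norm x * norm (y::'a::complex_hilbert_space)"
proof (cases "x = 0")
  case True
  then show ?thesis by simp
next
  case False
  define c where "c = cinner x y / complex_of_real ((norm x)\<^sup>2)"
  have "cinner x (c *\<^sub>C x) = cinner x y"
    using False by (simp add: cinner_scaleC_right cinner_self c_def)
  then have xy: "cinner x (y - c *\<^sub>C x) = 0"
    by (simp add: cinner_diff_right)
  have "(norm y)\<^sup>2 = (norm (c *\<^sub>C x + (y - c *\<^sub>C x)))\<^sup>2"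
    by simp
  also have "\<dots> = (norm (c *\<^sub>C x))\<^sup>2 + (norm (y - c *\<^sub>C x))\<^sup>2"
    unfolding norm_add_square by (simp add: cinner_scaleC_left xy)
  finally have "(norm (c *\<^sub>C x))\<^sup>2 \<le> (norm y)\<^sup>2"
    by simp
  then have "norm (c *\<^sub>C x) \<le> norm y"
    by (rule power2_le_imp_le) simp
  moreover have "norm (c *\<^sub>C x) = cmod (cinner x y) / norm x"
    using False by (simp add: norm_scaleC c_def norm_divide norm_mult power2_eq_square)
  ultimately show ?thesis
    using False by (simp add: divide_le_eq mult.commute)
qed

lemma riesz_representation:
  fixes f :: "'a::complex_hilbert_space \<Rightarrow> complex"
  assumes lin: "bounded_linear f" and hom: "\<And>c x. f (c *\<^sub>C x) = c * f x"
  shows "\<exists>y. \<forall>x. f x = cinner y x"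
proof (cases "\<forall>x. f x = 0")
  case True
  then show ?thesis
    by (intro exI[of _ 0]) simp
next
  case False
  then obtain x0 where x0: "f x0 \<noteq> 0" by blast
  define S where "S = {x. f x = 1}"
  have "inverse (f x0) *\<^sub>C x0 \<in> S"
    using x0 by (simp add: S_def hom)
  then have ne: "S \<noteq> {}" by blast
  define d where "d = (INF x\<in>S. norm x)"
  have bdd: "bdd_below (norm ` S)"
    by (rule bdd_belowI[of _ 0]) auto
  have d_le: "d \<le> norm x" if "x \<in> S" for x
    unfolding d_def using bdd that by (rule cINF_lower)
  have d0: "0 \<le> d"
    unfolding d_def using ne by (intro cINF_greatest) auto
  have "\<exists>x\<in>S. norm x < d + inverse (real (Suc n))" for n
    using cINF_less_iff[OF ne bdd, of "d + inverse (real (Suc n))"]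
    by (simp add: d_def)
  then obtain X where XS: "\<And>n. X n \<in> S" and Xd: "\<And>n. norm (X n) < d + inverse (real (Suc n))"
    by metis
  have Xlim: "(\<lambda>n. norm (X n)) \<longlonglongrightarrow> d"
  proof (rule tendsto_sandwich)
    show "\<forall>\<^sub>F n in sequentially. d \<le> norm (X n)"
      using d_le XS by simp
    show "\<forall>\<^sub>F n in sequentially. norm (X n) \<le> d + inverse (real (Suc n))"
      using Xd less_imp_le by (intro always_eventually allI) blast
    show "(\<lambda>n. d + inverse (real (Suc n))) \<longlonglongrightarrow> d"
      using tendsto_add[OF tendsto_const LIMSEQ_inverse_real_of_nat, of d] by simp
  qed simp
  have par: "(norm (x - y))\<^sup>2 \<le> 2 * (norm x)\<^sup>2 + 2 * (norm y)\<^sup>2 - 4 * d\<^sup>2"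
    if "x \<in> S" "y \<in> S" for x y
  proof -
    have "(1/2) *\<^sub>R (x + y) \<in> S"
      using that by (simp add: S_def linear_simps[OF lin] scaleR_conv_of_real)
    from d_le[OF this] have "2 * d \<le> norm (x + y)" by simp
    then have "(2 * d)\<^sup>2 \<le> (norm (x + y))\<^sup>2"
      using d0 by (intro power_mono) auto
    then show ?thesis
      unfolding norm_add_square norm_diff_square by (simp add: power_mult_distrib)
  qed
  have "Cauchy X"
  proof (rule metric_CauchyI)
    fix e :: real assume e: "0 < e"
    have "(\<lambda>n. (norm (X n))\<^sup>2) \<longlonglongrightarrow> d\<^sup>2"
      using Xlim by (intro tendsto_intros)
    then have "\<forall>\<^sub>F n in sequentially. (norm (X n))\<^sup>2 < d\<^sup>2 + e\<^sup>2 / 4"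
      by (rule order_tendstoD) (use e in simp)
    then obtain M where M: "\<And>n. n \<ge> M \<Longrightarrow> (norm (X n))\<^sup>2 < d\<^sup>2 + e\<^sup>2 / 4"
      unfolding eventually_sequentially by blast
    have "dist (X m) (X n) < e" if "m \<ge> M" "n \<ge> M" for m n
    proof -
      have "(norm (X m - X n))\<^sup>2 < e\<^sup>2"
        using par[OF XS XS, of m n] M[OF that(1)] M[OF that(2)] by linarith
      then show ?thesis
        unfolding dist_norm using e by (auto intro: power2_less_imp_less[OF _ less_imp_le])
    qed
    then show "\<exists>M. \<forall>m\<ge>M. \<forall>n\<ge>M. dist (X m) (X n) < e" by blast
  qed
  then obtain z where z: "X \<longlonglongrightarrow> z"
    using Cauchy_convergent_iff convergent_def by blast
  have "(\<lambda>n. f (X n)) \<longlonglongrightarrow> f z"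
    using bounded_linear.tendsto[OF lin z] .
  then have fz: "f z = 1"
    using XS by (simp add: S_def LIMSEQ_const_iff)
  have nz: "norm z = d"
    using tendsto_norm[OF z] Xlim by (rule LIMSEQ_unique)
  have z0: "z \<noteq> 0"
    using fz linear_simps(3)[OF lin] by auto
  have orth: "cinner z v = 0" if v: "f v = 0" for v
  proof (cases "v = 0")
    case True
    then show ?thesis by simp
  next
    case False
    define c where "c = cinner v z / complex_of_real ((norm v)\<^sup>2)"
    have "cinner v (c *\<^sub>C v) = cinner v z"
      using False by (simp add: cinner_scaleC_right cinner_self c_def)
    then have 0: "cinner v (z - c *\<^sub>C v) = 0"
      by (simp add: cinner_diff_right)
    have "z - c *\<^sub>C v \<in> S"
      using v by (simp add: S_def linear_simps[OF lin] hom fz)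
    then have le: "norm z \<le> norm (z - c *\<^sub>C v)"
      using d_le nz by simp
    have "(norm z)\<^sup>2 = (norm (c *\<^sub>C v + (z - c *\<^sub>C v)))\<^sup>2"
      by simp
    also have "\<dots> = (norm (c *\<^sub>C v))\<^sup>2 + (norm (z - c *\<^sub>C v))\<^sup>2"
      unfolding norm_add_square by (simp add: cinner_scaleC_left 0)
    finally have "(norm (c *\<^sub>C v))\<^sup>2 \<le> 0"
      using power_mono[OF le, of 2] by simp
    then have "cmod c * norm v = 0"
      by (simp add: norm_scaleC)
    then have "cinner v z = 0"
      using False by (simp add: c_def)
    then show ?thesis
      using cinner_commute[of z v] by simp
  qed
  define y where "y = complex_of_real (inverse ((norm z)\<^sup>2)) *\<^sub>C z"
  have "f x = cinner y x" for x
  proof -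
    have "f (x - f x *\<^sub>C z) = 0"
      by (simp add: linear_simps[OF lin] hom fz)
    then have "cinner z x = f x * cinner z z"
      using orth by (fastforce simp: cinner_diff_right cinner_scaleC_right)
    then show ?thesis
      using z0 by (simp add: y_def cinner_scaleC_left cinner_self)
  qed
  then show ?thesis by blast
qed

lemma adjoint_exists:
  fixes T :: "'a::complex_hilbert_space \<Rightarrow> 'a"
  assumes T: "bounded_clinear T"
  obtains S where "bounded_clinear S" "\<And>x y. cinner (S x) y = cinner x (T y)"
proof -
  from T have lin: "bounded_linear T" and hom: "\<And>c x. T (c *\<^sub>C x) = c *\<^sub>C T x"
    by (auto simp: bounded_clinear_iff)
  obtain K where K: "\<And>x. norm (T x) \<le> norm x * K" and K0: "0 \<le> K"
    using bounded_linear.nonneg_bounded[OF lin] by blast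
  have "\<exists>z. \<forall>y. cinner x (T y) = cinner z y" for x
  proof (rule riesz_representation)
    show "bounded_linear (\<lambda>y. cinner x (T y))"
    proof (rule bounded_linear_intro[where K = "norm x * K"])
      show "cinner x (T (y + z)) = cinner x (T y) + cinner x (T z)" for y z
        by (simp add: linear_simps[OF lin] cinner_add_right)
      show "cinner x (T (r *\<^sub>R y)) = r *\<^sub>R cinner x (T y)" for r y
        using cinner_scaleC_right[of x "complex_of_real r" "T y"]
        by (simp add: linear_simps[OF lin] scaleC_of_real scaleR_conv_of_real)
      show "cmod (cinner x (T y)) \<le> norm y * (norm x * K)" for y
        using cinner_Cauchy_Schwarz[of x "T y"] mult_left_mono[OF K[of y] norm_ge_zero[of x]]
        by (simp add: algebra_simps)
    qed
  qed (simp add: hom cinner_scaleC_right)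
  then obtain S where S: "\<And>x y. cinner x (T y) = cinner (S x) y"
    by metis
  have S': "cinner y (S x) = cinner (T y) x" for x y
    using S[of x y] cinner_commute[of y "S x"] cinner_commute[of "T y" x] by simp
  have "clinear S"
    unfolding clinear_def
  proof (intro conjI allI)
    show "S (x + y) = S x + S y" for x y
      by (rule cinner_extensionality) (simp add: S' cinner_add_right)
    show "S (c *\<^sub>C x) = c *\<^sub>C S x" for c x
      by (rule cinner_extensionality) (simp add: S' cinner_scaleC_right)
  qed
  moreover have "norm (S x) \<le> K * norm x" for x
  proof (cases "S x = 0")
    case False
    have "(norm (S x))\<^sup>2 = cmod (cinner (S x) (S x))"
      unfolding cinner_self norm_of_real by simp
    also have "\<dots> = cmod (cinner x (T (S x)))"
      by (simp add: S)
    also have "\<dots> \<le> norm x * (norm (S x) * K)"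
      using cinner_Cauchy_Schwarz[of x "T (S x)"] mult_left_mono[OF K[of "S x"] norm_ge_zero[of x]]
      by linarith
    finally show ?thesis
      using False by (simp add: power2_eq_square algebra_simps)
  qed (use K0 in simp)
  ultimately show thesis
    using that[of S] S by (auto simp: bounded_clinear_def)
qed


section \<open>The C*-algebra \<open>B(H)\<close>\<close>

typedef (overloaded) 'h bounded_op = "{T :: 'h::complex_hilbert_space \<Rightarrow> 'h. bounded_clinear T}"
  morphisms op_apply Bounded_op
  by (rule exI[of _ "\<lambda>x. 0"]) (auto simp: bounded_clinear_iff)

setup_lifting type_definition_bounded_op

lemma op_eqI: "(\<And>x. op_apply S x = op_apply T x) \<Longrightarrow> S = T"
  by transfer auto

lemma bounded_clinear_op: "bounded_clinear (op_apply T)"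
  by transfer simp

lemma bounded_linear_op: "bounded_linear (op_apply T)"
  using bounded_clinear_op bounded_clinear_iff by blast

instantiation bounded_op :: (complex_hilbert_space) real_normed_vector
begin

lift_definition zero_bounded_op :: "'a bounded_op" is "\<lambda>x. 0"
  by (simp add: bounded_clinear_iff)

lift_definition plus_bounded_op :: "'a bounded_op \<Rightarrow> 'a bounded_op \<Rightarrow> 'a bounded_op"
  is "\<lambda>S T x. S x + T x"
  by (auto simp: bounded_clinear_iff scaleC_add_right intro: bounded_linear_add)

lift_definition uminus_bounded_op :: "'a bounded_op \<Rightarrow> 'a bounded_op"
  is "\<lambda>T x. - T x"
  by (auto simp: bounded_clinear_iff scaleC_minus_right intro: bounded_linear_minus)

lift_definition minus_bounded_op :: "'a bounded_op \<Rightarrow> 'a bounded_op \<Rightarrow> 'a bounded_op"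
  is "\<lambda>S T x. S x - T x"
  by (auto simp: bounded_clinear_iff linear_simps[OF bounded_linear_scaleC_right]
      intro: bounded_linear_sub)

lift_definition scaleR_bounded_op :: "real \<Rightarrow> 'a bounded_op \<Rightarrow> 'a bounded_op"
  is "\<lambda>r T x. r *\<^sub>R T x"
  by (auto simp: bounded_clinear_iff linear_simps[OF bounded_linear_scaleC_right]
      intro: bounded_linear_const_scaleR)

lift_definition norm_bounded_op :: "'a bounded_op \<Rightarrow> real" is onorm .

definition sgn_bounded_op :: "'a bounded_op \<Rightarrow> 'a bounded_op" where
  "sgn_bounded_op T = inverse (norm T) *\<^sub>R T"

definition dist_bounded_op :: "'a bounded_op \<Rightarrow> 'a bounded_op \<Rightarrow> real" where
  "dist_bounded_op S T = norm (S - T)"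

definition uniformity_bounded_op :: "('a bounded_op \<times> 'a bounded_op) filter" where
  "uniformity_bounded_op = (INF e\<in>{0 <..}. principal {(x, y). dist x y < e})"

definition open_bounded_op :: "'a bounded_op set \<Rightarrow> bool" where
  "open_bounded_op S = (\<forall>x\<in>S. \<forall>\<^sub>F (x', y) in uniformity. x' = x \<longrightarrow> y \<in> S)"

lemma bounded_op_norm_triangle: "norm (S + T) \<le> norm S + norm T" for S T :: "'a bounded_op"
  unfolding norm_bounded_op.rep_eq plus_bounded_op.rep_eq
  by (rule onorm_triangle[OF bounded_linear_op bounded_linear_op])

lemma bounded_op_norm_scaleR: "norm (r *\<^sub>R T) = \<bar>r\<bar> * norm T" for T :: "'a bounded_op"
  unfolding norm_bounded_op.rep_eq scaleR_bounded_op.rep_eq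
  by (rule onorm_scaleR[OF bounded_linear_op])

lemma bounded_op_norm_eq_0: "norm T = 0 \<longleftrightarrow> T = 0" for T :: "'a bounded_op"
  unfolding norm_bounded_op.rep_eq onorm_eq_0[OF bounded_linear_op]
  by transfer auto

instance
proof
  fix S T U :: "'a bounded_op" and r s :: real
  note simps = zero_bounded_op.rep_eq plus_bounded_op.rep_eq uminus_bounded_op.rep_eq
    minus_bounded_op.rep_eq scaleR_bounded_op.rep_eq
  show "S + T + U = S + (T + U)" by (rule op_eqI) (simp add: simps)
  show "S + T = T + S" by (rule op_eqI) (simp add: simps)
  show "0 + S = S" by (rule op_eqI) (simp add: simps)
  show "- S + S = 0" by (rule op_eqI) (simp add: simps)
  show "S - T = S + - T" by (rule op_eqI) (simp add: simps)
  show "r *\<^sub>R (S + T) = r *\<^sub>R S + r *\<^sub>R T" by (rule op_eqI) (simp add: simps scaleR_add_right)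
  show "(r + s) *\<^sub>R T = r *\<^sub>R T + s *\<^sub>R T" by (rule op_eqI) (simp add: simps scaleR_add_left)
  show "r *\<^sub>R s *\<^sub>R T = (r * s) *\<^sub>R T" by (rule op_eqI) (simp add: simps)
  show "1 *\<^sub>R T = T" by (rule op_eqI) (simp add: simps)
  show "norm (S + T) \<le> norm S + norm T" by (rule bounded_op_norm_triangle)
  show "norm (r *\<^sub>R T) = \<bar>r\<bar> * norm T" by (rule bounded_op_norm_scaleR)
  show "norm T = 0 \<longleftrightarrow> T = 0" by (rule bounded_op_norm_eq_0)
qed (rule sgn_bounded_op_def dist_bounded_op_def uniformity_bounded_op_def open_bounded_op_def)+

end

instantiation bounded_op :: (complex_hilbert_space) unital_cstar_algebra
begin

lift_definition one_bounded_op :: "'a bounded_op" is "\<lambda>x. x"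
  by (simp add: bounded_clinear_iff bounded_linear_ident)

lift_definition times_bounded_op :: "'a bounded_op \<Rightarrow> 'a bounded_op \<Rightarrow> 'a bounded_op"
  is "\<lambda>S T x. S (T x)"
  by (auto simp: bounded_clinear_iff intro: bounded_linear_compose)

lift_definition scaleC_bounded_op :: "complex \<Rightarrow> 'a bounded_op \<Rightarrow> 'a bounded_op"
  is "\<lambda>c T x. c *\<^sub>C T x"
  by (auto simp: bounded_clinear_iff scaleC_scaleC mult.commute
      intro: bounded_linear_compose[OF bounded_linear_scaleC_right])

definition star_bounded_op :: "'a bounded_op \<Rightarrow> 'a bounded_op" where
  "star_bounded_op T = (THE S. \<forall>x y. cinner (op_apply S x) y = cinner x (op_apply T y))"

lemmas op_apply_simps = zero_bounded_op.rep_eq one_bounded_op.rep_eq plus_bounded_op.rep_eq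
  uminus_bounded_op.rep_eq minus_bounded_op.rep_eq times_bounded_op.rep_eq
  scaleR_bounded_op.rep_eq scaleC_bounded_op.rep_eq

lemma cinner_star_left:
  "cinner (op_apply (star T) x) y = cinner x (op_apply T y)" for T :: "'a bounded_op"
proof -
  have "\<exists>!S. \<forall>x y. cinner (op_apply S x) y = cinner x (op_apply T y)"
  proof (rule ex_ex1I)
    obtain S where "bounded_clinear S" "\<And>x y. cinner (S x) y = cinner x (op_apply T y)"
      using adjoint_exists[OF bounded_clinear_op] by blast
    then show "\<exists>S. \<forall>x y. cinner (op_apply S x) y = cinner x (op_apply T y)"
      by (intro exI[of _ "Bounded_op S"]) (simp add: Bounded_op_inverse)
  next
    fix S S'
    assume "\<forall>x y. cinner (op_apply S x) y = cinner x (op_apply T y)"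
      and "\<forall>x y. cinner (op_apply S' x) y = cinner x (op_apply T y)"
    then show "S = S'"
      by (intro op_eqI cinner_extensionality) (metis cinner_commute)
  qed
  from theI'[OF this] show ?thesis
    unfolding star_bounded_op_def by blast
qed

lemma cinner_star_right:
  "cinner x (op_apply (star T) y) = cinner (op_apply T x) y" for T :: "'a bounded_op"
  by (metis cinner_commute cinner_star_left)

lemma norm_op_apply: "norm (op_apply T x) \<le> norm T * norm x" for T :: "'a bounded_op"
  unfolding norm_bounded_op.rep_eq by (rule onorm[OF bounded_linear_op])

lemma norm_op_bound: "(\<And>x. norm (op_apply T x) \<le> b * norm x) \<Longrightarrow> 0 \<le> b \<Longrightarrow> norm T \<le> b"
  for T :: "'a bounded_op"
  unfolding norm_bounded_op.rep_eq by (rule onorm_bound) auto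

lemma norm_op_ge_zero: "0 \<le> norm T" for T :: "'a bounded_op"
  unfolding norm_bounded_op.rep_eq by (rule onorm_pos_le[OF bounded_linear_op])

lemma bounded_op_norm_mult: "norm (S * T) \<le> norm S * norm T" for S T :: "'a bounded_op"
  unfolding norm_bounded_op.rep_eq times_bounded_op.rep_eq
  using onorm_compose[OF bounded_linear_op bounded_linear_op] by (simp add: o_def)

lemma bounded_op_cstar_identity: "norm (star T * T) = (norm T)\<^sup>2" for T :: "'a bounded_op"
proof -
  have lower: "(norm S)\<^sup>2 \<le> norm (star S * S)" for S :: "'a bounded_op"
  proof -
    have "norm S \<le> sqrt (norm (star S * S))"
    proof (rule norm_op_bound)
      fix x
      have "(norm (op_apply S x))\<^sup>2 = cmod (cinner (op_apply S x) (op_apply S x))"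
        unfolding cinner_self norm_of_real by simp
      also have "\<dots> = cmod (cinner x (op_apply (star S * S) x))"
        by (simp add: op_apply_simps cinner_star_right)
      also have "\<dots> \<le> norm x * (norm (star S * S) * norm x)"
        by (rule order_trans[OF cinner_Cauchy_Schwarz])
          (intro mult_left_mono norm_op_apply norm_ge_zero)
      also have "\<dots> = (sqrt (norm (star S * S)) * norm x)\<^sup>2"
        by (simp add: power_mult_distrib norm_op_ge_zero power2_eq_square[of "norm x"])
      finally show "norm (op_apply S x) \<le> sqrt (norm (star S * S)) * norm x"
        by (rule power2_le_imp_le) (simp add: norm_op_ge_zero)
    qed (simp add: norm_op_ge_zero)
    then have "(norm S)\<^sup>2 \<le> (sqrt (norm (star S * S)))\<^sup>2"
      by (intro power_mono norm_op_ge_zero)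
    then show ?thesis
      by (simp add: norm_op_ge_zero)
  qed
  have norm_le: "norm S \<le> norm (star S)" for S :: "'a bounded_op"
  proof (cases "norm S = 0")
    case False
    have "norm S * norm S \<le> norm (star S) * norm S"
      using lower[of S] bounded_op_norm_mult[of "star S" S] by (simp add: power2_eq_square)
    then show ?thesis
      using False norm_op_ge_zero[of S] by (simp add: mult_le_cancel_right)
  qed (simp add: norm_op_ge_zero)
  have "star (star T) = T"
    by (intro op_eqI cinner_extensionality) (simp add: cinner_star_left cinner_star_right)
  then have "norm (star T) \<le> norm T"
    using norm_le[of "star T"] by simp
  then have "norm (star T * T) \<le> norm T * norm T"
    by (rule order_trans[OF bounded_op_norm_mult mult_right_mono[OF _ norm_op_ge_zero]])
  then show ?thesis
    using lower[of T] by (simp add: power2_eq_square)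
qed

lemma bounded_op_norm_scaleC: "norm (c *\<^sub>C T) = cmod c * norm T" for T :: "'a bounded_op"
proof -
  have le: "norm (c *\<^sub>C T) \<le> cmod c * norm T" for c and T :: "'a bounded_op"
    by (rule norm_op_bound)
      (auto simp: op_apply_simps norm_scaleC norm_op_ge_zero mult.assoc
        intro!: mult_left_mono norm_op_apply)
  show ?thesis
  proof (cases "c = 0")
    case True
    then show ?thesis
      using le[of 0 T] norm_op_ge_zero[of "0 *\<^sub>C T"] by simp
  next
    case False
    have "inverse c *\<^sub>C c *\<^sub>C T = T"
      by (rule op_eqI) (use False in \<open>simp add: op_apply_simps scaleC_scaleC\<close>)
    then have "norm T \<le> inverse (cmod c) * norm (c *\<^sub>C T)"
      using le[of "inverse c" "c *\<^sub>C T"] by (simp add: norm_inverse)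
    then have "cmod c * norm T \<le> norm (c *\<^sub>C T)"
      using False by (simp add: field_simps)
    then show ?thesis
      using le[of c T] by simp
  qed
qed

lemma bounded_op_complete:
  fixes X :: "nat \<Rightarrow> 'a bounded_op"
  assumes X: "Cauchy X"
  shows "convergent X"
proof -
  define Y where "Y n = Blinfun (op_apply (X n))" for n
  have Y: "blinfun_apply (Y n) = op_apply (X n)" for n
    unfolding Y_def by (rule bounded_linear_Blinfun_apply[OF bounded_linear_op])
  have nY: "norm (Y m - Y n) = norm (X m - X n)" for m n
    by (simp add: norm_blinfun.rep_eq norm_bounded_op.rep_eq minus_blinfun.rep_eq
        minus_bounded_op.rep_eq Y)
  have "Cauchy Y"
    using X by (simp add: Cauchy_iff nY)
  then obtain L where L: "Y \<longlonglongrightarrow> L"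
    using Cauchy_convergent_iff convergent_def by blast
  have pt: "(\<lambda>n. op_apply (X n) x) \<longlonglongrightarrow> blinfun_apply L x" for x
    using blinfun.tendsto[OF L tendsto_const, of x] by (simp add: Y)
  have "blinfun_apply L (c *\<^sub>C x) = c *\<^sub>C blinfun_apply L x" for c x
  proof (rule LIMSEQ_unique[OF pt])
    have "(\<lambda>n. c *\<^sub>C op_apply (X n) x) \<longlonglongrightarrow> c *\<^sub>C blinfun_apply L x"
      by (rule bounded_linear.tendsto[OF bounded_linear_scaleC_right pt])
    moreover have "op_apply (X n) (c *\<^sub>C x) = c *\<^sub>C op_apply (X n) x" for n
      using bounded_clinear_op[of "X n"] by (simp add: bounded_clinear_iff)
    ultimately show "(\<lambda>n. op_apply (X n) (c *\<^sub>C x)) \<longlonglongrightarrow> c *\<^sub>C blinfun_apply L x"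
      by simp
  qed
  then have bc: "bounded_clinear (blinfun_apply L)"
    by (simp add: bounded_clinear_iff blinfun.bounded_linear_right)
  have "norm (X n - Bounded_op (blinfun_apply L)) = norm (Y n - L)" for n
    by (simp add: norm_blinfun.rep_eq norm_bounded_op.rep_eq minus_blinfun.rep_eq
        minus_bounded_op.rep_eq Y Bounded_op_inverse bc)
  moreover have "(\<lambda>n. norm (Y n - L)) \<longlonglongrightarrow> 0"
    using L by (simp add: LIM_zero tendsto_norm_zero)
  ultimately have "(\<lambda>n. norm (X n - Bounded_op (blinfun_apply L))) \<longlonglongrightarrow> 0"
    by (simp only:)
  then have "(\<lambda>n. X n - Bounded_op (blinfun_apply L)) \<longlonglongrightarrow> 0"
    by (rule tendsto_norm_zero_cancel)
  then show ?thesis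
    unfolding convergent_def by (metis LIM_zero_cancel)
qed

instance
proof
  fix S T U :: "'a bounded_op" and r s :: real and c d :: complex
    and X :: "nat \<Rightarrow> 'a bounded_op"
  have lin: "op_apply S (x + y) = op_apply S x + op_apply S y"
    "op_apply S (r *\<^sub>R x) = r *\<^sub>R op_apply S x"
    "op_apply S (c *\<^sub>C x) = c *\<^sub>C op_apply S x" for S :: "'a bounded_op" and x y r c
    using bounded_linear_op[of S] bounded_clinear_op[of S]
    by (auto simp: linear_simps bounded_clinear_iff)
  note simps = op_apply_simps lin scaleC_scaleC scaleC_add_left scaleC_add_right scaleC_of_real
  show "S * T * U = S * (T * U)" by (rule op_eqI) (simp add: simps)
  show "(S + T) * U = S * U + T * U" by (rule op_eqI) (simp add: simps)
  show "S * (T + U) = S * T + S * U" by (rule op_eqI) (simp add: simps)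
  show "(r *\<^sub>R S) * T = r *\<^sub>R (S * T)" by (rule op_eqI) (simp add: simps)
  show "S * (r *\<^sub>R T) = r *\<^sub>R (S * T)" by (rule op_eqI) (simp add: simps)
  show "1 * T = T" by (rule op_eqI) (simp add: simps)
  show "T * 1 = T" by (rule op_eqI) (simp add: simps)
  show "c *\<^sub>C (S + T) = c *\<^sub>C S + c *\<^sub>C T" by (rule op_eqI) (simp add: simps)
  show "(c + d) *\<^sub>C T = c *\<^sub>C T + d *\<^sub>C T" by (rule op_eqI) (simp add: simps)
  show "c *\<^sub>C d *\<^sub>C T = (c * d) *\<^sub>C T" by (rule op_eqI) (simp add: simps)
  show "complex_of_real r *\<^sub>C T = r *\<^sub>R T" by (rule op_eqI) (simp add: simps)
  show "(c *\<^sub>C S) * T = c *\<^sub>C (S * T)" by (rule op_eqI) (simp add: simps)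
  show "S * (c *\<^sub>C T) = c *\<^sub>C (S * T)" by (rule op_eqI) (simp add: simps)
  show "star (star T) = T"
    by (intro op_eqI cinner_extensionality) (simp add: cinner_star_left cinner_star_right)
  show "star (S + T) = star S + star T"
    by (intro op_eqI cinner_extensionality)
      (simp add: cinner_star_right cinner_add_left cinner_add_right simps)
  show "star (S * T) = star T * star S"
    by (intro op_eqI cinner_extensionality) (simp add: cinner_star_right simps)
  show "star (c *\<^sub>C T) = cnj c *\<^sub>C star T"
    by (intro op_eqI cinner_extensionality)
      (simp add: cinner_star_right cinner_scaleC_left cinner_scaleC_right simps)
  show "norm (star T * T) = (norm T)\<^sup>2" by (rule bounded_op_cstar_identity)
  show "norm (S * T) \<le> norm S * norm T" by (rule bounded_op_norm_mult)
  show "norm (c *\<^sub>C T) = cmod c * norm T" by (rule bounded_op_norm_scaleC)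
  show "Cauchy X \<Longrightarrow> convergent X" by (rule bounded_op_complete)
qed

end


section \<open>The C*-algebra \<open>c\<^sub>0(A)\<close>\<close>

text \<open>The block-diagonal element \<open>diag {a\<^sub>k}\<^sub>k\<close> of the spatial tensor product
  \<open>B(l\<^sup>2) \<otimes> A\<close> is represented by the null sequence \<open>(a\<^sub>k)\<^sub>k\<close>.\<close>

typedef (overloaded) 'a c0 = "{x :: nat \<Rightarrow> 'a::cstar_algebra. x \<longlonglongrightarrow> 0}"
  morphisms entry diag
  by (rule exI[of _ "\<lambda>k. 0"]) simp

setup_lifting type_definition_c0

lemma c0_eqI: "(\<And>k. entry x k = entry y k) \<Longrightarrow> x = y"
  by transfer auto

lemma entry_tendsto: "entry x \<longlonglongrightarrow> 0"
  by transfer simp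

lemma bdd_above_entry: "bdd_above (range (\<lambda>k. norm (entry x k)))"
proof -
  have "Bseq (\<lambda>k. norm (entry x k))"
    by (intro convergent_imp_Bseq convergentI[of _ "norm (0::'a)"] tendsto_norm entry_tendsto)
  then have "bounded (range (\<lambda>k. norm (entry x k)))"
    by (simp add: Bseq_eq_bounded)
  then show ?thesis
    by (rule bounded_imp_bdd_above)
qed

instantiation c0 :: (cstar_algebra) real_normed_vector
begin

lift_definition zero_c0 :: "'a c0" is "\<lambda>k. 0"
  by simp

lift_definition plus_c0 :: "'a c0 \<Rightarrow> 'a c0 \<Rightarrow> 'a c0" is "\<lambda>x y k. x k + y k"
  by (rule tendsto_add_zero)

lift_definition uminus_c0 :: "'a c0 \<Rightarrow> 'a c0" is "\<lambda>x k. - x k"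
  using tendsto_minus by fastforce

lift_definition minus_c0 :: "'a c0 \<Rightarrow> 'a c0 \<Rightarrow> 'a c0" is "\<lambda>x y k. x k - y k"
  using tendsto_diff by fastforce

lift_definition scaleR_c0 :: "real \<Rightarrow> 'a c0 \<Rightarrow> 'a c0" is "\<lambda>r x k. r *\<^sub>R x k"
  using tendsto_scaleR[OF tendsto_const] by fastforce

definition norm_c0 :: "'a c0 \<Rightarrow> real" where
  "norm_c0 x = (SUP k. norm (entry x k))"

definition sgn_c0 :: "'a c0 \<Rightarrow> 'a c0" where
  "sgn_c0 x = inverse (norm x) *\<^sub>R x"

definition dist_c0 :: "'a c0 \<Rightarrow> 'a c0 \<Rightarrow> real" where
  "dist_c0 x y = norm (x - y)"

definition uniformity_c0 :: "('a c0 \<times> 'a c0) filter" where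
  "uniformity_c0 = (INF e\<in>{0 <..}. principal {(x, y). dist x y < e})"

definition open_c0 :: "'a c0 set \<Rightarrow> bool" where
  "open_c0 S = (\<forall>x\<in>S. \<forall>\<^sub>F (x', y) in uniformity. x' = x \<longrightarrow> y \<in> S)"

lemma norm_entry_le: "norm (entry x k) \<le> norm x" for x :: "'a c0"
  unfolding norm_c0_def by (rule cSUP_upper[OF _ bdd_above_entry]) simp

lemma norm_c0_le: "(\<And>k. norm (entry x k) \<le> b) \<Longrightarrow> norm x \<le> b" for x :: "'a c0"
  unfolding norm_c0_def by (rule cSUP_least) auto

lemma norm_c0_scaled:
  fixes x y :: "'a c0"
  assumes "\<And>k. norm (entry y k) = b * norm (entry x k)" "0 \<le> b"
  shows "norm y = b * norm x"
proof (rule antisym)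
  show "norm y \<le> b * norm x"
    by (rule norm_c0_le) (use assms norm_entry_le in \<open>auto intro: mult_left_mono\<close>)
  show "b * norm x \<le> norm y"
  proof (cases "b = 0")
    case True
    then show ?thesis
      using norm_entry_le[of y 0] norm_ge_zero[of "entry y 0"] by (simp del: norm_ge_zero)
  next
    case False
    then have b: "0 < b" using assms(2) by simp
    have "norm x \<le> norm y / b"
    proof (rule norm_c0_le)
      show "norm (entry x k) \<le> norm y / b" for k
        using norm_entry_le[of y k] b by (simp add: assms(1) pos_le_divide_eq mult.commute)
    qed
    then show ?thesis
      using b by (simp add: pos_le_divide_eq mult.commute)
  qed
qed

instance
proof
  fix x y z :: "'a c0" and r s :: real
  note simps = zero_c0.rep_eq plus_c0.rep_eq uminus_c0.rep_eq minus_c0.rep_eq scaleR_c0.rep_eq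
  show "x + y + z = x + (y + z)" by (rule c0_eqI) (simp add: simps)
  show "x + y = y + x" by (rule c0_eqI) (simp add: simps)
  show "0 + x = x" by (rule c0_eqI) (simp add: simps)
  show "- x + x = 0" by (rule c0_eqI) (simp add: simps)
  show "x - y = x + - y" by (rule c0_eqI) (simp add: simps)
  show "r *\<^sub>R (x + y) = r *\<^sub>R x + r *\<^sub>R y" by (rule c0_eqI) (simp add: simps scaleR_add_right)
  show "(r + s) *\<^sub>R x = r *\<^sub>R x + s *\<^sub>R x" by (rule c0_eqI) (simp add: simps scaleR_add_left)
  show "r *\<^sub>R s *\<^sub>R x = (r * s) *\<^sub>R x" by (rule c0_eqI) (simp add: simps)
  show "1 *\<^sub>R x = x" by (rule c0_eqI) (simp add: simps)
  show "norm (x + y) \<le> norm x + norm y"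
    by (rule norm_c0_le) (simp add: simps norm_triangle_mono norm_entry_le)
  show "norm (r *\<^sub>R x) = \<bar>r\<bar> * norm x"
    by (rule norm_c0_scaled) (auto simp: simps)
  show "norm x = 0 \<longleftrightarrow> x = 0"
  proof
    assume "norm x = 0"
    then show "x = 0"
      by (intro c0_eqI) (metis norm_entry_le norm_le_zero_iff zero_c0.rep_eq)
  qed (simp add: norm_c0_def simps)
qed (rule sgn_c0_def dist_c0_def uniformity_c0_def open_c0_def)+

end

lemma star_0 [simp]: "star (0::'a::cstar_algebra) = 0"
  using star_add[of 0 "0::'a"] by simp

lemma norm_star: "norm (star a) = norm (a::'a::cstar_algebra)"
proof -
  have le: "norm b \<le> norm (star b)" for b :: 'a
  proof (cases "b = 0")
    case False
    have "norm b * norm b \<le> norm (star b) * norm b"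
      using norm_mult_ineq[of "star b" b] cstar_identity[of b] by (simp add: power2_eq_square)
    then show ?thesis
      using False by simp
  qed simp
  show ?thesis
    using le[of a] le[of "star a"] by (simp add: star_star)
qed

instantiation c0 :: (cstar_algebra) cstar_algebra
begin

lift_definition times_c0 :: "'a c0 \<Rightarrow> 'a c0 \<Rightarrow> 'a c0" is "\<lambda>x y k. x k * y k"
  by (rule tendsto_mult_zero)

lift_definition scaleC_c0 :: "complex \<Rightarrow> 'a c0 \<Rightarrow> 'a c0" is "\<lambda>c x k. c *\<^sub>C x k"
  using bounded_linear.tendsto_zero[OF bounded_linear_scaleC_right] by fastforce

lift_definition star_c0 :: "'a c0 \<Rightarrow> 'a c0" is "\<lambda>x k. star (x k)"
  by (rule tendsto_norm_zero_cancel) (simp add: norm_star tendsto_norm_zero)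

lemma c0_complete:
  fixes X :: "nat \<Rightarrow> 'a c0"
  assumes X: "Cauchy X"
  shows "convergent X"
proof -
  have X_entry: "norm (entry (X m) k - entry (X n) k) \<le> norm (X m - X n)" for m n k
    using norm_entry_le[of "X m - X n" k] by (simp add: minus_c0.rep_eq)
  have "Cauchy (\<lambda>n. entry (X n) k)" for k
    unfolding Cauchy_iff
  proof (intro allI impI)
    fix e :: real assume "0 < e"
    then obtain M where "\<forall>m\<ge>M. \<forall>n\<ge>M. norm (X m - X n) < e"
      using X unfolding Cauchy_iff by blast
    then show "\<exists>M. \<forall>m\<ge>M. \<forall>n\<ge>M. norm (entry (X m) k - entry (X n) k) < e"
      using le_less_trans[OF X_entry] by blast
  qed
  then have "\<exists>l. (\<lambda>n. entry (X n) k) \<longlonglongrightarrow> l" for k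
    using Cauchy_convergent_iff convergent_def by blast
  then obtain L where L: "\<And>k. (\<lambda>n. entry (X n) k) \<longlonglongrightarrow> L k"
    by metis
  have unif: "\<exists>M. \<forall>n\<ge>M. \<forall>k. norm (entry (X n) k - L k) \<le> e" if "e > 0" for e
  proof -
    obtain M where M: "\<forall>m\<ge>M. \<forall>n\<ge>M. norm (X m - X n) < e"
      using X \<open>e > 0\<close> unfolding Cauchy_iff by blast
    have "norm (entry (X n) k - L k) \<le> e" if "n \<ge> M" for n k
    proof (rule LIMSEQ_le_const2)
      show "(\<lambda>m. norm (entry (X n) k - entry (X m) k)) \<longlonglongrightarrow> norm (entry (X n) k - L k)"
        by (intro tendsto_intros L)
      show "\<exists>N. \<forall>m\<ge>N. norm (entry (X n) k - entry (X m) k) \<le> e"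
        using M that order_trans[OF X_entry less_imp_le] by blast
    qed
    then show ?thesis by blast
  qed
  have "L \<longlonglongrightarrow> 0"
  proof (rule LIMSEQ_I)
    fix e :: real assume e: "0 < e"
    obtain n where n: "\<And>k. norm (entry (X n) k - L k) \<le> e / 2"
      using unif[of "e / 2"] e by auto
    obtain K where K: "\<And>k. k \<ge> K \<Longrightarrow> norm (entry (X n) k) < e / 2"
      using LIMSEQ_D[OF entry_tendsto, of "e / 2" "X n"] e by auto
    have "norm (L k) < e" if "k \<ge> K" for k
      using n[of k] K[OF that] norm_triangle_sub[of "L k" "entry (X n) k"]
        norm_minus_commute[of "L k" "entry (X n) k"] by linarith
    then show "\<exists>K. \<forall>k\<ge>K. norm (L k - 0) < e" by auto
  qed
  then have diag_L: "entry (diag L) = L"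
    by (simp add: diag_inverse)
  have "X \<longlonglongrightarrow> diag L"
  proof (rule LIMSEQ_I)
    fix e :: real assume e: "0 < e"
    obtain M where M: "\<forall>n\<ge>M. \<forall>k. norm (entry (X n) k - L k) \<le> e / 2"
      using unif[of "e / 2"] e by auto
    have "norm (X n - diag L) \<le> e / 2" if "n \<ge> M" for n
      by (rule norm_c0_le) (use M that in \<open>simp add: minus_c0.rep_eq diag_L\<close>)
    then show "\<exists>M. \<forall>n\<ge>M. norm (X n - diag L) < e"
      using e by (intro exI[of _ M]) fastforce
  qed
  then show ?thesis by (rule convergentI)
qed

instance
proof
  fix x y z :: "'a c0" and r :: real and c d :: complex and X :: "nat \<Rightarrow> 'a c0"
  note simps = zero_c0.rep_eq plus_c0.rep_eq scaleR_c0.rep_eq times_c0.rep_eq scaleC_c0.rep_eq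
    star_c0.rep_eq
  show "x * y * z = x * (y * z)" by (rule c0_eqI) (simp add: simps mult.assoc)
  show "(x + y) * z = x * z + y * z" by (rule c0_eqI) (simp add: simps distrib_right)
  show "x * (y + z) = x * y + x * z" by (rule c0_eqI) (simp add: simps distrib_left)
  show "(r *\<^sub>R x) * y = r *\<^sub>R (x * y)" by (rule c0_eqI) (simp add: simps)
  show "x * (r *\<^sub>R y) = r *\<^sub>R (x * y)" by (rule c0_eqI) (simp add: simps)
  show "c *\<^sub>C (x + y) = c *\<^sub>C x + c *\<^sub>C y" by (rule c0_eqI) (simp add: simps scaleC_add_right)
  show "(c + d) *\<^sub>C x = c *\<^sub>C x + d *\<^sub>C x" by (rule c0_eqI) (simp add: simps scaleC_add_left)
  show "c *\<^sub>C d *\<^sub>C x = (c * d) *\<^sub>C x" by (rule c0_eqI) (simp add: simps scaleC_scaleC)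
  show "complex_of_real r *\<^sub>C x = r *\<^sub>R x" by (rule c0_eqI) (simp add: simps scaleC_of_real)
  show "(c *\<^sub>C x) * y = c *\<^sub>C (x * y)" by (rule c0_eqI) (simp add: simps scaleC_mult_left)
  show "x * (c *\<^sub>C y) = c *\<^sub>C (x * y)" by (rule c0_eqI) (simp add: simps scaleC_mult_right)
  show "star (star x) = x" by (rule c0_eqI) (simp add: simps star_star)
  show "star (x + y) = star x + star y" by (rule c0_eqI) (simp add: simps star_add)
  show "star (x * y) = star y * star x" by (rule c0_eqI) (simp add: simps star_mult)
  show "star (c *\<^sub>C x) = cnj c *\<^sub>C star x" by (rule c0_eqI) (simp add: simps star_scaleC)
  show "norm (c *\<^sub>C x) = cmod c * norm x"
    by (rule norm_c0_scaled) (auto simp: simps norm_scaleC)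
  show "norm (x * y) \<le> norm x * norm y"
  proof (rule norm_c0_le)
    fix k
    have "norm (entry (x * y) k) \<le> norm (entry x k) * norm (entry y k)"
      by (simp add: simps norm_mult_ineq)
    also have "\<dots> \<le> norm x * norm y"
      by (intro mult_mono norm_entry_le norm_ge_zero)
    finally show "norm (entry (x * y) k) \<le> norm x * norm y" .
  qed
  show "norm (star x * x) = (norm x)\<^sup>2"
  proof (rule antisym)
    have entry: "norm (entry (star x * x) k) = (norm (entry x k))\<^sup>2" for k
      by (simp add: simps cstar_identity)
    show "norm (star x * x) \<le> (norm x)\<^sup>2"
      by (rule norm_c0_le) (simp add: entry power_mono norm_entry_le)
    have "norm x \<le> sqrt (norm (star x * x))"
    proof (rule norm_c0_le)
      show "norm (entry x k) \<le> sqrt (norm (star x * x))" for k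
        using norm_entry_le[of "star x * x" k] by (intro real_le_rsqrt) (simp add: entry)
    qed
    then have "(norm x)\<^sup>2 \<le> (sqrt (norm (star x * x)))\<^sup>2"
      by (intro power_mono) auto
    then show "(norm x)\<^sup>2 \<le> norm (star x * x)"
      by simp
  qed
  show "Cauchy X \<Longrightarrow> convergent X" by (rule c0_complete)
qed

end

text \<open>A set of elements which is itself a C*-algebra under the inherited operations and norm.\<close>

definition is_cstar_algebra :: "'a::cstar_algebra set \<Rightarrow> bool" where
  "is_cstar_algebra S \<longleftrightarrow>
     0 \<in> S \<and> (\<forall>x\<in>S. \<forall>y\<in>S. x + y \<in> S) \<and> (\<forall>c. \<forall>x\<in>S. c *\<^sub>C x \<in> S) \<and>
     (\<forall>x\<in>S. \<forall>y\<in>S. x * y \<in> S) \<and> (\<forall>x\<in>S. star x \<in> S) \<and> complete S"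


section \<open>Positive matrices and completely positive maps\<close>

definition star_mat :: "'a::cstar_algebra mat \<Rightarrow> 'a mat" where
  "star_mat A = transpose_mat (map_mat star A)"

text \<open>The positive elements of \<open>M\<^sub>n(A)\<close>, being those of the form \<open>b\<^sup>* b\<close>.\<close>

definition positive_mats :: "nat \<Rightarrow> 'a::cstar_algebra mat set" where
  "positive_mats n = {star_mat B * B | B. B \<in> carrier_mat n n}"

definition star_map :: "('a::cstar_algebra \<Rightarrow> 'b::cstar_algebra) \<Rightarrow> bool" where
  "star_map f \<longleftrightarrow> clinear f \<and> (\<forall>a. f (star a) = star (f a))"

definition completely_positive :: "('a::cstar_algebra \<Rightarrow> 'b::cstar_algebra) \<Rightarrow> bool" where
  "completely_positive f \<longleftrightarrow> bounded_clinear f \<and> star_map f \<and>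
     (\<forall>n. \<forall>A\<in>positive_mats n. map_mat f A \<in> positive_mats n)"


section \<open>Countable decomposability\<close>

text \<open>Uniform boundedness of the norms is implied by their convergence.\<close>

definition vanishing :: "(nat \<Rightarrow> 'a::complex_normed_space \<Rightarrow> 'a) \<Rightarrow> bool" where
  "vanishing \<phi> \<longleftrightarrow> (\<forall>k. bounded_clinear (\<phi> k)) \<and> (\<lambda>k. onorm (\<phi> k)) \<longlonglongrightarrow> 0"

definition decomposable ::
  "(nat \<Rightarrow> 'a::cstar_algebra \<Rightarrow> 'a) \<Rightarrow> ('a \<Rightarrow> 'h::complex_hilbert_space bounded_op) \<Rightarrow> bool" where
  "decomposable \<phi> f \<longleftrightarrow>
     (\<exists>\<psi>. (\<forall>k. completely_positive (\<psi> k)) \<and> (\<forall>a. (\<lambda>k. \<psi> k (\<phi> k a)) sums f a))"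

definition Gamma_plus :: "(nat \<Rightarrow> 'a::cstar_algebra \<Rightarrow> 'a) \<Rightarrow> nat \<Rightarrow> 'a mat set" where
  "Gamma_plus \<phi> n = {A \<in> carrier_mat n n. \<forall>k. map_mat (\<phi> k) A \<in> positive_mats n}"

lemma vanishing_tendsto:
  assumes "vanishing \<phi>"
  shows "(\<lambda>k. \<phi> k a) \<longlonglongrightarrow> 0"
proof (rule Lim_null_comparison)
  show "\<forall>\<^sub>F k in sequentially. norm (\<phi> k a) \<le> onorm (\<phi> k) * norm a"
    using assms by (intro always_eventually allI onorm) (simp add: vanishing_def bounded_clinear_iff)
  show "(\<lambda>k. onorm (\<phi> k) * norm a) \<longlonglongrightarrow> 0"
    using assms tendsto_mult_left_zero unfolding vanishing_def by blast
qed

text \<open>Meaningful whenever \<open>\<phi>\<close> is vanishing, for then \<^term>\<open>\<lambda>k. \<phi> k a\<close> is a null sequence.\<close>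

definition xi :: "(nat \<Rightarrow> 'a::cstar_algebra \<Rightarrow> 'a) \<Rightarrow> 'a \<Rightarrow> 'a c0" where
  "xi \<phi> a = diag (\<lambda>k. \<phi> k a)"

lemma entry_xi: "vanishing \<phi> \<Longrightarrow> entry (xi \<phi> a) k = \<phi> k a"
  by (simp add: xi_def diag_inverse vanishing_tendsto)

end

theory Submission
  imports Defs "HOL-Library.Function_Algebras"
begin

text \<open>
  By the hypothesis on matrices, \<open>\<xi>(a) \<mapsto> f a\<close> is a completely positive map on the C*-algebra
  \<open>X = \<xi>(A) \<subseteq> c\<^sub>0(A)\<close>.  It suffices to extend it to a completely positive map \<open>\<Psi>\<close> on
  \<open>c\<^sub>0(A)\<close>: the maps \<open>\<psi>\<^sub>k\<close> are then the restrictions of \<open>\<Psi>\<close> to the coordinates, because a null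
  sequence is the norm limit of its truncations.

  A map into \<open>B(H)\<close> is encoded as a functional on finitely supported matrices over \<open>c\<^sub>0(A)\<close>
  indexed by \<open>H\<close> itself, and is extended by the Hahn--Banach theorem, dominated by the least value
  \<open>\<Sum> t h k \<langle>h, k\<rangle>\<close> of a positive scalar matrix \<open>t\<close> lying above the given matrix.  That the
  functional on \<open>X\<close> is dominated, although \<open>X\<close> need not have a unit, follows by compressing with
  an element \<open>e\<close> of an approximate unit of \<open>X\<close>; the open mapping theorem bounds \<open>f\<close> at a
  preimage of \<open>e\<^sup>* e\<close>.  The domination also makes the extension sesquilinear in the two indices.
\<close>


section \<open>Open mappings onto complete subspaces\<close>

text \<open>Arveson's extension theorem does not apply as it stands, since neither \<open>X\<close>
  nor \<open>c\<^sub>0(A)\<close> has a unit in general. Its part is played by the scalar matrices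
  \<open>t\<close>, which are constant sequences and lie outside \<open>c\<^sub>0(A)\<close>; hence
  domination speaks of arbitrary sequences, with neither a bound nor decay. Indexing by all of
  \<open>H\<close> avoids a basis: a label is its own vector, so one matrix carries both an operator
  matrix and the family on which its form is evaluated. That labels add like vectors is not built in
  but forced, because a formal combination of labels with value 0 costs nothing. Real functionals
  suffice: the order sees only hermitian parts, and a complex form is recovered from its real part.
  No separate argument shows that \<open>f\<close> vanishes on the kernel of \<xi>; this too follows
  from domination. Positivity means being a square and no functional calculus is at hand. One
  iteration supplies every root that occurs: for \<open>1 - star x * x\<close>, for the norm
  estimate behind approximate units, and for operator matrices with nonnegative form.\<close>

lemma open_mapping_approx:
  fixes f :: "'a::real_normed_vector \<Rightarrow> 'b::banach"
  assumes f: "bounded_linear f" and S: "complete (range f)"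
  obtains K where "K \<ge> 0" "\<And>z. z \<in> range f \<Longrightarrow> \<exists>a. norm a \<le> K * norm z \<and> norm (z - f a) \<le> norm z / 2"
proof -
  interpret f: bounded_linear f by (rule f)
  \<comment> \<open>Baire applied in the complete space \<open>range f\<close>: one of these
    closures has interior relative to the range, and differences of two of its points move the ball
    found there to the origin.\<close>
  define A where "A n = closure (f ` cball 0 (real n))" for n
  have clS: "closed (range f)" by (rule complete_imp_closed[OF S])
  have A_sub: "A n \<subseteq> range f" for n
    unfolding A_def by (rule closure_minimal[OF _ clS]) auto
  have Un: "(\<Union>n. A n) = range f"
  proof
    show "range f \<subseteq> (\<Union>n. A n)"
    proof
      fix y assume "y \<in> range f"
      then obtain a where a: "y = f a" by blast
      obtain n where "norm a \<le> real n" using real_arch_simple by blast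
      then have "y \<in> A n" unfolding A_def a by (intro subsetD[OF closure_subset]) auto
      then show "y \<in> (\<Union>n. A n)" by blast
    qed
  qed (use A_sub in blast)
  have comp: "completely_metrizable_space (top_of_set (range f))"
    using clS completely_metrizable_space_closedin completely_metrizable_space_euclidean
    by (metis closed_closedin)
  have "\<exists>n. top_of_set (range f) interior_of A n \<noteq> {}"
  proof (rule ccontr)
    assume "\<not> ?thesis"
    then have emp: "top_of_set (range f) interior_of A n = {}" for n by blast
    have "top_of_set (range f) interior_of \<Union>(range A) = {}"
    proof (rule Baire_category_alt)
      show "closedin (top_of_set (range f)) T \<and> top_of_set (range f) interior_of T = {}"
          if "T \<in> range A" for T
        using that emp A_sub by (auto simp: A_def closed_subset)
    qed (use comp in auto)
    then show False using Un by (metis UNIV_I empty_iff imageI interior_of_topspace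
        topspace_euclidean_subtopology)
  qed
  then obtain n y where y: "y \<in> top_of_set (range f) interior_of A n" by blast
  then obtain U where U: "openin (top_of_set (range f)) U" "y \<in> U" "U \<subseteq> A n"
    by (auto simp: interior_of_def)
  then obtain r where r: "r > 0" "ball y r \<inter> range f \<subseteq> U"
    by (meson openin_contains_ball)
  have yA: "y \<in> A n" and yS: "y \<in> range f" using U openin_imp_subset by blast+
  have appr: "\<exists>a. norm a \<le> 2 * real n \<and> norm (z - f a) \<le> e"
      if z: "z \<in> range f" "norm z < r" and e: "e > 0" for z e
  proof -
    obtain a0 a1 where a01: "y = f a0" "z = f a1" using yS z by blast
    have "y + z \<in> range f" unfolding a01 by (metis f.add rangeI)
    then have "y + z \<in> ball y r \<inter> range f" using z(2) by (simp add: dist_norm)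
    then have "y + z \<in> A n" using r U by blast
    then obtain a where a: "norm a \<le> real n" "norm (y + z - f a) < e / 2"
      using e unfolding A_def closure_approachable
      by (auto simp: dist_norm norm_minus_commute dest!: spec[of _ "e/2"])
    obtain b where b: "norm b \<le> real n" "norm (y - f b) < e / 2"
      using e yA unfolding A_def closure_approachable
      by (auto simp: dist_norm norm_minus_commute dest!: spec[of _ "e/2"])
    have "norm (a - b) \<le> 2 * real n" using norm_triangle_ineq4[of a b] a b by linarith
    moreover have "norm (z - f (a - b)) \<le> e"
      using norm_triangle_ineq4[of "y + z - f a" "y - f b"] a b by (simp add: f.diff algebra_simps)
    ultimately show ?thesis by blast
  qed
  \<comment> \<open>For \<open>z\<close> rescaled to norm \<open>r / 2\<close> and the error
    \<open>r / 4\<close>, \<open>appr\<close> gives an element of norm at most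
    \<open>2 * real n\<close>; scaling back multiplies by \<open>2 * norm z / r\<close>.\<close>
  define K where "K = 4 * real n / r"
  have "\<exists>a. norm a \<le> K * norm z \<and> norm (z - f a) \<le> norm z / 2" if "z \<in> range f" for z
  proof (cases "z = 0")
    case True
    then show ?thesis by (intro exI[of _ 0]) (simp add: f.zero)
  next
    case False
    define t where "t = r / (2 * norm z)"
    have t: "t > 0" using r False by (simp add: t_def)
    have "t *\<^sub>R z \<in> range f" using that by (auto simp: f.scaleR[symmetric])
    moreover have "norm (t *\<^sub>R z) < r" using False r by (simp add: t_def)
    moreover have "r / 4 > 0" using r by simp
    ultimately obtain a where a: "norm a \<le> 2 * real n" "norm (t *\<^sub>R z - f a) \<le> r / 4"
      using appr by blast
    have na: "norm (a /\<^sub>R t) \<le> K * norm z"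
      using a False r by (simp add: t_def K_def field_simps)
    have "z - f (a /\<^sub>R t) = (t *\<^sub>R z - f a) /\<^sub>R t"
      using t by (simp add: f.scaleR scaleR_diff_right)
    then have "norm (z - f (a /\<^sub>R t)) = norm (t *\<^sub>R z - f a) / t" using t
        by (simp add: divide_inverse mult.commute)
    also have "\<dots> \<le> (r / 4) / t" using a(2) t by (intro divide_right_mono) auto
    also have "\<dots> = norm z / 2" using r by (simp add: t_def)
    finally have "norm (z - f (a /\<^sub>R t)) \<le> norm z / 2" .
    then show ?thesis using na by blast
  qed
  moreover have "K \<ge> 0" using r by (simp add: K_def)
  ultimately show ?thesis using that by blast
qed

text \<open>Successive approximation: the remainders \<open>Z m\<close> are halved each time, so the
  corrections \<open>g (Z m)\<close> form an absolutely convergent series whose geometric majorant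
  sums to twice \<open>K * norm z\<close>.\<close>

lemma open_mapping_preimage_bound:
  fixes f :: "'a::banach \<Rightarrow> 'b::banach"
  assumes f: "bounded_linear f" and S: "complete (range f)"
  obtains K where "K \<ge> 0" "\<And>z. z \<in> range f \<Longrightarrow> \<exists>a. f a = z \<and> norm a \<le> K * norm z"
proof -
  interpret f: bounded_linear f by (rule f)
  obtain K where K0: "K \<ge> 0"
    and K: "\<And>z. z \<in> range f \<Longrightarrow> \<exists>a. norm a \<le> K * norm z \<and> norm (z - f a) \<le> norm z / 2"
    using open_mapping_approx[OF f S] by blast
  then obtain g where g: "\<And>z. z \<in> range f \<Longrightarrow> norm (g z) \<le> K * norm z"
     "\<And>z. z \<in> range f \<Longrightarrow> norm (z - f (g z)) \<le> norm z / 2" by metis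
  have "\<exists>a. f a = z \<and> norm a \<le> 2 * K * norm z" if z: "z \<in> range f" for z
  proof -
    define Z where "Z m = ((\<lambda>z. z - f (g z)) ^^ m) z" for m
    have Z0: "Z 0 = z" and ZS: "Z (Suc m) = Z m - f (g (Z m))" for m by (auto simp: Z_def)
    have ZR: "Z m \<in> range f" for m
    proof (induction m)
      case (Suc m)
      then obtain a where "Z m = f a" by blast
      then show ?case by (metis ZS f.diff rangeI)
    qed (simp add: Z0 z)
    have Zn: "norm (Z m) \<le> norm z * (1/2) ^ m" for m
    proof (induction m)
      case (Suc m) then show ?case using g(2)[OF ZR[of m]] by (simp add: ZS)
    qed (simp add: Z0)
    have gn: "norm (g (Z m)) \<le> K * norm z * (1/2) ^ m" for m
      using g(1)[OF ZR[of m]] mult_left_mono[OF Zn[of m] K0] by (simp add: mult.assoc)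
    have sm: "(\<lambda>m. K * norm z * (1/2::real) ^ m) sums (K * norm z * 2)"
      using sums_mult[OF geometric_sums[of "1/2::real"]] by simp
    have sg: "summable (\<lambda>m. norm (g (Z m)))"
      using summable_comparison_test'[OF sums_summable[OF sm], of 0 "\<lambda>m. norm (g (Z m))"] gn by simp
    define a where "a = (\<Sum>m. g (Z m))"
    have sums: "(\<lambda>m. g (Z m)) sums a" unfolding a_def using summable_norm_cancel[OF sg]
        by (rule summable_sums)
    have "norm a \<le> (\<Sum>m. norm (g (Z m)))" unfolding a_def by (rule summable_norm[OF sg])
    also have "\<dots> \<le> K * norm z * 2"
      using suminf_le[OF gn sg sums_summable[OF sm]] sums_unique[OF sm] by simp
    finally have na: "norm a \<le> 2 * K * norm z" by simp
    have "(\<lambda>N. \<Sum>m<N. f (g (Z m))) \<longlonglongrightarrow> f a"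
      using f.tendsto[OF sums[unfolded sums_def]] by (simp add: f.sum)
    moreover have "(\<Sum>m<N. f (g (Z m))) = z - Z N" for N
      by (induction N) (auto simp: Z0 ZS)
    moreover have "Z \<longlonglongrightarrow> 0"
    proof (rule Lim_null_comparison)
      show "\<forall>\<^sub>F m in sequentially. norm (Z m) \<le> norm z * (1/2) ^ m" using Zn by simp
      show "(\<lambda>m. norm z * (1/2::real) ^ m) \<longlonglongrightarrow> 0"
          by (intro tendsto_mult_right_zero LIMSEQ_power_zero) simp
    qed
    then have "(\<lambda>N. z - Z N) \<longlonglongrightarrow> z" using tendsto_diff[OF tendsto_const, of Z 0 sequentially z]
        by simp
    ultimately have "f a = z" using LIMSEQ_unique by fastforce
    then show ?thesis using na by blast
  qed
  then show ?thesis using that[of "2 * K"] K0 by auto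
qed


section \<open>Square roots in unital C*-algebras\<close>

text \<open>The iteration \<open>y \<mapsto> (a + y\<^sup>2) / 2\<close>, whose fixed points satisfy \<open>(1 - y)\<^sup>2 = 1 - a\<close>, is
  dominated by its scalar instance at \<open>a = 1\<close>.\<close>

primrec sqrt_majorant :: "nat \<Rightarrow> real" where
  "sqrt_majorant 0 = 0"
| "sqrt_majorant (Suc m) = (1 + (sqrt_majorant m)\<^sup>2) / 2"

lemma sqrt_majorant_bounds: "0 \<le> sqrt_majorant m" "sqrt_majorant m \<le> 1"
proof -
  have "0 \<le> sqrt_majorant m \<and> sqrt_majorant m \<le> 1"
    by (induction m) (auto simp: power_le_one)
  then show "0 \<le> sqrt_majorant m" "sqrt_majorant m \<le> 1" by auto
qed

lemma sqrt_majorant_mono: "sqrt_majorant m \<le> sqrt_majorant (Suc m)"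
proof -
  have "0 \<le> (1 - sqrt_majorant m)\<^sup>2" by simp
  then show ?thesis by (simp add: power2_diff)
qed

text \<open>Put in the shape of the noncommutative increment: with \<open>d\<close> the previous
  increment, the new one is half of \<open>y (Suc m) * d + d * y m\<close>.\<close>

lemma sqrt_majorant_step:
  "sqrt_majorant (Suc (Suc m)) - sqrt_majorant (Suc m) =
    (sqrt_majorant (Suc m) + sqrt_majorant m) * (sqrt_majorant (Suc m) - sqrt_majorant m) / 2"
proof -
  have "sqrt_majorant (Suc k) - sqrt_majorant (Suc m)
      = ((sqrt_majorant k)\<^sup>2 - (sqrt_majorant m)\<^sup>2) / 2" for k
    by (simp add: field_simps)
  from this[of "Suc m"] show ?thesis
    by (simp only: power2_eq_square square_diff_square_factored)
qed

text \<open>The increments of the majorant telescope inside the unit interval. At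
  \<open>norm a = 1\<close> the iteration need not have a geometric rate, so summability has to come
  from this comparison.\<close>

lemma sqrt_majorant_dominated_convergent:
  fixes y :: "nat \<Rightarrow> 'a::banach"
  assumes "\<And>m. norm (y (Suc m) - y m) \<le> sqrt_majorant (Suc m) - sqrt_majorant m"
  shows "convergent y"
proof -
  have "convergent sqrt_majorant"
    using sqrt_majorant_mono sqrt_majorant_bounds
    by (intro Bseq_monoseq_convergent Bseq_eq_bounded[THEN iffD2] bounded_subset[OF
      bounded_closed_interval[of 0 1]])
      (auto simp: monoseq_Suc)
  then have "summable (\<lambda>m. sqrt_majorant (Suc m) - sqrt_majorant m)"
    using telescope_summable convergent_def by blast
  then have "summable (\<lambda>m. y (Suc m) - y m)"
    using assms by (rule summable_comparison_test'[where N = 0])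
  then have "convergent (\<lambda>n. \<Sum>m<n. y (Suc m) - y m)" by (simp add: summable_iff_convergent)
  then have "convergent (\<lambda>n. y n - y 0)" by (simp add: sum_lessThan_telescope)
  then have "convergent (\<lambda>n. (y n - y 0) + y 0)" by (rule convergent_add[OF _ convergent_const])
  then show ?thesis by simp
qed

lemma star_minus: "star (- a) = - star (a::'a::cstar_algebra)"
  using star_add[of a "- a"] by (simp add: eq_neg_iff_add_eq_0 add.commute)

lemma star_diff: "star (a - b) = star a - star (b::'a::cstar_algebra)"
  using star_add[of a "- b"] by (simp add: star_minus)

lemma star_scaleR: "star (r *\<^sub>R a) = r *\<^sub>R star (a::'a::cstar_algebra)"
  using star_scaleC[of "complex_of_real r" a] by (simp add: scaleC_of_real)

lemma star_sum: "star (\<Sum>i\<in>I. g i) = (\<Sum>i\<in>I. star (g i :: 'a::cstar_algebra))"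
  by (induction I rule: infinite_finite_induct) (auto simp: star_add)

lemma bounded_linear_star: "bounded_linear (star :: 'a::cstar_algebra \<Rightarrow> 'a)"
  by (rule bounded_linear_intro[where K = 1]) (auto simp: star_add star_scaleR norm_star)

lemma star_one [simp]: "star (1::'a::unital_cstar_algebra) = 1"
  by (metis mult_1 mult_1_right star_mult star_star)

text \<open>In the zero algebra, which the class admits, the norm is 0; otherwise the C*-identity
  forces 1.\<close>

lemma norm_one_le: "norm (1::'a::unital_cstar_algebra) \<le> 1"
proof -
  have "(norm (1::'a))\<^sup>2 = norm (1::'a)"
    using cstar_identity[of "1::'a"] by simp
  then show ?thesis by (cases "norm (1::'a) = 0") (auto simp: power2_eq_square)
qed

text \<open>The root is \<open>1 - l\<close> for the limit \<open>l\<close> of the iteration started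
  at 0. Every iterate is a real polynomial in \<open>a\<close>, hence self-adjoint and commuting
  with whatever commutes with \<open>a\<close>; both properties pass to the limit.\<close>

lemma cstar_sqrt:
  fixes a :: "'a::unital_cstar_algebra"
  assumes sa: "star a = a" and na: "norm a \<le> 1"
  obtains c where "star c = c" "c * c = 1 - a" "\<And>b. a * b = b * a \<Longrightarrow> c * b = b * c"
proof -
  define y where "y m = ((\<lambda>y. (1/2) *\<^sub>R (a + y * y)) ^^ m) 0" for m
  have y0: "y 0 = 0" and yS: "y (Suc m) = (1/2) *\<^sub>R (a + y m * y m)" for m
    by (auto simp: y_def)
  have ysa: "star (y m) = y m" for m
    by (induction m) (auto simp: y0 yS sa star_scaleR star_add star_mult)
  have yn: "norm (y m) \<le> sqrt_majorant m" for m
  proof (induction m)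
    case (Suc m)
    have "norm (y m * y m) \<le> (sqrt_majorant m)\<^sup>2"
      unfolding power2_eq_square
      by (rule order_trans[OF norm_mult_ineq mult_mono]) (use Suc sqrt_majorant_bounds in auto)
    then have "norm (a + y m * y m) \<le> 1 + (sqrt_majorant m)\<^sup>2"
      using na norm_triangle_ineq[of a "y m * y m"] by linarith
    then show ?case by (simp add: yS)
  qed (simp add: y0)
  have yd: "norm (y (Suc m) - y m) \<le> sqrt_majorant (Suc m) - sqrt_majorant m" for m
  proof (induction m)
    case 0 show ?case using yn[of 1] by (simp add: y0)
  next
    case (Suc m)
    let ?d = "y (Suc m) - y m"
    have nd: "norm ?d \<ge> 0" by simp
    have eq: "y (Suc (Suc m)) - y (Suc m) = (1/2) *\<^sub>R (y (Suc m) * ?d + ?d * y m)"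
      unfolding yS[of "Suc m"] by (subst (3) yS[of m]) (simp add: algebra_simps)
    have b1: "norm (y (Suc m) * ?d) \<le> sqrt_majorant (Suc m) * (sqrt_majorant (Suc m) -
        sqrt_majorant m)"
      by (rule order_trans[OF norm_mult_ineq mult_mono]) (use Suc yn[of "Suc m"]
        sqrt_majorant_bounds(1)[of "Suc m"] in auto)
    have b2: "norm (?d * y m) \<le> (sqrt_majorant (Suc m) - sqrt_majorant m) * sqrt_majorant m"
      by (rule order_trans[OF norm_mult_ineq mult_mono]) (use Suc yn[of m] order_trans[OF nd Suc]
        in auto)
    have "norm (y (Suc m) * ?d + ?d * y m)
        \<le> (sqrt_majorant (Suc m) + sqrt_majorant m) * (sqrt_majorant (Suc m) - sqrt_majorant m)"
      using b1 b2 norm_triangle_ineq[of "y (Suc m) * ?d" "?d * y m"]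
        by (simp add: algebra_simps del: sqrt_majorant.simps)
    then show ?case unfolding eq sqrt_majorant_step by simp
  qed
  obtain l where l: "y \<longlonglongrightarrow> l"
    using sqrt_majorant_dominated_convergent[OF yd] convergent_def by blast
  have "(\<lambda>m. y (Suc m)) \<longlonglongrightarrow> (1/2) *\<^sub>R (a + l * l)"
    unfolding yS by (intro tendsto_intros l)
  then have fixp: "l = (1/2) *\<^sub>R (a + l * l)"
    using LIMSEQ_unique LIMSEQ_Suc[OF l] by blast
  show ?thesis
  proof (rule that[of "1 - l"])
    have "(\<lambda>m. star (y m)) \<longlonglongrightarrow> star l" by (rule bounded_linear.tendsto[OF bounded_linear_star l])
    then have "star l = l" unfolding ysa using LIMSEQ_unique l by blast
    then show "star (1 - l) = 1 - l" by (simp add: star_diff)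
    have "l + l = 2 *\<^sub>R l" by (simp add: scaleR_2)
    also have "\<dots> = a + l * l" by (subst fixp) simp
    finally show "(1 - l) * (1 - l) = 1 - a" by (simp add: algebra_simps)
    fix b assume ab: "a * b = b * a"
    have yb: "y m * b = b * y m" for m
    proof (induction m)
      case (Suc m)
      then show ?case by (simp add: yS distrib_left distrib_right ab) (metis mult.assoc)
    qed (simp add: y0)
    have "(\<lambda>m. y m * b) \<longlonglongrightarrow> l * b" "(\<lambda>m. b * y m) \<longlonglongrightarrow> b * l"
      by (intro tendsto_intros l)+
    then have "l * b = b * l" unfolding yb using LIMSEQ_unique by blast
    then show "(1 - l) * b = b * (1 - l)" by (simp add: algebra_simps)
  qed
qed

text \<open>With \<open>c = \<surd>(1 - x\<^sup>2)\<close> the element \<open>x + i c\<close> is unitary.\<close>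

lemma norm_one_minus_square_le:
  fixes x :: "'a::unital_cstar_algebra"
  assumes sa: "star x = x" and nx: "norm x \<le> 1"
  shows "norm (1 - x * x) \<le> 1"
proof -
  have "norm (x * x) \<le> 1" using norm_mult_ineq[of x x] nx mult_le_one[of "norm x" "norm x"] by simp
  then obtain c where c: "star c = c" "c * c = 1 - x * x" "c * x = x * c"
    using cstar_sqrt[of "x * x"] by (metis mult.assoc sa star_mult)
  define u where "u = x + \<i> *\<^sub>C c"
  have su: "star u = x - \<i> *\<^sub>C c"
    unfolding u_def star_add star_scaleC sa c(1)
    using scaleC_add_left[of "\<i>" "- \<i>" c] scaleC_add_left[of 0 0 c]
      by (simp add: eq_neg_iff_add_eq_0 add.commute)
  have "star u * u = x * x - (\<i> * \<i>) *\<^sub>C (c * c)"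
    unfolding su unfolding u_def
    by (simp add: algebra_simps scaleC_mult_left scaleC_mult_right c(3) linear_simps[OF
      bounded_linear_scaleC_right])
      (simp add: scaleC_scaleC)
  also have "\<dots> = 1" using scaleC_of_real[of "-1" "c * c"] by (simp add: c(2))
  finally have "(norm u)\<^sup>2 \<le> 1" using cstar_identity[of u] norm_one_le by metis
  then have nu: "norm u \<le> 1" by (simp add: abs_square_le_1)
  \<comment> \<open>\<open>c\<close> is the imaginary part of the contraction \<open>u\<close>, so
    its norm is at most 1, and \<open>1 - x * x\<close> is its square.\<close>
  have "norm (u - star u) \<le> 2" using norm_triangle_ineq4[of u "star u"] nu by (simp add: norm_star)
  moreover have "u - star u = (2 * \<i>) *\<^sub>C c"
    unfolding su using scaleC_add_left[of "\<i>" "\<i>" c] by (simp add: u_def)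
  ultimately have "norm c \<le> 1" by (simp add: norm_scaleC norm_mult)
  then show ?thesis unfolding c(2)[symmetric]
      using norm_mult_ineq[of c c] mult_le_one[of "norm c" "norm c"] by simp
qed

section \<open>Approximate units\<close>

lemma is_cstar_algebra_closed:
  assumes "is_cstar_algebra X"
  shows "0 \<in> X" "x \<in> X \<Longrightarrow> y \<in> X \<Longrightarrow> x + y \<in> X" "x \<in> X \<Longrightarrow> c *\<^sub>C x \<in> X"
    "x \<in> X \<Longrightarrow> r *\<^sub>R x \<in> X" "x \<in> X \<Longrightarrow> y \<in> X \<Longrightarrow> x - y \<in> X"
    "x \<in> X \<Longrightarrow> y \<in> X \<Longrightarrow> x * y \<in> X" "x \<in> X \<Longrightarrow> star x \<in> X"
proof -
  have add: "\<And>x y. x \<in> X \<Longrightarrow> y \<in> X \<Longrightarrow> x + y \<in> X" and sc: "\<And>c x. x \<in> X \<Longrightarrow> c *\<^sub>C x \<in> X"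
    using assms by (auto simp: is_cstar_algebra_def)
  have sr: "\<And>r x. x \<in> X \<Longrightarrow> r *\<^sub>R x \<in> X" using sc by (metis scaleC_of_real)
  then have "\<And>x y. x \<in> X \<Longrightarrow> y \<in> X \<Longrightarrow> x - y \<in> X"
    using add by (metis add_uminus_conv_diff scaleR_minus1_left)
  then show "0 \<in> X" "x \<in> X \<Longrightarrow> y \<in> X \<Longrightarrow> x + y \<in> X" "x \<in> X \<Longrightarrow> c *\<^sub>C x \<in> X"
    "x \<in> X \<Longrightarrow> r *\<^sub>R x \<in> X" "x \<in> X \<Longrightarrow> y \<in> X \<Longrightarrow> x - y \<in> X"
    "x \<in> X \<Longrightarrow> y \<in> X \<Longrightarrow> x * y \<in> X" "x \<in> X \<Longrightarrow> star x \<in> X"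
    using assms add sc sr by (auto simp: is_cstar_algebra_def)
qed

lemma is_cstar_algebra_sum:
  assumes "is_cstar_algebra X" "\<And>i. i \<in> I \<Longrightarrow> g i \<in> X"
  shows "(\<Sum>i\<in>I. g i) \<in> X"
  using assms(2) by (induction I rule: infinite_finite_induct) (auto intro:
    is_cstar_algebra_closed[OF assms(1)])

text \<open>With the contraction \<open>q = 1 - x * x\<close>, the product
  \<open>(1 - q) * c\<close> telescopes to \<open>(1 - q ^ N) / N\<close>, so
  \<open>x * x * c\<close> is of order \<open>1 / N\<close>; the C*-identity passes from there to
  \<open>x * c\<close> at the price of a square root. The mean \<open>c\<close> will be
  \<open>1 - entry e k\<close> for an approximate unit \<open>e\<close>.\<close>

lemma mean_ergodic_square:
  fixes x :: "'a::unital_cstar_algebra"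
  assumes sa: "star x = x" and nx: "norm x \<le> 1" and N: "N > 0"
    and c: "c = (1 / real N) *\<^sub>R (\<Sum>j<N. (1 - x * x) ^ j)"
  shows "norm c \<le> 1" "(norm (x * c))\<^sup>2 \<le> 2 / real N"
proof -
  define q where "q = 1 - x * x"
  have nq: "norm q \<le> 1" unfolding q_def by (rule norm_one_minus_square_le[OF sa nx])
  have nqj: "norm (q ^ j) \<le> 1" for j
    by (induction j) (auto simp: norm_one_le intro!: order_trans[OF norm_mult_ineq mult_le_one] nq)
  have sq: "star q = q" by (simp add: q_def star_diff star_mult sa)
  have sqj: "star (q ^ j) = q ^ j" for j
    by (induction j) (auto simp: star_mult sq power_commutes)
  have sc: "star c = c" unfolding c q_def[symmetric] by (simp add: star_scaleR star_sum sqj)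
  have "norm (\<Sum>j<N. q ^ j) \<le> (\<Sum>j<N. 1)" by (rule order_trans[OF norm_sum sum_mono]) (rule nqj)
  then show nc: "norm c \<le> 1" unfolding c q_def[symmetric] using N by simp
  have "(1 - q) * (\<Sum>j<N. q ^ j) = 1 - q ^ N"
  proof (induction N)
    case (Suc N)
    have "(1 - q) * (\<Sum>j<Suc N. q ^ j) = (1 - q ^ N) + (1 - q) * q ^ N"
      using Suc by (simp add: distrib_left)
    then show ?case by (simp add: left_diff_distrib)
  qed simp
  then have "x * x * c = (1 / real N) *\<^sub>R (1 - q ^ N)" unfolding c q_def[symmetric]
      by (simp add: q_def)
  moreover have "norm (1 - q ^ N) \<le> 2" using norm_triangle_ineq4[of 1 "q ^ N"] nqj[of N]
      norm_one_le[where 'a = 'a] by linarith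
  ultimately have b: "norm (x * x * c) \<le> 2 / real N" using N by (simp add: divide_right_mono)
  have "(norm (x * c))\<^sup>2 = norm (c * (x * x * c))"
    unfolding cstar_identity[symmetric] star_mult sc sa by (simp add: mult.assoc)
  also have "\<dots> \<le> 1 * norm (x * x * c)"
    by (rule order_trans[OF norm_mult_ineq mult_right_mono[OF nc]]) simp
  finally show "(norm (x * c))\<^sup>2 \<le> 2 / real N" using b by simp
qed

text \<open>For the mean \<open>c\<close> above, \<open>1 - c\<close> is a polynomial in
  \<open>x * x\<close> without constant term, so it makes sense in \<open>X\<close>, where no unit
  is available. The estimates are made in each coordinate, inside the unital algebra.\<close>

lemma approximate_unit_selfadjoint:
  fixes X :: "'a::unital_cstar_algebra c0 set"
  assumes X: "is_cstar_algebra X" and z: "z \<in> X" "star z = z" and e: "\<epsilon> > 0"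
  obtains e where "e \<in> X" "\<And>k. norm (1 - entry e k) \<le> 1" "norm (z - z * e) \<le> \<epsilon>"
proof -
  note cl = is_cstar_algebra_closed[OF X]
  \<comment> \<open>Adding 1 keeps \<open>r\<close> positive for \<open>z = 0\<close>.\<close>
  define r where "r = norm z + 1"
  have r: "r > 0" using norm_ge_zero[of z] unfolding r_def by linarith
  define x where "x = (1 / r) *\<^sub>R z"
  have xX: "x \<in> X" unfolding x_def by (intro cl z)
  have sx: "star x = x" by (simp add: x_def star_scaleR z)
  have nx: "norm x \<le> 1" using r by (simp add: x_def r_def)
  have zx: "z = r *\<^sub>R x" using r by (simp add: x_def)
  \<comment> \<open>Chosen so that \<open>2 / real N \<le> (\<epsilon> / r)\<^sup>2\<close>.\<close>
  obtain N where N: "real N > 2 * (r / \<epsilon>)\<^sup>2" using reals_Archimedean2 by blast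
  then have N0: "N > 0" using zero_le_power2[of "r / \<epsilon>"]
      by (metis gr0I less_le_not_le mult_nonneg_nonneg of_nat_0 zero_le_numeral)
  \<comment> \<open>In each coordinate \<open>R j\<close> is \<open>1 - (1 - x * x) ^ j\<close>,
    produced by a recursion that never mentions the unit.\<close>
  define R where "R j = ((\<lambda>y. x * x + y - x * x * y) ^^ j) 0" for j
  have R0: "R 0 = 0" and RS: "R (Suc j) = x * x + R j - x * x * R j" for j by (auto simp: R_def)
  have RX: "R j \<in> X" for j by (induction j) (auto simp: R0 RS intro!: cl xX)
  define e where "e = (1 / real N) *\<^sub>R (\<Sum>j<N. R j)"
  have eX: "e \<in> X" unfolding e_def by (intro cl is_cstar_algebra_sum[OF X] RX)
  note reps = zero_c0.rep_eq plus_c0.rep_eq minus_c0.rep_eq scaleR_c0.rep_eq times_c0.rep_eq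
      star_c0.rep_eq
  have Rk: "1 - entry (R j) k = (1 - entry x k * entry x k) ^ j" for j k
  proof (induction j)
    case (Suc j)
    have "1 - entry (R (Suc j)) k = (1 - entry x k * entry x k) * (1 - entry (R j) k)"
      by (simp add: RS reps algebra_simps)
    then show ?case using Suc by simp
  qed (simp add: R0 reps)
  have entry_sum: "entry (\<Sum>j<n. R j) k = (\<Sum>j<n. entry (R j) k)" for n k
    by (induction n) (auto simp: reps)
  have ek: "1 - entry e k = (1 / real N) *\<^sub>R (\<Sum>j<N. (1 - entry x k * entry x k) ^ j)" for k
    unfolding Rk[symmetric] e_def reps entry_sum using N0
    by (simp add: sum_subtractf scaleR_diff_right sum_constant_scaleR)
  have sxk: "star (entry x k) = entry x k" for k using sx by (metis star_c0.rep_eq)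
  have nxk: "norm (entry x k) \<le> 1" for k using norm_entry_le[of x k] nx by linarith
  note me = mean_ergodic_square[OF sxk nxk N0 ek]
  have "norm (z - z * e) \<le> \<epsilon>"
  proof (rule norm_c0_le)
    fix k
    have "(norm (entry x k * (1 - entry e k)))\<^sup>2 \<le> (\<epsilon> / r)\<^sup>2"
    proof (rule order_trans[OF me(2)])
      show "2 / real N \<le> (\<epsilon> / r)\<^sup>2" using N N0 r e by (simp add: field_simps power_divide)
    qed
    then have "norm (entry x k * (1 - entry e k)) \<le> \<epsilon> / r"
      by (rule power2_le_imp_le) (use e r in auto)
    then have "r * norm (entry x k * (1 - entry e k)) \<le> \<epsilon>" using r by (simp add: field_simps)
    moreover have "entry (z - z * e) k = r *\<^sub>R (entry x k * (1 - entry e k))"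
      by (simp add: zx reps right_diff_distrib scaleR_diff_right)
    ultimately show "norm (entry (z - z * e) k) \<le> \<epsilon>" using r by simp
  qed
  then show ?thesis using that eX me(1) by blast
qed

text \<open>Induction over \<open>S\<close>: the error \<open>y\<close> left by the unit
  \<open>d\<close> of the smaller set is treated with a unit \<open>g\<close> for
  \<open>star y * y\<close>, and both are merged by \<open>1 - h = (1 - d) * (1 - g)\<close>.
  Multiplying by the contraction \<open>1 - g\<close> does not enlarge the errors already
  controlled. The result need not be self-adjoint, hence only a right unit.\<close>

lemma approximate_right_unit:
  fixes X :: "'a::unital_cstar_algebra c0 set"
  assumes X: "is_cstar_algebra X" and S: "finite S" "S \<subseteq> X" and e: "\<epsilon> > 0"
  obtains e where "e \<in> X" "\<And>k. norm (1 - entry e k) \<le> 1" "\<And>x. x \<in> S \<Longrightarrow> norm (x - x * e) \<le> \<epsilon>"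
proof -
  note cl = is_cstar_algebra_closed[OF X]
  note reps = zero_c0.rep_eq plus_c0.rep_eq minus_c0.rep_eq scaleR_c0.rep_eq times_c0.rep_eq
      star_c0.rep_eq
  have "\<exists>e\<in>X. (\<forall>k. norm (1 - entry e k) \<le> 1) \<and> (\<forall>x\<in>S. norm (x - x * e) \<le> \<epsilon>)"
    using S
  proof (induction S rule: finite_induct)
    case empty
    show ?case by (rule bexI[of _ 0]) (auto simp: reps norm_one_le cl)
  next
    case (insert x S)
    then obtain d where d: "d \<in> X" "\<And>k. norm (1 - entry d k) \<le> 1" "\<And>x. x \<in> S \<Longrightarrow> norm (x - x * d) \<le> \<epsilon>"
      by auto
    define y where "y = x - x * d"
    have yX: "y \<in> X" unfolding y_def using insert d by (intro cl) auto
    have "star y * y \<in> X" by (intro cl yX)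
    moreover have "star (star y * y) = star y * y" by (simp add: star_mult star_star)
    \<comment> \<open>The square is there because the C*-identity controls the square of the norm of
      \<open>y * (1 - g)\<close>.\<close>
    moreover have "\<epsilon>\<^sup>2 > 0" using e by simp
    ultimately obtain g where g: "g \<in> X" "\<And>k. norm (1 - entry g k) \<le> 1"
      "norm (star y * y - star y * y * g) \<le> \<epsilon>\<^sup>2"
      using approximate_unit_selfadjoint[OF X] by blast
    define h where "h = d + g - d * g"
    have hX: "h \<in> X" unfolding h_def by (intro cl d g)
    have hk: "1 - entry h k = (1 - entry d k) * (1 - entry g k)" for k
      by (simp add: h_def reps algebra_simps)
    have 1: "norm (1 - entry h k) \<le> 1" for k
      unfolding hk by (rule order_trans[OF norm_mult_ineq mult_le_one]) (auto intro: d g)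
    have eq: "entry (s - s * h) k = entry (s - s * d) k * (1 - entry g k)" for s k
      by (simp add: h_def reps algebra_simps)
    have 2: "norm (s - s * h) \<le> \<epsilon>" if "s \<in> S" for s
    proof (rule norm_c0_le)
      fix k
      have "norm (entry (s - s * h) k) \<le> norm (entry (s - s * d) k) * 1"
        unfolding eq by (rule order_trans[OF norm_mult_ineq mult_left_mono]) (auto intro: g)
      then show "norm (entry (s - s * h) k) \<le> \<epsilon>"
          using norm_entry_le[of "s - s * d" k] d(3)[OF that] by linarith
    qed
    have 3: "norm (x - x * h) \<le> \<epsilon>"
    proof (rule norm_c0_le)
      fix k
      let ?c = "1 - entry g k" and ?y = "entry y k"
      have "(norm (?y * ?c))\<^sup>2 = norm (star ?c * (star ?y * ?y * ?c))"
        unfolding cstar_identity[symmetric] star_mult by (simp add: mult.assoc)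
      also have "\<dots> \<le> 1 * norm (star ?y * ?y * ?c)"
        by (rule order_trans[OF norm_mult_ineq mult_right_mono]) (auto simp: norm_star intro: g)
      also have "star ?y * ?y * ?c = entry (star y * y - star y * y * g) k"
        by (simp add: reps algebra_simps)
      also have "1 * norm \<dots> \<le> \<epsilon>\<^sup>2" using norm_entry_le[of "star y * y - star y * y * g" k] g(3)
          by linarith
      finally have "norm (?y * ?c) \<le> \<epsilon>" by (rule power2_le_imp_le) (use e in simp)
      then show "norm (entry (x - x * h) k) \<le> \<epsilon>" unfolding eq y_def .
    qed
    show ?case using hX 1 2 3 by auto
  qed
  then show ?thesis using that by blast
qed

section \<open>Positive matrices of operators\<close>

text \<open>An \<open>n \<times> n\<close> matrix over \<open>B(H)\<close> acts on the families \<open>v :: nat \<Rightarrow> 'h\<close>, of which only the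
  components below \<open>n\<close> matter.\<close>

definition vip :: "nat \<Rightarrow> (nat \<Rightarrow> 'h::complex_hilbert_space) \<Rightarrow> (nat \<Rightarrow> 'h) \<Rightarrow> complex" where
  "vip n u v = (\<Sum>i<n. cinner (u i) (v i))"

definition vnorm :: "nat \<Rightarrow> (nat \<Rightarrow> 'h::complex_hilbert_space) \<Rightarrow> real" where
  "vnorm n v = L2_set (\<lambda>i. norm (v i)) {..<n}"

definition mapply :: "nat \<Rightarrow> (nat \<Rightarrow> nat \<Rightarrow> 'h::complex_hilbert_space bounded_op) \<Rightarrow> (nat \<Rightarrow> 'h) \<Rightarrow> nat
    \<Rightarrow> 'h" where
  "mapply n Y v i = (\<Sum>j<n. op_apply (Y i j) (v j))"

definition mmult :: "nat \<Rightarrow> (nat \<Rightarrow> nat \<Rightarrow> 'a::cstar_algebra) \<Rightarrow> (nat \<Rightarrow> nat \<Rightarrow> 'a) \<Rightarrow> nat \<Rightarrow> nat \<Rightarrow> 'a"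
    where
  "mmult n Y Z i k = (\<Sum>j<n. Y i j * Z j k)"

text \<open>Any \<open>r\<close> above the operator norm on the \<open>n\<close>-fold direct sum of
  the Hilbert space. Since \<open>n\<close> is a value, that sum is not a type to which the norm of
  \<open>bounded_op\<close> could be applied.\<close>

definition mbound :: "nat \<Rightarrow> (nat \<Rightarrow> nat \<Rightarrow> 'h::complex_hilbert_space bounded_op) \<Rightarrow> real \<Rightarrow> bool" where
  "mbound n Y r \<longleftrightarrow> (\<forall>v. vnorm n (mapply n Y v) \<le> r * vnorm n v)"

lemma op_apply_add: "op_apply T (x + y) = op_apply T x + op_apply T y"
  and op_apply_diff: "op_apply T (x - y) = op_apply T x - op_apply T y"
  and op_apply_zero [simp]: "op_apply T 0 = 0"
  using bounded_linear_op[of T] by (auto simp: linear_simps)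

lemma op_apply_scaleC: "op_apply T (c *\<^sub>C x) = c *\<^sub>C op_apply T x"
  using bounded_clinear_op[of T] by (auto simp: bounded_clinear_iff)

lemma op_apply_sum: "op_apply T (\<Sum>i\<in>I. g i) = (\<Sum>i\<in>I. op_apply T (g i))"
  by (induction I rule: infinite_finite_induct) (auto simp: op_apply_add)

lemma op_sum_apply: "op_apply (\<Sum>i\<in>I. G i) x = (\<Sum>i\<in>I. op_apply (G i) x)"
  by (induction I rule: infinite_finite_induct) (auto simp: op_apply_simps)

lemma cinner_sum_right: "cinner x (\<Sum>i\<in>I. g i) = (\<Sum>i\<in>I. cinner x (g i :: 'h::complex_hilbert_space))"
  by (induction I rule: infinite_finite_induct) (auto simp: cinner_add_right)

lemma cinner_sum_left: "cinner (\<Sum>i\<in>I. g i) x = (\<Sum>i\<in>I. cinner (g i :: 'h::complex_hilbert_space) x)"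
  by (induction I rule: infinite_finite_induct) (auto simp: cinner_add_left)

lemma cinner_scaleR_right: "cinner x (r *\<^sub>R y) = complex_of_real r * cinner x
    (y::'h::complex_hilbert_space)"
  using cinner_scaleC_right[of x "complex_of_real r" y] by (simp add: scaleC_of_real)

lemma vnorm_nonneg: "0 \<le> vnorm n v"
  by (simp add: vnorm_def)

lemma vip_self: "vip n v v = complex_of_real ((vnorm n v)\<^sup>2)"
  by (simp add: vip_def vnorm_def L2_set_def cinner_self sum_nonneg)

lemma vnorm_triangle: "vnorm n (\<lambda>i. u i + v i) \<le> vnorm n u + vnorm n v"
  unfolding vnorm_def
  by (rule order_trans[OF L2_set_mono L2_set_triangle_ineq]) (auto simp: norm_triangle_ineq)

lemma vnorm_scaleR: "vnorm n (\<lambda>i. r *\<^sub>R v i) = \<bar>r\<bar> * vnorm n v"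
  unfolding vnorm_def by (simp add: L2_set_right_distrib)

lemma mbound_mono: "mbound n Y r \<Longrightarrow> r \<le> s \<Longrightarrow> mbound n Y s"
  unfolding mbound_def by (meson mult_right_mono order_trans vnorm_nonneg)

lemma mapply_add: "mapply n (\<lambda>i j. Y i j + Z i j) v i = mapply n Y v i + mapply n Z v i"
  by (simp add: mapply_def op_apply_simps sum.distrib)

lemma mapply_scaleR: "mapply n (\<lambda>i j. r *\<^sub>R Y i j) v i = r *\<^sub>R mapply n Y v i"
  by (simp add: mapply_def op_apply_simps scaleR_sum_right)

lemma mapply_mmult: "mapply n (mmult n Y Z) v i = mapply n Y (mapply n Z v) i"
  unfolding mapply_def mmult_def op_sum_apply op_apply_sum
  by (subst sum.swap) (simp add: op_apply_simps)

lemma mbound_add: "mbound n Y r \<Longrightarrow> mbound n Z s \<Longrightarrow> mbound n (\<lambda>i j. Y i j + Z i j) (r + s)"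
  unfolding mbound_def mapply_add distrib_right
  by (auto intro!: order_trans[OF vnorm_triangle add_mono])

lemma mbound_scaleR: "mbound n Y r \<Longrightarrow> mbound n (\<lambda>i j. t *\<^sub>R Y i j) (\<bar>t\<bar> * r)"
  unfolding mbound_def mapply_scaleR vnorm_scaleR mult.assoc by (simp add: mult_left_mono)

lemma mbound_mmult:
  assumes "mbound n Y r" "mbound n Z s" "0 \<le> r" shows "mbound n (mmult n Y Z) (r * s)"
  unfolding mbound_def mapply_mmult
proof
  fix v
  have "vnorm n (mapply n Y (mapply n Z v)) \<le> r * vnorm n (mapply n Z v)"
    using assms by (auto simp: mbound_def)
  also have "\<dots> \<le> r * (s * vnorm n v)" using assms by (auto simp: mbound_def intro: mult_left_mono)
  finally show "vnorm n (mapply n Y (mapply n Z v)) \<le> r * s * vnorm n v" by simp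
qed

text \<open>Turns bounds on the matrix increments into bounds in B(H), so that the matrix iteration
  converges entry by entry.\<close>

lemma mbound_entry:
  fixes Y :: "nat \<Rightarrow> nat \<Rightarrow> 'h::complex_hilbert_space bounded_op"
  assumes Y: "mbound n Y r" and r: "0 \<le> r" and ij: "i < n" "j < n"
  shows "norm (Y i j) \<le> r"
proof (rule norm_op_bound[OF _ r])
  fix x :: 'h
  define v where "v l = (if l = j then x else 0)" for l
  have "mapply n Y v i = (\<Sum>l<n. if l = j then op_apply (Y i j) x else 0)"
    unfolding mapply_def by (rule sum.cong) (auto simp: v_def)
  then have "norm (op_apply (Y i j) x) = norm (mapply n Y v i)" using ij by simp
  also have "\<dots> \<le> vnorm n (mapply n Y v)"
    unfolding vnorm_def using ij by (intro member_le_L2_set) auto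
  also have "\<dots> \<le> r * vnorm n v" using Y by (auto simp: mbound_def)
  also have "vnorm n v = norm x"
  proof -
    have "(\<Sum>l<n. (norm (v l))\<^sup>2) = (\<Sum>l<n. if l = j then (norm x)\<^sup>2 else 0)"
      by (rule sum.cong) (auto simp: v_def)
    then show ?thesis using ij by (simp add: vnorm_def L2_set_def)
  qed
  finally show "norm (op_apply (Y i j) x) \<le> r * norm x" .
qed

lemma vip_star:
  assumes "\<And>i j. i < n \<Longrightarrow> j < n \<Longrightarrow> star (Y i j) = Y j i"
  shows "vip n (mapply n Y u) v = vip n u (mapply n Y v)"
proof -
  have "vip n (mapply n Y u) v = (\<Sum>i<n. \<Sum>j<n. cinner (op_apply (Y i j) (u j)) (v i))"
    by (simp add: vip_def mapply_def cinner_sum_left)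
  also have "\<dots> = (\<Sum>i<n. \<Sum>j<n. cinner (u j) (op_apply (Y j i) (v i)))"
    by (intro sum.cong refl) (metis assms cinner_star_right lessThan_iff)
  also have "\<dots> = (\<Sum>j<n. \<Sum>i<n. cinner (u j) (op_apply (Y j i) (v i)))" by (rule sum.swap)
  finally show ?thesis by (simp add: vip_def mapply_def cinner_sum_right)
qed

text \<open>Applying \<open>2 Re \<langle>u, a v\<rangle> \<le> \<langle>u, a u\<rangle> + \<langle>v, a v\<rangle>\<close> to \<open>u = a v\<close> avoids the
  Cauchy--Schwarz inequality.\<close>

lemma mbound_one:
  assumes sa: "\<And>i j. i < n \<Longrightarrow> j < n \<Longrightarrow> star (Y i j) = Y j i"
    and pos: "\<And>v. 0 \<le> Re (vip n v (mapply n Y v))"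
    and le: "\<And>v. Re (vip n v (mapply n Y v)) \<le> (vnorm n v)\<^sup>2"
  shows "mbound n Y 1"
  unfolding mbound_def
proof
  fix v
  define u where "u = mapply n Y v"
  define d where "d i = u i - v i" for i
  have md: "mapply n Y d i = mapply n Y u i - mapply n Y v i" for i
    by (simp add: mapply_def d_def op_apply_diff sum_subtractf)
  \<comment> \<open>Nonnegativity of the form at \<open>u - v\<close>; by self-adjointness both
    mixed terms equal \<open>vip n u u\<close>.\<close>
  have "vip n d (mapply n Y d) = vip n u (mapply n Y u) + vip n v (mapply n Y v)
      - vip n u (mapply n Y v) - vip n v (mapply n Y u)"
    unfolding vip_def md d_def
    by (simp add: cinner_diff_left cinner_diff_right sum_subtractf sum.distrib)
  moreover have "vip n v (mapply n Y u) = vip n u u"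
    using vip_star[of n Y v u, OF sa] by (simp add: u_def)
  moreover have "vip n u (mapply n Y v) = vip n u u" by (simp add: u_def)
  ultimately have "0 \<le> Re (vip n u (mapply n Y u)) + Re (vip n v (mapply n Y v)) - 2 * (vnorm n
      u)\<^sup>2"
    using pos[of d] by (simp add: vip_self)
  then have "(vnorm n u)\<^sup>2 \<le> (vnorm n v)\<^sup>2" using le[of u] le[of v] by linarith
  then have "vnorm n u \<le> vnorm n v" by (rule power2_le_imp_le) (rule vnorm_nonneg)
  then show "vnorm n (mapply n Y v) \<le> 1 * vnorm n v" by (simp add: u_def)
qed

text \<open>The matrices of variable size \<open>n\<close> over B(H) are not an instance of the
  algebra class, so the iteration of \<open>cstar_sqrt\<close> is repeated with
  \<open>mbound\<close> for the norm and \<open>mmult\<close> for the product.\<close>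

lemma mbound_sqrt_iteration:
  fixes a :: "nat \<Rightarrow> nat \<Rightarrow> 'h::complex_hilbert_space bounded_op"
  assumes sa: "\<And>i j. i < n \<Longrightarrow> j < n \<Longrightarrow> star (a i j) = a j i" and a1: "mbound n a 1"
  shows "\<exists>l. (\<forall>i<n. \<forall>j<n. star (l i j) = l j i) \<and>
    (\<forall>i<n. \<forall>j<n. l i j = (1/2) *\<^sub>R (a i j + mmult n l l i j))"
proof -
  define y where "y m = ((\<lambda>y i j. (1/2) *\<^sub>R (a i j + mmult n y y i j)) ^^ m) (\<lambda>i j. 0)" for m
  have y0: "y 0 = (\<lambda>i j. 0)" and yS: "y (Suc m) = (\<lambda>i j. (1/2) *\<^sub>R (a i j + mmult n (y m) (y m) i
      j))" for m
    by (auto simp: y_def)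
  have ysa: "star (y m i j) = y m j i" if "i < n" "j < n" for m i j
    using that
  proof (induction m arbitrary: i j)
    case (Suc m)
    have "star (mmult n (y m) (y m) i j) = mmult n (y m) (y m) j i"
      unfolding mmult_def star_sum star_mult using Suc by (intro sum.cong) auto
    then show ?case using Suc.prems by (simp add: yS star_scaleR star_add sa)
  qed (simp add: y0)
  note eb = sqrt_majorant_bounds
  have yn: "mbound n (y m) (sqrt_majorant m)" for m
  proof (induction m)
    case 0 show ?case by (simp add: y0 mbound_def mapply_def op_apply_simps vnorm_def L2_set_def)
  next
    case (Suc m)
    show ?case using mbound_scaleR[OF mbound_add[OF a1 mbound_mmult[OF Suc Suc eb(1)]], of "1/2"]
      by (simp add: yS power2_eq_square)
  qed
  define d where "d m = (\<lambda>i j. y (Suc m) i j - y m i j)" for m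
  have yd: "mbound n (d m) (sqrt_majorant (Suc m) - sqrt_majorant m)" for m
  proof (induction m)
    case 0 show ?case using yn[of 1] by (simp add: d_def y0)
  next
    case (Suc m)
    have eq: "d (Suc m) = (\<lambda>i j. (1/2) *\<^sub>R (mmult n (y (Suc m)) (d m) i j + mmult n (d m) (y m) i
        j))"
    proof (intro ext)
      fix i j
      have "mmult n (y (Suc m)) (d m) i j + mmult n (d m) (y m) i j
         = mmult n (y (Suc m)) (y (Suc m)) i j - mmult n (y m) (y m) i j"
        unfolding mmult_def d_def sum.distrib[symmetric] sum_subtractf[symmetric]
        by (rule sum.cong) (auto simp: left_diff_distrib right_diff_distrib)
      moreover have "d (Suc m) i j = (1/2) *\<^sub>R (mmult n (y (Suc m)) (y (Suc m)) i j - mmult n (y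
          m) (y m) i j)"
        unfolding d_def fun_cong[OF fun_cong[OF yS[of "Suc m"]]] fun_cong[OF fun_cong[OF yS[of
          m]], of i j]
        by (simp add: scaleR_diff_right scaleR_add_right)
      ultimately show "d (Suc m) i j = (1/2) *\<^sub>R (mmult n (y (Suc m)) (d m) i j + mmult n (d m) (y
          m) i j)" by simp
    qed
    have nn: "0 \<le> sqrt_majorant (Suc m) - sqrt_majorant m" using sqrt_majorant_mono[of m] by simp
    have half: "\<bar>1/2\<bar> * (s * c + c * r) = (s + r) * c / 2" for s c r :: real
      by (simp add: algebra_simps)
    note b = mbound_scaleR[OF mbound_add[OF mbound_mmult[OF yn[of "Suc m"] Suc eb(1)]
        mbound_mmult[OF Suc yn[of m] nn]], of "1/2"]
    show ?case unfolding eq sqrt_majorant_step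
      by (rule mbound_mono[OF b]) (rule eq_refl, rule half)
  qed
  define l where "l i j = lim (\<lambda>m. y m i j)" for i j
  have l: "(\<lambda>m. y m i j) \<longlonglongrightarrow> l i j" if "i < n" "j < n" for i j
  proof -
    have "norm (y (Suc m) i j - y m i j) \<le> sqrt_majorant (Suc m) - sqrt_majorant m" for m
      using mbound_entry[OF yd[of m] _ that, folded d_def] sqrt_majorant_mono[of m] unfolding d_def
      by linarith
    then have "convergent (\<lambda>m. y m i j)" by (rule sqrt_majorant_dominated_convergent)
    then show ?thesis by (simp add: l_def convergent_LIMSEQ_iff)
  qed
  show ?thesis
  proof (intro exI[of _ l] conjI allI impI)
    fix i j assume ij: "i < n" "j < n"
    have "(\<lambda>m. star (y m i j)) \<longlonglongrightarrow> star (l i j)"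
      by (rule bounded_linear.tendsto[OF bounded_linear_star l[OF ij]])
    then show "star (l i j) = l j i" unfolding ysa[OF ij] using LIMSEQ_unique l[OF ij(2,1)] by blast
  next
    fix i j assume ij: "i < n" "j < n"
    have "(\<lambda>m. y (Suc m) i j) \<longlonglongrightarrow> (1/2) *\<^sub>R (a i j + mmult n l l i j)"
      unfolding yS mmult_def by (intro tendsto_scaleR tendsto_const tendsto_add tendsto_sum
        tendsto_mult l) (use ij in auto)
    then show "l i j = (1/2) *\<^sub>R (a i j + mmult n l l i j)"
      using LIMSEQ_unique LIMSEQ_Suc[OF l[OF ij]] by blast
  qed
qed

section \<open>Quadratic forms of operator matrices\<close>

definition mform :: "'i set \<Rightarrow> ('i \<Rightarrow> 'i \<Rightarrow> 'h::complex_hilbert_space bounded_op) \<Rightarrow> ('i \<Rightarrow> 'h) \<Rightarrow>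
    complex" where
  "mform I T v = (\<Sum>i\<in>I. \<Sum>j\<in>I. cinner (v i) (op_apply (T i j) (v j)))"

lemma mform_vip: "mform {..<n} T v = vip n v (mapply n T v)"
  by (simp add: mform_def vip_def mapply_def cinner_sum_right)

lemma vip_add_left: "vip n (\<lambda>i. u i + v i) w = vip n u w + vip n v w"
  by (simp add: vip_def cinner_add_left sum.distrib)

lemma vip_add_right: "vip n w (\<lambda>i. u i + v i) = vip n w u + vip n w v"
  by (simp add: vip_def cinner_add_right sum.distrib)

lemma mapply_add_right: "mapply n T (\<lambda>i. u i + v i) = (\<lambda>i. mapply n T u i + mapply n T v i)"
  by (rule ext) (simp add: mapply_def op_apply_add sum.distrib)

lemma vip_single:
  assumes "i < n" shows "vip n (\<lambda>l. if l = i then x else 0) w = cinner x (w i)"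
proof -
  have "vip n (\<lambda>l. if l = i then x else 0) w = (\<Sum>l<n. if l = i then cinner x (w i) else 0)"
    unfolding vip_def by (rule sum.cong) auto
  then show ?thesis using assms by simp
qed

lemma mapply_single:
  assumes "j < n" shows "mapply n T (\<lambda>l. if l = j then y else 0) = (\<lambda>i. op_apply (T i j) y)"
proof
  fix i
  have "mapply n T (\<lambda>l. if l = j then y else 0) i = (\<Sum>l<n. if l = j then op_apply (T i j) y else 0)"
    unfolding mapply_def by (rule sum.cong) auto
  then show "mapply n T (\<lambda>l. if l = j then y else 0) i = op_apply (T i j) y" using assms by simp
qed

text \<open>Polarisation: vectors are placed in slots \<open>i\<close> and \<open>j\<close>, and one
  of them is then multiplied by \<open>\<i>\<close>. The family is a sum of two single-slot
  families, so that \<open>i = j\<close> is covered as well.\<close>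

lemma mform_real_imp_hermitian:
  fixes n :: nat
  assumes re: "\<And>v. Im (mform {..<n} T v) = 0" and ij: "i < n" "j < n"
  shows "star (T i j) = T j i"
proof -
  note single = vip_single mapply_single
  have one: "Im (cinner x (op_apply (T i i) x)) = 0" if "i < n" for x i
    using re[of "\<lambda>l. if l = i then x else 0"] unfolding mform_vip by (simp add: single that)
  have im: "Im (cinner x (op_apply (T i j) y) + cinner y (op_apply (T j i) x)) = 0" for x y
    using re[of "\<lambda>l. (if l = i then x else 0) + (if l
      = j then y else 0)"] one[OF ij(1), of x] one[OF ij(2), of y]
    unfolding mform_vip mapply_add_right vip_add_left vip_add_right by (simp add: single ij)
  have "cinner x (op_apply (T i j) y) = cnj (cinner y (op_apply (T j i) x))" for x y
    using im[of x y] im[of x "\<i> *\<^sub>C y"]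
    by (simp add: op_apply_scaleC cinner_scaleC_left cinner_scaleC_right complex_eq_iff)
  then show ?thesis
    by (intro op_eqI cinner_extensionality) (metis cinner_commute cinner_star_right)
qed

lemma mform_le:
  fixes n :: nat
  shows "Re (mform {..<n} T v) \<le> (\<Sum>i<n. \<Sum>j<n. norm (T i j)) * (vnorm n v)\<^sup>2"
proof -
  have c: "Re (cinner (v i) (op_apply (T i j) (v j))) \<le> norm (T i j) * (vnorm n v)\<^sup>2"
      if "i < n" "j < n" for i j
  proof -
    have vi: "norm (v l) \<le> vnorm n v" if "l < n" for l
      unfolding vnorm_def using that by (intro member_le_L2_set) auto
    have "Re (cinner (v i) (op_apply (T i j) (v j))) \<le> norm (v i) * norm (op_apply (T i j) (v j))"
      by (rule order_trans[OF complex_Re_le_cmod cinner_Cauchy_Schwarz])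
    also have "\<dots> \<le> vnorm n v * (norm (T i j) * vnorm n v)"
      by (intro mult_mono order_trans[OF norm_op_apply] vi that) (auto simp: vnorm_nonneg
        norm_op_ge_zero)
    finally show ?thesis by (simp add: power2_eq_square mult_ac)
  qed
  show ?thesis unfolding mform_def Re_sum sum_distrib_right
    by (intro sum_mono c) auto
qed

text \<open>With \<open>K\<close> above the norm of \<open>T\<close>, the form of
  \<open>a = 1 - T / K\<close> lies between 0 and the squared norm, so \<open>mbound_one\<close>
  makes \<open>a\<close> a contraction, and the fixed point \<open>l\<close> satisfies
  \<open>(1 - l) * (1 - l) = T / K\<close>.\<close>

lemma operator_matrix_square_root:
  fixes T :: "nat \<Rightarrow> nat \<Rightarrow> 'h::complex_hilbert_space bounded_op"
  assumes re: "\<And>v. Im (mform {..<n} T v) = 0" and pos: "\<And>v. 0 \<le> Re (mform {..<n} T v)"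
  obtains S where "\<And>i j. i < n \<Longrightarrow> j < n \<Longrightarrow> star (S i j) = S j i"
    "\<And>i j. i < n \<Longrightarrow> j < n \<Longrightarrow> T i j = mmult n S S i j"
proof -
  \<comment> \<open>The summand 1 makes \<open>K\<close> positive even for
    \<open>T = 0\<close>.\<close>
  define K where "K = (\<Sum>i<n. \<Sum>j<n. norm (T i j)) + 1"
  have K: "K > 0" unfolding K_def by (intro add_nonneg_pos sum_nonneg) auto
  define \<delta> where "\<delta> i j = (if i = j then 1 else 0 :: 'h bounded_op)" for i j :: nat
  define a where "a i j = \<delta> i j - (1 / K) *\<^sub>R T i j" for i j
  have Tsa: "star (T i j) = T j i" if "i < n" "j < n" for i j
    using mform_real_imp_hermitian[OF re that] .
  have dsa: "star (\<delta> i j) = \<delta> j i" for i j by (simp add: \<delta>_def)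
  have asa: "star (a i j) = a j i" if "i < n" "j < n" for i j
    by (simp add: a_def star_diff star_scaleR Tsa that dsa)
  have dm: "mmult n \<delta> Y i j = Y i j" "mmult n Y \<delta> j i = Y j i" if "i < n"
      for i j and Y :: "nat \<Rightarrow> nat \<Rightarrow> 'h bounded_op"
  proof -
    have "mmult n \<delta> Y i j = (\<Sum>l<n. if l = i then Y i j else 0)"
      unfolding mmult_def by (rule sum.cong) (auto simp: \<delta>_def)
    moreover have "mmult n Y \<delta> j i = (\<Sum>l<n. if l = i then Y j i else 0)"
      unfolding mmult_def by (rule sum.cong) (auto simp: \<delta>_def)
    ultimately show "mmult n \<delta> Y i j = Y i j" "mmult n Y \<delta> j i = Y j i" using that by simp_all
  qed
  have ma: "vip n v (mapply n a v) = complex_of_real ((vnorm n v)\<^sup>2) - complex_of_real (1 / K) *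
      mform {..<n} T v" for v
  proof -
    have md: "mapply n a v i = v i - (1/K) *\<^sub>R mapply n T v i" if "i < n" for i
    proof -
      have "mapply n a v i = (\<Sum>j<n. (if j = i then v i else 0) - (1/K) *\<^sub>R op_apply (T i j) (v j))"
        unfolding mapply_def by (rule sum.cong) (auto simp: a_def \<delta>_def op_apply_simps)
      then show ?thesis using that by (simp add: sum_subtractf mapply_def scaleR_sum_right)
    qed
    have "vip n v (mapply n a v) = vip n v v - complex_of_real (1 / K) * vip n v (mapply n T v)"
      unfolding vip_def by (simp add: md cinner_diff_right cinner_scaleR_right sum_subtractf
        sum_distrib_left sum_divide_distrib)
    then show ?thesis by (simp add: vip_self mform_vip)
  qed
  have a1: "mbound n a 1"
  proof (rule mbound_one[OF asa])
    fix v
    have "Re (mform {..<n} T v) \<le> K * (vnorm n v)\<^sup>2"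
      using mform_le[of n T v] by (simp add: K_def distrib_right add_increasing2)
    then show "0 \<le> Re (vip n v (mapply n a v))" using K unfolding ma by (simp add: field_simps)
    show "Re (vip n v (mapply n a v)) \<le> (vnorm n v)\<^sup>2" using K pos[of v] unfolding ma by simp
  qed auto
  have "\<exists>l. (\<forall>i<n. \<forall>j<n. star (l i j) = l j i) \<and>
    (\<forall>i<n. \<forall>j<n. l i j = (1/2) *\<^sub>R (a i j + mmult n l l i j))"
    by (rule mbound_sqrt_iteration[OF _ a1]) (rule asa)
  then obtain l where l': "\<forall>i<n. \<forall>j<n. star (l i j) = l j i"
    "\<forall>i<n. \<forall>j<n. l i j = (1/2) *\<^sub>R (a i j + mmult n l l i j)"
    by (elim exE conjE) (rule that)
  then have l: "star (l i j) = l j i" "l i j = (1/2) *\<^sub>R (a i j + mmult n l l i j)"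
    if "i < n" "j < n" for i j
    using that by blast+
  show ?thesis
  proof (rule that[of "\<lambda>i j. sqrt K *\<^sub>R (\<delta> i j - l i j)"])
    fix i j assume ij: "i < n" "j < n"
    show "star (sqrt K *\<^sub>R (\<delta> i j - l i j)) = sqrt K *\<^sub>R (\<delta> j i - l j i)"
      by (simp add: star_scaleR star_diff l(1) ij dsa)
    have "mmult n (\<lambda>i j. sqrt K *\<^sub>R (\<delta> i j - l i j)) (\<lambda>i j. sqrt K *\<^sub>R (\<delta> i j - l i j)) i j
        = K *\<^sub>R (mmult n \<delta> \<delta> i j - mmult n \<delta> l i j - mmult n l \<delta> i j + mmult n l l i j)"
      using K by (simp add: mmult_def scaleR_sum_right sum_subtractf[symmetric]
        sum.distrib[symmetric] algebra_simps)
    also have "\<dots> = K *\<^sub>R (\<delta> i j - (l i j + l i j) + mmult n l l i j)"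
      by (simp add: dm ij algebra_simps)
    also have "l i j + l i j = 2 *\<^sub>R l i j" by (simp add: scaleR_2)
    also have "\<dots> = a i j + mmult n l l i j" by (subst l(2)[OF ij]) simp
    finally show "T i j = mmult n (\<lambda>i j. sqrt K *\<^sub>R (\<delta> i j - l i j)) (\<lambda>i j. sqrt K *\<^sub>R (\<delta> i j - l
        i j)) i j"
      using K by (simp add: a_def)
  qed
qed

lemma positive_mats_iff:
  fixes A :: "'a::cstar_algebra mat"
  shows "A \<in> positive_mats n \<longleftrightarrow> A \<in> carrier_mat n n \<and>
    (\<exists>B. \<forall>i<n. \<forall>j<n. A $$ (i, j) = (\<Sum>l<n. star (B l i) * B l j))" (is "_ \<longleftrightarrow> ?R")
proof
  assume "A \<in> positive_mats n"
  then obtain B where B: "A = star_mat B * B" "B \<in> carrier_mat n n"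
      by (auto simp: positive_mats_def)
  have "A $$ (i, j) = (\<Sum>l<n. star (B $$ (l, i)) * B $$ (l, j))" if "i < n" "j < n" for i j
    using B that by (simp add: star_mat_def scalar_prod_def lessThan_atLeast0)
  moreover have "A \<in> carrier_mat n n" using B by (simp add: star_mat_def)
  ultimately show ?R by (intro conjI exI[of _ "\<lambda>i j. B $$ (i, j)"]) auto
next
  assume ?R
  then obtain B where A: "A \<in> carrier_mat n n"
    and B: "\<And>i j. i < n \<Longrightarrow> j < n \<Longrightarrow> A $$ (i, j) = (\<Sum>l<n. star (B l i) * B l j)" by blast
  define B' where "B' = mat n n (\<lambda>(i, j). B i j)"
  have "A = star_mat B' * B'"
    by (rule eq_matI) (use A in \<open>auto simp: B star_mat_def scalar_prod_def lessThan_atLeast0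
      B'_def\<close>)
  then show "A \<in> positive_mats n" unfolding positive_mats_def by (auto simp: B'_def)
qed

lemma mform_square:
  "mform I (\<lambda>i j. \<Sum>l\<in>L. star (B l i) * B l j) v =
    (\<Sum>l\<in>L. complex_of_real ((norm (\<Sum>i\<in>I. op_apply (B l i) (v i)))\<^sup>2))"
proof -
  have "mform I (\<lambda>i j. \<Sum>l\<in>L. star (B l i) * B l j) v =
      (\<Sum>i\<in>I. \<Sum>j\<in>I. \<Sum>l\<in>L. cinner (op_apply (B l i) (v i)) (op_apply (B l j) (v j)))"
    by (simp add: mform_def op_sum_apply cinner_sum_right op_apply_simps cinner_star_right)
  also have "\<dots> = (\<Sum>l\<in>L. \<Sum>i\<in>I. \<Sum>j\<in>I. cinner (op_apply (B l i) (v i)) (op_apply (B l j) (v j)))"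
    by (simp only: sum.swap[of _ L I])
  also have "\<dots> = (\<Sum>l\<in>L. cinner (\<Sum>i\<in>I. op_apply (B l i) (v i)) (\<Sum>j\<in>I. op_apply (B l j) (v j)))"
    unfolding cinner_sum_left unfolding cinner_sum_right ..
  finally show ?thesis by (simp add: cinner_self)
qed

lemma mform_cong:
  "(\<And>i j. i \<in> I \<Longrightarrow> j \<in> I \<Longrightarrow> T i j = T' i j) \<Longrightarrow> mform I T v = mform I T' v"
  unfolding mform_def by (intro sum.cong refl) simp

text \<open>Nonnegativity of the form passes to sums and norm limits, which a factorisation does not
  show; the way back to a factorisation is the square root just constructed.\<close>

lemma positive_op_mats_iff:
  fixes A :: "'h::complex_hilbert_space bounded_op mat"
  assumes A: "A \<in> carrier_mat n n"
  shows "A \<in> positive_mats n \<longleftrightarrow>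
    (\<forall>v. Im (mform {..<n} (\<lambda>i j. A $$ (i, j)) v) = 0 \<and> 0 \<le> Re (mform {..<n} (\<lambda>i j. A $$ (i, j)) v))"
proof
  assume "A \<in> positive_mats n"
  then obtain B where B: "\<And>i j. i < n \<Longrightarrow> j < n \<Longrightarrow> A $$ (i, j) = (\<Sum>l<n. star (B l i) * B l j)"
    unfolding positive_mats_iff by blast
  have "mform {..<n} (\<lambda>i j. A $$ (i, j)) v = mform {..<n} (\<lambda>i j. \<Sum>l<n. star (B l i) * B l j) v"
      for v
    by (rule mform_cong) (simp add: B)
  then show "\<forall>v. Im (mform {..<n} (\<lambda>i j. A $$ (i, j)) v) = 0 \<and> 0
      \<le> Re (mform {..<n} (\<lambda>i j. A $$ (i, j)) v)"
    by (auto simp: mform_square sum_nonneg)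
next
  assume "\<forall>v. Im (mform {..<n} (\<lambda>i j. A $$ (i, j)) v) = 0 \<and> 0
      \<le> Re (mform {..<n} (\<lambda>i j. A $$ (i, j)) v)"
  then obtain S where S: "\<And>i j. i < n \<Longrightarrow> j < n \<Longrightarrow> star (S i j) = S j i"
    "\<And>i j. i < n \<Longrightarrow> j < n \<Longrightarrow> A $$ (i, j) = mmult n S S i j"
    using operator_matrix_square_root[of n "\<lambda>i j. A $$ (i, j)"] by blast
  have "A $$ (i, j) = (\<Sum>l<n. star (S l i) * S l j)" if "i < n" "j < n" for i j
    unfolding S(2)[OF that] mmult_def by (rule sum.cong) (auto simp: S(1) that)
  then show "A \<in> positive_mats n" using A unfolding positive_mats_iff by blast
qed

section \<open>The Hahn--Banach theorem\<close>

text \<open>Functionals are represented by their graphs: for a subspace of \<open>'v \<times> real\<close>, single-valuedness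
  already follows from domination by a sublinear function.\<close>

theorem hahn_banach:
  fixes p :: "'v::real_vector \<Rightarrow> real"
  assumes D: "subspace D"
    and sub: "\<And>x y. x \<in> D \<Longrightarrow> y \<in> D \<Longrightarrow> p (x + y) \<le> p x + p y"
    and hom: "\<And>t x. 0 < t \<Longrightarrow> x \<in> D \<Longrightarrow> p (t *\<^sub>R x) = t * p x"
    and G0: "subspace G0" and dom: "\<And>v r. (v, r) \<in> G0 \<Longrightarrow> v \<in> D \<and> r \<le> p v"
  shows "\<exists>s. (\<forall>x\<in>D. \<forall>y\<in>D. s (x + y) = s x + s y) \<and> (\<forall>t. \<forall>x\<in>D. s (t *\<^sub>R x) = t * s x) \<and>
    (\<forall>x\<in>D. s x \<le> p x) \<and> (\<forall>(v, r)\<in>G0. s v = r)"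
proof -
  define \<A> where "\<A> = {G. subspace G \<and> G0 \<subseteq> G \<and> (\<forall>(v, r)\<in>G. v \<in> D \<and> r \<le> p v)}"
  have "\<exists>M\<in>\<A>. \<forall>X\<in>\<A>. M \<subseteq> X \<longrightarrow> X = M"
  proof (rule subset_Zorn_nonempty)
    have "G0 \<in> \<A>" using G0 dom by (auto simp: \<A>_def)
    then show "\<A> \<noteq> {}" by blast
    fix \<C> assume ne: "\<C> \<noteq> {}" and ch: "subset.chain \<A> \<C>"
    have CA: "\<C> \<subseteq> \<A>" using ch by (simp add: subset.chain_def)
    have CS: "subspace X" "G0 \<subseteq> X" "\<And>v r. (v, r) \<in> X \<Longrightarrow> v \<in> D \<and> r \<le> p v" if "X \<in> \<C>" for X
      using that CA by (auto simp: \<A>_def)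
    have "subspace (\<Union>\<C>)"
    proof (rule subspaceI)
      show "0 \<in> \<Union>\<C>" using ne CS subspace_0 by blast
      show "c *\<^sub>R x \<in> \<Union>\<C>" if "x \<in> \<Union>\<C>" for c x
        using that CS subspace_scale by blast
      fix x y assume "x \<in> \<Union>\<C>" "y \<in> \<Union>\<C>"
      then obtain X Y where XY: "X \<in> \<C>" "Y \<in> \<C>" "x \<in> X" "y \<in> Y" by blast
      then obtain Z where "Z \<in> \<C>" "x \<in> Z" "y \<in> Z"
        using ch unfolding subset.chain_def by blast
      then have "x + y \<in> Z" using CS(1) subspace_add by blast
      then show "x + y \<in> \<Union>\<C>" using \<open>Z \<in> \<C>\<close> by blast
    qed
    moreover have "G0 \<subseteq> \<Union>\<C>" using ne CS(2) by blast
    moreover have "\<forall>(v, r)\<in>\<Union>\<C>. v \<in> D \<and> r \<le> p v" using CS(3) by blast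
    ultimately show "\<Union>\<C> \<in> \<A>" unfolding \<A>_def by blast
  qed
  then obtain M where M: "M \<in> \<A>" and Mmax: "\<And>X. X \<in> \<A> \<Longrightarrow> M \<subseteq> X \<Longrightarrow> X = M" by blast
  have Ms: "subspace M" and MG: "G0 \<subseteq> M" and MD: "\<And>v r. (v, r) \<in> M \<Longrightarrow> v \<in> D"
    and Mp: "\<And>v r. (v, r) \<in> M \<Longrightarrow> r \<le> p v"
    using M by (auto simp: \<A>_def)
  have M0: "(0, 0) \<in> M" using subspace_0[OF Ms] by (simp add: zero_prod_def)
  have Madd: "(v + w, r + q) \<in> M" if "(v, r) \<in> M" "(w, q) \<in> M" for v w r q
    using subspace_add[OF Ms that] by simp
  have Msc: "(t *\<^sub>R v, t * r) \<in> M" if "(v, r) \<in> M" for v r t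
    using subspace_scale[OF Ms that, of t] by simp
  have total: "\<exists>r. (v0, r) \<in> M" if v0: "v0 \<in> D" for v0
  proof -
    define B where "B = {r - p (v - v0) | v r. (v, r) \<in> M}"
    \<comment> \<open>Every lower bound for an admissible value at \<open>v0\<close> lies below
      every upper bound; \<open>c\<close> is the supremum of the lower ones.\<close>
    have le: "r - p (v - v0) \<le> p (w + v0) - q" if "(v, r) \<in> M" "(w, q) \<in> M" for v r w q
    proof -
      have "r + q \<le> p (v + w)" using Mp[OF Madd[OF that]] .
      also have "v + w = (v - v0) + (w + v0)" by simp
      also have "p \<dots> \<le> p (v - v0) + p (w + v0)"
        using that MD v0 by (intro sub subspace_diff[OF D] subspace_add[OF D])
      finally show ?thesis by simp
    qed
    define c where "c = Sup B"
    have bdd: "bdd_above B" unfolding B_def using le[OF _ M0] by (auto intro!: bdd_aboveI)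
    have B0: "B \<noteq> {}" unfolding B_def using M0 by blast
    have c1: "r - c \<le> p (v - v0)" if "(v, r) \<in> M" for v r
    proof -
      have "r - p (v - v0) \<le> c" unfolding c_def
          by (rule cSup_upper[OF _ bdd]) (use that B_def in blast)
      then show ?thesis by simp
    qed
    have c2: "q + c \<le> p (w + v0)" if "(w, q) \<in> M" for w q
    proof -
      have "c \<le> p (w + v0) - q" unfolding c_def
          by (rule cSup_least[OF B0]) (auto simp: B_def intro: le that)
      then show ?thesis by simp
    qed
    have c3: "r + t * c \<le> p (v + t *\<^sub>R v0)" if vr: "(v, r) \<in> M" for v r t
    proof (cases t "0::real" rule: linorder_cases)
      case greater
      have "t * (r / t + c) \<le> t * p ((1 / t) *\<^sub>R v + v0)"
        using c2[OF Msc[OF vr, of "1 / t"]] greater by (intro mult_left_mono) auto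
      also have "\<dots> = p (t *\<^sub>R ((1 / t) *\<^sub>R v + v0))"
        by (rule hom[symmetric]) (use greater D MD[OF vr] v0 in \<open>auto intro!: subspace_add
          subspace_scale\<close>)
      finally show ?thesis using greater by (simp add: scaleR_add_right distrib_left)
    next
      case less
      define u where "u = - t"
      have u: "u > 0" "t = - u" using less by (auto simp: u_def)
      have "u * (r / u - c) \<le> u * p ((1 / u) *\<^sub>R v - v0)"
        using c1[OF Msc[OF vr, of "1 / u"]] u by (intro mult_left_mono) auto
      also have "\<dots> = p (u *\<^sub>R ((1 / u) *\<^sub>R v - v0))"
        by (rule hom[symmetric]) (use u D MD[OF vr] v0 in \<open>auto intro!: subspace_diff
          subspace_scale\<close>)
      finally show ?thesis using u by (simp add: scaleR_diff_right right_diff_distrib)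
    qed (use Mp vr in simp)
    \<comment> \<open>\<open>v0\<close> may already have a value; the enlarged graph is dominated
      all the same, and maximality then puts \<open>(v0, c)\<close> into \<open>M\<close>.\<close>
    define G where "G = {x + y | x y. x \<in> M \<and> y \<in> span {(v0, c)}}"
    have MsubG: "M \<subseteq> G"
    proof
      fix x assume "x \<in> M"
      then have "x + 0 \<in> G" unfolding G_def using span_zero by blast
      then show "x \<in> G" by simp
    qed
    have "G \<in> \<A>"
    proof -
      have "subspace G" unfolding G_def by (rule subspace_sums[OF Ms subspace_span])
      moreover have "\<forall>(v, r)\<in>G. v \<in> D \<and> r \<le> p v"
        unfolding G_def span_singleton using c3 MD v0 D
        by (auto intro!: subspace_add subspace_scale)
      ultimately show ?thesis using MG MsubG unfolding \<A>_def by blast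
    qed
    then have "G = M" by (rule Mmax[OF _ MsubG])
    moreover have "(0, 0) + (v0, c) \<in> G" unfolding G_def
        using M0 span_base[of "(v0, c)" "{(v0, c)}"] by blast
    ultimately show ?thesis by auto
  qed
  have uniq: "r = q" if "(v, r) \<in> M" "(v, q) \<in> M" for v r q
  proof -
    have "0 \<in> D" by (rule subspace_0[OF D])
    \<comment> \<open>Doubling at 0 gives \<open>p 0 = 0\<close>, so an element of \<open>M\<close>
      over 0, taken with both signs, has value 0.\<close>
    from hom[OF _ this, of 2] have p0: "p 0 = 0" by simp
    have "(0, r - q) \<in> M" "(0, q - r) \<in> M"
      using subspace_diff[OF Ms that] subspace_diff[OF Ms that(2,1)] by simp_all
    then show ?thesis using Mp[of 0 "r - q"] Mp[of 0 "q - r"] p0 by simp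
  qed
  define s where "s v = (THE r. (v, r) \<in> M)" for v
  have s_eq: "s v = r" if "(v, r) \<in> M" for v r
    unfolding s_def using that by (rule the_equality) (rule uniq[OF _ that])
  have sM: "(v, s v) \<in> M" if "v \<in> D" for v using total[OF that] s_eq by auto
  show ?thesis
  proof (intro exI[of _ s] conjI ballI allI)
    show "s (x + y) = s x + s y" if "x \<in> D" "y \<in> D" for x y
      using Madd[OF sM sM] that s_eq by blast
    show "s (t *\<^sub>R x) = t * s x" if "x \<in> D" for t x
      using Msc[OF sM[OF that]] s_eq by blast
    show "s x \<le> p x" if "x \<in> D" for x using Mp sM that by blast
    show "case vr of (v, r) \<Rightarrow> s v = r" if "vr \<in> G0" for vr using that MG s_eq by blast
  qed
qed

text \<open>\<open>hahn_banach\<close> will be applied to matrices, that is to functions of two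
  labels, which therefore have to form a real vector space; their addition is that of
  \<open>Function_Algebras\<close>.\<close>

instantiation "fun" :: (type, real_vector) real_vector
begin

definition "r *\<^sub>R f = (\<lambda>x. r *\<^sub>R f x)"

instance
  by standard (simp_all add: scaleR_fun_def fun_eq_iff scaleR_add_right scaleR_add_left)

end

lemma scaleR_fun_apply [simp]: "(r *\<^sub>R f) x = r *\<^sub>R f x"
  by (simp add: scaleR_fun_def)


lemma sum_fun_apply: "(\<Sum>i\<in>I. g i) x = (\<Sum>i\<in>I. (g i x :: 'z::comm_monoid_add))"
  by (induction I rule: infinite_finite_induct) auto


section \<open>Matrices dominated by scalar matrices\<close>

text \<open>Evaluates a formal finite combination of labels as the vector it denotes. For
  \<open>t h k = cnj (c h) * c k\<close> the sum of all \<open>t h k * cinner h k\<close> is the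
  squared norm of this vector, which is the increment in \<open>dominated_scalar\<close>.\<close>

definition combination :: "('h::complex_normed_space \<Rightarrow> complex) \<Rightarrow> 'h" where
  "combination c = (\<Sum>h | c h \<noteq> 0. c h *\<^sub>C h)"

lemma scaleC_zero_left [simp]: "0 *\<^sub>C (x::'a::complex_normed_space) = 0"
  using scaleC_of_real[of 0 x] by simp

lemma combination_superset:
  assumes "finite F" "\<And>h. h \<notin> F \<Longrightarrow> c h = 0"
  shows "combination c = (\<Sum>h\<in>F. c h *\<^sub>C h)"
  unfolding combination_def by (rule sum.mono_neutral_left) (use assms in auto)

text \<open>Matrices are indexed by the Hilbert space itself and have entries in sequences of elements of
  the algebra.  \<open>dominated w r\<close> says that \<open>w\<close> is obtained from a positive scalar matrix \<open>t\<close> by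
  subtracting squares, \<open>r\<close> being the value of the form \<open>\<Sum> t h k \<langle>h, k\<rangle>\<close>.\<close>

inductive dominated ::
  "('h::complex_hilbert_space \<Rightarrow> 'h \<Rightarrow> nat \<Rightarrow> 'a::unital_cstar_algebra) \<Rightarrow> real \<Rightarrow> bool" where
  dominated_zero: "dominated (\<lambda>h k m. 0) 0"
| dominated_scalar: "dominated w r \<Longrightarrow> finite {h. c h \<noteq> 0} \<Longrightarrow>
    dominated (\<lambda>h k m. w h k m + (cnj (c h) * c k) *\<^sub>C 1) (r + (norm (combination c))\<^sup>2)"
| dominated_square: "dominated w r \<Longrightarrow> finite {h. b h \<noteq> (\<lambda>m. 0)} \<Longrightarrow>
    dominated (\<lambda>h k m. w h k m - star (b h m) * b k m) r"

lemma dominated_nonneg: "dominated w r \<Longrightarrow> 0 \<le> r"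
  by (induction rule: dominated.induct) auto

lemma dominated_add:
  assumes "dominated v q" "dominated w r"
  shows "dominated (\<lambda>h k m. v h k m + w h k m) (q + r)"
  using assms(2)
proof (induction rule: dominated.induct)
  case dominated_zero
  then show ?case using assms(1) by simp
next
  case (dominated_scalar w r c)
  then show ?case using dominated.dominated_scalar[of "\<lambda>h k m. v h k m + w h k m" "q + r" c]
      by (simp add: add_ac)
next
  case (dominated_square w r b)
  then show ?case using dominated.dominated_square[of "\<lambda>h k m. v h k m + w h k m" "q + r" b]
      by (simp add: add_diff_eq)
qed

lemma combination_scaleR: "combination (\<lambda>h. complex_of_real t * c h) = t *\<^sub>R combination c"
  by (cases "t = 0") (auto simp: combination_def scaleR_sum_right scaleC_scaleC[symmetric]
    scaleC_of_real)

lemma dominated_scaleR: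
  assumes "dominated w r" "0 < t"
  shows "dominated (\<lambda>h k m. t *\<^sub>R w h k m) (t * r)"
  using assms(1)
proof (induction rule: dominated.induct)
  case dominated_zero
  then show ?case using dominated.dominated_zero by simp
next
  case (dominated_scalar w r c)
  have st: "complex_of_real (sqrt t) * complex_of_real (sqrt t) = complex_of_real t"
    using assms(2) by (metis of_real_mult less_imp_le real_sqrt_mult_self abs_of_pos)
  have *: "(cnj (complex_of_real (sqrt t) * c h) * (complex_of_real (sqrt t) * c k)) *\<^sub>C 1
      = t *\<^sub>R (cnj (c h) * c k) *\<^sub>C (1::'b)" for h k
    unfolding scaleC_of_real[symmetric] scaleC_scaleC using st by (simp add: mult_ac)
  show ?case
    using dominated.dominated_scalar[OF dominated_scalar(3), of
      "\<lambda>h. complex_of_real (sqrt t) * c h"] dominated_scalar(2) assms(2)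
    unfolding * combination_scaleR
    by (simp add: scaleR_add_right distrib_left power_mult_distrib)
next
  case (dominated_square w r b)
  have "finite {h. (\<lambda>m. sqrt t *\<^sub>R b h m) \<noteq> (\<lambda>m. 0)}"
    by (rule finite_subset[OF _ dominated_square(2)]) (auto simp: fun_eq_iff)
  from dominated.dominated_square[OF dominated_square(3) this]
  show ?case using assms(2) by (simp add: star_scaleR scaleR_diff_right)
qed

text \<open>Unfolds the inductive definition into two sums over a common range with a common finite
  support, padding with zeros the family that lacks a term. The bound on the functional needs the
  scalar matrix and the squares side by side.\<close>

lemma dominated_representation:
  fixes w :: "'h::complex_hilbert_space \<Rightarrow> 'h \<Rightarrow> nat \<Rightarrow> 'a::unital_cstar_algebra"
  assumes "dominated w r"
  shows "\<exists>(n::nat) b c F. finite F \<and> (\<forall>l h. h \<notin> F \<longrightarrow> b l h = (\<lambda>m. 0)) \<and> (\<forall>l h. h \<notin> F \<longrightarrow> c l h = 0) \<and>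
    (\<forall>h k m. w h k m = (\<Sum>l<n. (cnj (c l h) * c l k) *\<^sub>C 1) - (\<Sum>l<n. star (b l h m) * b l k m)) \<and>
    r = (\<Sum>l<n. (norm (combination (c l)))\<^sup>2)"
  using assms
proof (induction rule: dominated.induct)
  case dominated_zero
  show ?case
    by (rule exI[of _ "0::nat"], rule exI[of _ "\<lambda>(l::nat) (h::'h) (m::nat). 0::'a"],
        rule exI[of _ "\<lambda>(l::nat) (h::'h). 0::complex"], rule exI[of _ "{}"]) simp
next
  case (dominated_scalar w r d)
  obtain n :: nat and b c F where F: "finite F"
    "\<forall>l h. h \<notin> F \<longrightarrow> b l h = (\<lambda>m. 0)" "\<forall>l h. h \<notin> F \<longrightarrow> c l h = 0"
    and w: "\<forall>h k m. w h k m = (\<Sum>l<n. (cnj (c l h) * c l k) *\<^sub>C 1) - (\<Sum>l<n. star (b l h m) * b l k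
        m)"
    and r: "r = (\<Sum>l<n. (norm (combination (c l)))\<^sup>2)"
    using dominated_scalar.IH by (elim exE conjE) (rule that)
  have "w h k m + (cnj (d h) * d k) *\<^sub>C 1 =
      (\<Sum>l<Suc n. (cnj ((c(n := d)) l h) * (c(n := d)) l k) *\<^sub>C 1) -
      (\<Sum>l<Suc n. star ((b(n := \<lambda>h m. 0)) l h m) * (b(n := \<lambda>h m. 0)) l k m)" for h k m
    using w[rule_format, of h k m] by simp
  then show ?case
    by (intro exI[of _ "Suc n"] exI[of _ "b(n := \<lambda>h m. 0)"] exI[of _ "c(n := d)"]
        exI[of _ "F \<union> {h. d h \<noteq> 0}"] conjI allI) (use F dominated_scalar.hyps(2) in \<open>auto simp: r\<close>)
next
  case (dominated_square w r d)
  obtain n :: nat and b c F where F: "finite F"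
    "\<forall>l h. h \<notin> F \<longrightarrow> b l h = (\<lambda>m. 0)" "\<forall>l h. h \<notin> F \<longrightarrow> c l h = 0"
    and w: "\<forall>h k m. w h k m = (\<Sum>l<n. (cnj (c l h) * c l k) *\<^sub>C 1) - (\<Sum>l<n. star (b l h m) * b l k
        m)"
    and r: "r = (\<Sum>l<n. (norm (combination (c l)))\<^sup>2)"
    using dominated_square.IH by (elim exE conjE) (rule that)
  have "w h k m - star (d h m) * d k m =
      (\<Sum>l<Suc n. (cnj ((c(n := \<lambda>h. 0)) l h) * (c(n := \<lambda>h. 0)) l k) *\<^sub>C 1) -
      (\<Sum>l<Suc n. star ((b(n := d)) l h m) * (b(n := d)) l k m)" for h k m
    using w[rule_format, of h k m] by simp
  moreover have "r = (\<Sum>l<Suc n. (norm (combination ((c(n := \<lambda>h. 0)) l)))\<^sup>2)"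
    unfolding r by (simp add: combination_def)
  ultimately show ?case
    by (intro exI[of _ "Suc n"] exI[of _ "b(n := d)"] exI[of _ "c(n := \<lambda>h. 0)"]
        exI[of _ "F \<union> {h. d h \<noteq> (\<lambda>m. 0)}"] conjI allI) (use F dominated_square.hyps(2) in auto)
qed

text \<open>The matrix plus its adjoint, without a factor 1/2. The order concerns hermitian matrices
  while the functional lives on all matrices, so domination is tested through this map.\<close>

definition herm :: "('h \<Rightarrow> 'h \<Rightarrow> 'a::cstar_algebra c0) \<Rightarrow> 'h \<Rightarrow> 'h \<Rightarrow> nat \<Rightarrow> 'a" where
  "herm w h k m = entry (w h k) m + star (entry (w k h) m)"

text \<open>A matrix of rank one in the labels. Under the intended encoding it stands for the
  coefficient at \<open>x\<close> between the vectors \<open>combination u\<close> and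
  \<open>combination v\<close>.\<close>

definition elementary :: "('h \<Rightarrow> complex) \<Rightarrow> ('h \<Rightarrow> complex) \<Rightarrow> 'a::cstar_algebra c0 \<Rightarrow> 'h \<Rightarrow> 'h \<Rightarrow> 'a
    c0" where
  "elementary u v x = (\<lambda>h k. (cnj (u h) * v k) *\<^sub>C x)"

text \<open>This is positivity of the matrix with rows \<open>(1, -x)\<close> and \<open>(-x\<^sup>*, 1)\<close>.\<close>

lemma dominated_elementary:
  fixes x :: "'a::unital_cstar_algebra c0" and u v :: "'h::complex_hilbert_space \<Rightarrow> complex"
  assumes u: "finite {h. u h \<noteq> 0}" and v: "finite {h. v h \<noteq> 0}" and x: "norm x \<le> 1"
  shows "dominated (herm (elementary u v x)) ((norm (combination u))\<^sup>2 + (norm (combination v))\<^sup>2)"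
proof -
  let ?x = "\<lambda>m. entry x m"
  have "\<exists>c. star c = c \<and> c * c = 1 - star (?x m) * ?x m" for m
  proof -
    have "norm (star (?x m) * ?x m) \<le> 1"
      using norm_entry_le[of x m] x by (simp add: cstar_identity power_le_one)
    moreover have "star (star (?x m) * ?x m) = star (?x m) * ?x m"
        by (simp add: star_mult star_star)
    ultimately show ?thesis using cstar_sqrt by metis
  qed
  then obtain c where c: "\<And>m. star (c m) = c m" "\<And>m. c m * c m = 1 - star (?x m) * ?x m" by metis
  \<comment> \<open>Completing the square: \<open>b1\<close> accounts for everything except the
    Schur complement \<open>1 - star x * x\<close> at \<open>v\<close>, which \<open>b2\<close>
    supplies through its root \<open>c\<close>.\<close>
  define b1 where "b1 h m = u h *\<^sub>C 1 - v h *\<^sub>C ?x m" for h m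
  define b2 where "b2 h m = v h *\<^sub>C c m" for h m
  have f1: "finite {h. b1 h \<noteq> (\<lambda>m. 0)}"
    by (rule finite_subset[OF _ finite_UnI[OF u v]]) (auto simp: b1_def)
  have f2: "finite {h. b2 h \<noteq> (\<lambda>m. 0)}"
    by (rule finite_subset[OF _ v]) (auto simp: b2_def)
  note dom = dominated_square[OF dominated_square[OF dominated_scalar[OF dominated_scalar[OF
      dominated_zero u] v] f1] f2]
  have "herm (elementary u v x) = (\<lambda>h k m. 0 + (cnj (u h) * u k) *\<^sub>C 1 + (cnj (v h) * v k) *\<^sub>C 1
      - star (b1 h m) * b1 k m - star (b2 h m) * b2 k m)"
  proof (intro ext)
    fix h k m
    have "star (b1 h m) * b1 k m = (cnj (u h) * u k) *\<^sub>C 1 - (cnj (u h) * v k) *\<^sub>C ?x m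
        - (cnj (v h) * u k) *\<^sub>C star (?x m) + (cnj (v h) * v k) *\<^sub>C (star (?x m) * ?x m)"
      unfolding b1_def
      by (simp add: star_diff star_scaleC left_diff_distrib right_diff_distrib scaleC_mult_left
        scaleC_mult_right scaleC_scaleC mult.commute linear_simps[OF bounded_linear_scaleC_right])
    moreover have "star (b2 h m) * b2 k m = (cnj (v h) * v k) *\<^sub>C 1 - (cnj (v h) * v k) *\<^sub>C (star
        (?x m) * ?x m)"
      unfolding b2_def
      by (simp add: star_scaleC scaleC_mult_left scaleC_mult_right scaleC_scaleC c mult.commute[of
        "v k"] linear_simps[OF bounded_linear_scaleC_right])
    moreover have "herm (elementary u v x) h k m = (cnj (u h) * v k) *\<^sub>C ?x m + (cnj (v h) * u k)
        *\<^sub>C star (?x m)"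
      by (simp add: herm_def elementary_def scaleC_c0.rep_eq star_scaleC mult.commute)
    ultimately show "herm (elementary u v x) h k m = 0 + (cnj (u h) * u k) *\<^sub>C 1 + (cnj (v h) * v
        k) *\<^sub>C 1
      - star (b1 h m) * b1 k m - star (b2 h m) * b2 k m" by simp
  qed
  then show ?thesis using dom by (simp only: add_0)
qed

section \<open>Bounded *-maps into \<open>c\<^sub>0(A)\<close>\<close>

lemma xi_add: "vanishing \<phi> \<Longrightarrow> xi \<phi> (a + b) = xi \<phi> a + xi \<phi> b"
  and xi_scaleC: "vanishing \<phi> \<Longrightarrow> xi \<phi> (c *\<^sub>C a) = c *\<^sub>C xi \<phi> a"
  by (auto intro!: c0_eqI simp: entry_xi plus_c0.rep_eq scaleC_c0.rep_eq vanishing_def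
    bounded_clinear_def clinear_def)

lemma xi_star: "vanishing \<phi> \<Longrightarrow> (\<And>k. star_map (\<phi> k)) \<Longrightarrow> xi \<phi> (star a) = star (xi \<phi> a)"
  by (auto intro!: c0_eqI simp: entry_xi star_c0.rep_eq star_map_def)

lemma bounded_linear_xi:
  assumes v: "vanishing \<phi>"
  shows "bounded_linear (xi \<phi>)"
proof -
  have "Bseq (\<lambda>k. onorm (\<phi> k))"
    using v convergentI convergent_imp_Bseq unfolding vanishing_def by blast
  then obtain K where K: "K > 0" "\<And>k. norm (onorm (\<phi> k)) \<le> K" by (auto simp: Bseq_def)
  show ?thesis
  proof (rule bounded_linear_intro[where K = K])
    show "xi \<phi> (x + y) = xi \<phi> x + xi \<phi> y" for x y by (rule xi_add[OF v])
    show "xi \<phi> (r *\<^sub>R x) = r *\<^sub>R xi \<phi> x" for r x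
      using xi_scaleC[OF v, of "complex_of_real r" x] by (simp add: scaleC_of_real)
    show "norm (xi \<phi> x) \<le> norm x * K" for x
    proof (rule norm_c0_le)
      fix k
      have "norm (\<phi> k x) \<le> onorm (\<phi> k) * norm x"
        using v by (intro onorm) (simp add: vanishing_def bounded_clinear_iff)
      also have "\<dots> \<le> K * norm x" using K(2)[of k] by (intro mult_right_mono) auto
      finally show "norm (entry (xi \<phi> x) k) \<le> norm x * K" by (simp add: entry_xi[OF v] mult.commute)
    qed
  qed
qed

text \<open>Moves a form from an abstract finite index set to an initial segment of the naturals and
  pads it with zero rows and columns, the format in which \<open>positive_mats\<close> is
  stated.\<close>

lemma mform_reindex:
  fixes c N :: nat
  assumes g: "bij_betw g {..<c} F" and N: "c \<le> N"
  shows "mform {..<N} (\<lambda>i j. if i < c \<and> j < c then T (g i) (g j) else 0) (\<lambda>i. if i < c then v (g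
      i) else 0) = mform F T v"
proof -
  have "mform {..<N} (\<lambda>i j. if i < c \<and> j < c then T (g i) (g j) else 0) (\<lambda>i. if i < c then v (g i)
      else 0)
     = (\<Sum>i<c. \<Sum>j<N. cinner (if i < c then v (g i) else 0) (op_apply (if i < c
         \<and> j < c then T (g i) (g j) else 0) (if j < c then v (g j) else 0)))"
    unfolding mform_def by (rule sum.mono_neutral_right) (use N in auto)
  also have "\<dots> = (\<Sum>i<c. \<Sum>j<c. cinner (v (g i)) (op_apply (T (g i) (g j)) (v (g j))))"
  proof (rule sum.cong[OF refl])
    fix i assume "i \<in> {..<c}"
    have "(\<Sum>j<N. cinner (if i < c then v (g i) else 0) (op_apply (if i < c
        \<and> j < c then T (g i) (g j) else 0) (if j < c then v (g j) else 0)))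
      = (\<Sum>j<c. cinner (if i < c then v (g i) else 0) (op_apply (if i < c
          \<and> j < c then T (g i) (g j) else 0) (if j < c then v (g j) else 0)))"
      by (rule sum.mono_neutral_right) (use N in auto)
    also have "\<dots> = (\<Sum>j<c. cinner (v (g i)) (op_apply (T (g i) (g j)) (v (g j))))"
      by (rule sum.cong) (use \<open>i \<in> {..<c}\<close> in auto)
    finally show "(\<Sum>j<N. cinner (if i < c then v (g i) else 0) (op_apply (if i < c
        \<and> j < c then T (g i) (g j) else 0) (if j < c then v (g j) else 0)))
      = (\<Sum>j<c. cinner (v (g i)) (op_apply (T (g i) (g j)) (v (g j))))" .
  qed
  also have "\<dots> = (\<Sum>i<c. \<Sum>y\<in>F. cinner (v (g i)) (op_apply (T (g i) y) (v y)))"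
    by (intro sum.cong refl) (rule sum.reindex_bij_betw[OF g, of
      "\<lambda>y. cinner (v (g _)) (op_apply (T (g _) y) (v y))"])
  also have "\<dots> = mform F T v"
    unfolding mform_def by (rule sum.reindex_bij_betw[OF g, of
      "\<lambda>x. \<Sum>y\<in>F. cinner (v x) (op_apply (T x y) (v y))"])
  finally show ?thesis .
qed

section \<open>Maps respecting the cones \<open>Gamma_plus\<close>: adjoints and domination over
  X\<close>

locale gamma_positive_map =
  fixes \<phi> :: "nat \<Rightarrow> 'a::unital_cstar_algebra \<Rightarrow> 'a"
    and f :: "'a \<Rightarrow> 'h::complex_hilbert_space bounded_op"
  assumes vanishing: "vanishing \<phi>"
    and star_maps: "\<And>k. star_map (\<phi> k)"
    and range_cstar: "is_cstar_algebra (range (xi \<phi>))"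
    and bounded_clinear_f: "bounded_clinear f"
    and gamma_positive: "\<And>n A. A \<in> Gamma_plus \<phi> n \<Longrightarrow> map_mat f A \<in> positive_mats n"
begin

lemma f_linear: "f (a + b) = f a + f b" "f (a - b) = f a - f b" "f 0 = 0" "f (r *\<^sub>R a) = r *\<^sub>R f a"
  "f (c *\<^sub>C a) = c *\<^sub>C f a"
  using bounded_clinear_f by (auto simp: bounded_clinear_iff linear_simps)

lemma phi_linear: "\<phi> m (a + b) = \<phi> m a + \<phi> m b" "\<phi> m (a - b) = \<phi> m a - \<phi> m b" "\<phi> m 0 = 0"
  "\<phi> m (c *\<^sub>C a) = c *\<^sub>C \<phi> m a" "\<phi> m (star a) = star (\<phi> m a)"
  using vanishing star_maps by (auto simp: vanishing_def bounded_clinear_iff linear_simps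
    star_map_def)

lemma xi_simps: "xi \<phi> (a + b) = xi \<phi> a + xi \<phi> b" "xi \<phi> (c *\<^sub>C a) = c *\<^sub>C xi \<phi> a"
  "xi \<phi> (star a) = star (xi \<phi> a)" "xi \<phi> (a - b) = xi \<phi> a - xi \<phi> b" "xi \<phi> 0 = 0"
  "xi \<phi> (r *\<^sub>R a) = r *\<^sub>R xi \<phi> a"
  using xi_add[OF vanishing] xi_scaleC[OF vanishing] xi_star[OF vanishing star_maps]
    linear_simps[OF bounded_linear_xi[OF vanishing]] by auto

lemma entry_xi_phi: "xi \<phi> a = x \<Longrightarrow> \<phi> m a = entry x m"
  using entry_xi[OF vanishing, of a m] by simp

lemma f_bound:
  obtains K where "K \<ge> 0" "\<And>a. norm (f a) \<le> K * norm a"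
  using bounded_clinear_f bounded_linear.nonneg_bounded[of f]
    by (auto simp: bounded_clinear_iff mult.commute)

lemma preimage_bound:
  obtains K where "K \<ge> 0" "\<And>x. x \<in> range (xi \<phi>) \<Longrightarrow> \<exists>a. xi \<phi> a = x \<and> norm a \<le> K * norm x"
proof -
  have "complete (range (xi \<phi>))" using range_cstar by (simp add: is_cstar_algebra_def)
  then show ?thesis using open_mapping_preimage_bound[OF bounded_linear_xi[OF vanishing]] that
      by blast
qed

text \<open>A matrix that is coordinatewise a sum of \<open>n\<close> squares becomes an element of \<open>\<Gamma>\<^sup>+\<close>
  after padding with zeros.\<close>

lemma gamma_positive_form:
  fixes F :: "'i set" and n :: nat
  assumes F: "finite F"
    and y: "\<And>i j m. i \<in> F \<Longrightarrow> j \<in> F \<Longrightarrow> \<phi> m (y i j) = (\<Sum>l<n. star (b l i m) * b l j m)"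
  shows "Im (mform F (\<lambda>i j. f (y i j)) v) = 0 \<and> 0 \<le> Re (mform F (\<lambda>i j. f (y i j)) v)"
proof -
  obtain g where g: "bij_betw g {..<card F} F"
    using ex_bij_betw_nat_finite[OF F] by (auto simp: atLeast0LessThan)
  define c where "c = card F"
  \<comment> \<open>The factor demanded by \<open>positive_mats\<close> is square: it needs
    \<open>c\<close> columns for the indices and \<open>n\<close> rows for the squares.\<close>
  define N where "N = c + n"
  define A where "A = mat N N (\<lambda>(i, j). if i < c \<and> j < c then y (g i) (g j) else 0)"
  have gF: "g i \<in> F" if "i < c" for i using g that by (auto simp: c_def bij_betw_def)
  have A: "A \<in> carrier_mat N N" by (simp add: A_def)
  have "map_mat (\<phi> m) A \<in> positive_mats N" for m
    unfolding positive_mats_iff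
  proof (intro conjI exI allI impI)
    define B where "B l i = (if l < n \<and> i < c then b l (g i) m else 0)" for l i
    fix i j assume ij: "i < N" "j < N"
    have "(\<Sum>l<N. star (B l i) * B l j) = (\<Sum>l<n. star (B l i) * B l j)"
      by (rule sum.mono_neutral_right) (auto simp: N_def B_def)
    also have "\<dots> = map_mat (\<phi> m) A $$ (i, j)"
    proof (cases "i < c \<and> j < c")
      case True
      then show ?thesis using ij y[OF gF gF] by (simp add: A_def B_def)
    next
      case False
      then show ?thesis using ij by (auto simp: A_def B_def phi_linear)
    qed
    finally show "map_mat (\<phi> m) A $$ (i, j) = (\<Sum>l<N. star (B l i) * B l j)" by simp
  qed (simp add: A_def)
  then have "A \<in> Gamma_plus \<phi> N" using A by (simp add: Gamma_plus_def)
  from gamma_positive[OF this] have p: "map_mat f A \<in> positive_mats N" .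
  define v' where "v' i = (if i < c then v (g i) else 0)" for i
  have "mform {..<N} (\<lambda>i j. map_mat f A $$ (i, j)) v' =
     mform {..<N} (\<lambda>i j. if i < c \<and> j < c then f (y (g i) (g j)) else 0) v'"
    by (rule mform_cong) (auto simp: A_def f_linear)
  also have "\<dots> = mform F (\<lambda>i j. f (y i j)) v"
    unfolding v'_def using g by (intro mform_reindex) (auto simp: c_def N_def)
  finally have eq: "mform {..<N} (\<lambda>i j. map_mat f A $$ (i, j)) v' = mform F (\<lambda>i j. f (y i j)) v" .
  have "map_mat f A \<in> carrier_mat N N" using A by simp
  then show ?thesis using p positive_op_mats_iff eq by metis
qed

text \<open>The bound 2 comes from the contractivity of \<open>1 - e\<close> in each coordinate. As
  \<open>e\<close> acts from the right only, its adjoint is used on the left, for elements whose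
  adjoint also lies in \<open>S\<close>.\<close>

lemma approximate_compression:
  fixes S :: "'a c0 set"
  assumes "finite S" "S \<subseteq> range (xi \<phi>)" "\<epsilon> > 0"
  obtains e where "e \<in> range (xi \<phi>)" "norm e \<le> 2" "\<And>x. x \<in> S \<Longrightarrow> norm (x - x * e) \<le> \<epsilon>"
    "\<And>x. x \<in> S \<Longrightarrow> star x \<in> S \<Longrightarrow> norm (x - star e * x) \<le> \<epsilon>"
proof -
  obtain e where e: "e \<in> range (xi \<phi>)" "\<And>k. norm (1 - entry e k) \<le> 1"
     "\<And>x. x \<in> S \<Longrightarrow> norm (x - x * e) \<le> \<epsilon>"
    using approximate_right_unit[OF range_cstar assms] by blast
  have "norm e \<le> 2"
  proof (rule norm_c0_le)
    fix k
    have "norm (entry e k) \<le> norm (1::'a) + norm (1 - entry e k)"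
      using norm_triangle_ineq4[of 1 "1 - entry e k"] by simp
    then show "norm (entry e k) \<le> 2" using e(2)[of k] norm_one_le[where 'a = 'a] by linarith
  qed
  moreover have "norm (x - star e * x) \<le> \<epsilon>" if "star x \<in> S" for x
    using e(3)[OF that] norm_star[of "x - star e * x"] by (simp add: star_diff star_mult star_star)
  ultimately show ?thesis using that e by blast
qed

text \<open>The row with entries \<open>e\<close> and \<open>x\<close> gives the positive matrix
  with entries \<open>star e * e\<close>, \<open>star e * x\<close>, \<open>star x * e\<close>,
  \<open>star x * x\<close>. Its image under \<open>f\<close> is positive, hence hermitian, and the
  off-diagonal entries yield the claim up to the distance of \<open>star e * x\<close> from
  \<open>x\<close>.\<close>

lemma f_star: "f (star a) = star (f a)"
proof -
  note cl = is_cstar_algebra_closed[OF range_cstar]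
  obtain K where K: "K \<ge> 0" "\<And>x. x \<in> range (xi \<phi>) \<Longrightarrow> \<exists>a. xi \<phi> a = x \<and> norm a \<le> K * norm x"
    using preimage_bound by blast
  obtain L where L: "L \<ge> 0" "\<And>a. norm (f a) \<le> L * norm a" using f_bound by blast
  define x where "x = xi \<phi> a"
  have xX: "x \<in> range (xi \<phi>)" by (simp add: x_def)
  have bound: "norm (f (star a) - star (f a)) \<le> 2 * L * K * \<epsilon>" if \<epsilon>: "\<epsilon> > 0" for \<epsilon>
  proof -
    obtain e where e: "e \<in> range (xi \<phi>)" "norm (x - star e * x) \<le> \<epsilon>"
      using approximate_compression[of "{x, star x}" \<epsilon>] xX cl \<epsilon>
        by (metis bot.extremum finite.emptyI finite_insert insertCI insert_subset)
    \<comment> \<open>A small preimage \<open>d\<close> of the error makes \<open>a + d\<close>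
      represent \<open>star e * x\<close> exactly.\<close>
    have "star e * x - x \<in> range (xi \<phi>)" by (intro cl e xX)
    then obtain d where d: "xi \<phi> d = star e * x - x" "norm d \<le> K * norm (star e * x - x)"
        using K(2) by blast
    have nd: "norm d \<le> K * \<epsilon>"
      using d(2) e(2) K(1) by (metis norm_minus_commute mult_left_mono order_trans)
    obtain p where p: "xi \<phi> p = star e * e" using cl(6)[OF cl(7)[OF e(1)] e(1)] by (metis imageE)
    obtain q where q: "xi \<phi> q = star x * x" using cl(6)[OF cl(7)[OF xX] xX] by (metis imageE)
    have 1: "xi \<phi> (a + d) = star e * x" by (simp add: xi_simps d x_def[symmetric])
    have 2: "xi \<phi> (star (a + d)) = star x * e" unfolding xi_simps(3) 1
        by (simp add: star_mult star_star)
    define y where "y i j = (if i = (0::nat) then (if j = (0::nat) then p else a + d)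
        else (if j = 0 then star (a + d) else q))" for i j
    define b where "b i m = (if i = (0::nat) then entry e m else entry x m)" for i m
    have "\<phi> m (y i j) = (\<Sum>l<Suc 0. star (b i m) * b j m)" for i j m
      using entry_xi_phi[OF p] entry_xi_phi[OF q] entry_xi_phi[OF 1] entry_xi_phi[OF 2]
      by (simp add: y_def b_def times_c0.rep_eq star_c0.rep_eq)
    then have "Im (mform {..<2::nat} (\<lambda>i j. f (y i j)) v) = 0" for v
      using gamma_positive_form[where F = "{..<2::nat}" and y = y and n = "Suc 0" and b
        = "\<lambda>l i m. b i m" and v = v] by simp
    from mform_real_imp_hermitian[of 2 "\<lambda>i j. f (y i j)" 0 1, OF this]
    have "star (f (a + d)) = f (star (a + d))" by (simp add: y_def)
    then have "f (star a) - star (f a) = star (f d) - f (star d)"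
      by (simp add: f_linear star_add algebra_simps)
    then have "norm (f (star a) - star (f a)) \<le> norm (f d) + norm (f (star d))"
      using norm_triangle_ineq4[of "star (f d)" "f (star d)"] by (simp add: norm_star)
    also have "\<dots> \<le> L * norm d + L * norm d" using L(2)[of d] L(2)[of "star d"]
        by (simp add: norm_star)
    also have "\<dots> \<le> 2 * L * K * \<epsilon>" using mult_left_mono[OF nd L(1)] by (simp add: mult_ac)
    finally show ?thesis .
  qed
  have "norm (f (star a) - star (f a)) \<le> 0"
  proof (rule field_le_epsilon)
    fix \<delta> :: real assume \<delta>: "\<delta> > 0"
    \<comment> \<open>The summand 1 allows for \<open>L * K = 0\<close>.\<close>
    have pos: "2 * L * K + 1 > 0" using L K by (simp add: add_nonneg_pos)
    have "norm (f (star a) - star (f a)) \<le> 2 * L * K * (\<delta> / (2 * L * K + 1))"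
      using \<delta> pos by (intro bound) simp
    also have "\<dots> \<le> \<delta>" using \<delta> pos by (simp add: field_simps)
    finally show "norm (f (star a) - star (f a)) \<le> 0 + \<delta>" by simp
  qed
  then show ?thesis by simp
qed

end

lemma mform_superset:
  assumes "finite G" "F \<subseteq> G" "\<And>i j. i \<notin> F \<or> j \<notin> F \<Longrightarrow> T i j = 0"
  shows "mform F T v = mform G T v"
proof -
  have "mform F T v = (\<Sum>i\<in>F. \<Sum>j\<in>G. cinner (v i) (op_apply (T i j) (v j)))"
    unfolding mform_def by (intro sum.cong refl sum.mono_neutral_left) (use assms in \<open>auto simp:
      op_apply_simps\<close>)
  also have "\<dots> = mform G T v"
    unfolding mform_def by (rule sum.mono_neutral_left) (use assms in \<open>auto simp: op_apply_simps\<close>)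
  finally show ?thesis .
qed

lemma mform_add: "mform F (\<lambda>i j. S i j + T i j) v = mform F S v + mform F T v"
  by (simp add: mform_def op_apply_simps cinner_add_right sum.distrib)

lemma mform_diff: "mform F (\<lambda>i j. S i j - T i j) v = mform F S v - mform F T v"
  by (simp add: mform_def op_apply_simps cinner_diff_right sum_subtractf)

lemma mform_scaleR: "mform F (\<lambda>i j. r *\<^sub>R T i j) v = complex_of_real r * mform F T v"
  by (simp add: mform_def op_apply_simps cinner_scaleR_right sum_distrib_left)

lemma norm_mform_le:
  assumes "\<And>i j. i \<in> F \<Longrightarrow> j \<in> F \<Longrightarrow> norm (T i j) \<le> B"
  shows "norm (mform F T v) \<le> B * (\<Sum>i\<in>F. \<Sum>j\<in>F. norm (v i) * norm (v j))"
proof -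
  have "norm (mform F T v) \<le> (\<Sum>i\<in>F. \<Sum>j\<in>F. norm (cinner (v i) (op_apply (T i j) (v j))))"
    unfolding mform_def by (intro order_trans[OF norm_sum sum_mono] norm_sum)
  also have "\<dots> \<le> (\<Sum>i\<in>F. \<Sum>j\<in>F. B * (norm (v i) * norm (v j)))"
  proof (intro sum_mono)
    fix i j assume ij: "i \<in> F" "j \<in> F"
    have "norm (cinner (v i) (op_apply (T i j) (v j))) \<le> norm (v i) * (norm (T i j) * norm (v j))"
      by (rule order_trans[OF cinner_Cauchy_Schwarz]) (simp add: mult_left_mono norm_op_apply)
    also have "\<dots> \<le> norm (v i) * (B * norm (v j))"
      using assms[OF ij] by (intro mult_left_mono mult_right_mono) auto
    finally show "norm (cinner (v i) (op_apply (T i j) (v j))) \<le> B * (norm (v i) * norm (v j))"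
      by (simp add: mult_ac)
  qed
  finally show ?thesis by (simp add: sum_distrib_left)
qed

lemma scaleC_sum_left: "(\<Sum>i\<in>I. g i) *\<^sub>C (x::'a::complex_normed_space) = (\<Sum>i\<in>I. g i *\<^sub>C x)"
  by (induction I rule: infinite_finite_induct) (auto simp: scaleC_add_left)

text \<open>Evaluated with each label as its own vector, a matrix of rank one collapses to a single
  coefficient of \<open>T\<close>.\<close>

lemma mform_rank_one:
  assumes "finite F" "\<And>h. h \<notin> F \<Longrightarrow> u h = 0" "\<And>h. h \<notin> F \<Longrightarrow> v h = 0"
  shows "mform F (\<lambda>h k. (cnj (u h) * v k) *\<^sub>C T) (\<lambda>h. h)
      = cinner (combination u) (op_apply T (combination v))"
proof -
  have eq: "combination u = (\<Sum>h\<in>F. u h *\<^sub>C h)" "combination v = (\<Sum>h\<in>F. v h *\<^sub>C h)"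
    by (rule combination_superset; use assms in auto)+
  show ?thesis
    unfolding eq mform_def op_apply_sum cinner_sum_left
    by (simp add: cinner_sum_right op_apply_scaleC op_apply_simps cinner_scaleC_left
      cinner_scaleC_right mult_ac)
qed

context gamma_positive_map
begin

text \<open>The hermitian matrix is \<open>t\<close> minus squares of the rows \<open>b l\<close>.
  Its compression is \<open>t\<close> times \<open>star e * e\<close> minus squares of the rows
  \<open>b l * e\<close>, and now every term but the squares comes from \<open>X\<close>, so
  \<open>f\<close> can be applied. The value is then at most that of \<open>t\<close> times
  \<open>f p\<close>, up to a small error, for a preimage \<open>p\<close> of
  \<open>star e * e\<close>; as \<open>t\<close> is a sum of rank-one matrices, this is a sum of
  coefficients of \<open>f p\<close> at the vectors \<open>combination (c l)\<close>.\<close>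

lemma graph_bound:
  "\<exists>M>0. \<forall>F a \<tau>. finite F \<longrightarrow> (\<forall>h k. h \<notin> F \<or> k \<notin> F \<longrightarrow> a h k = 0) \<longrightarrow>
    dominated (herm (\<lambda>h k. xi \<phi> (a h k))) \<tau> \<longrightarrow>
    Re (mform F (\<lambda>h k. f (a h k + star (a k h))) (\<lambda>h. h)) \<le> M * \<tau>"
proof -
  note cl = is_cstar_algebra_closed[OF range_cstar]
  obtain K where K: "K \<ge> 0" "\<And>x. x \<in> range (xi \<phi>) \<Longrightarrow> \<exists>a. xi \<phi> a = x \<and> norm a \<le> K * norm x"
    using preimage_bound by blast
  obtain L where L: "L \<ge> 0" "\<And>a. norm (f a) \<le> L * norm a" using f_bound by blast
  \<comment> \<open>The constant collects the square of \<open>norm e \<le> 2\<close>, the preimage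
    constant \<open>K\<close> and the bound \<open>L\<close> of \<open>f\<close>.\<close>
  have main: "Re (mform F (\<lambda>h k. f (a h k + star (a k h))) (\<lambda>h. h)) \<le> 4 * K * L * \<tau>"
    if F: "finite F" "\<And>h k. h \<notin> F \<or> k \<notin> F \<Longrightarrow> a h k = 0"
      and dom: "dominated (herm (\<lambda>h k. xi \<phi> (a h k))) \<tau>"
    for F :: "'h set" and a \<tau>
  proof -
    define A where "A h k = a h k + star (a k h)" for h k
    obtain n :: nat and b c F' where F': "finite F'" and bF: "\<forall>l h. h \<notin> F' \<longrightarrow> b l h = (\<lambda>m. 0)"
      and cF: "\<forall>l h. h \<notin> F' \<longrightarrow> c l h = 0"
      and w: "\<forall>h k m. herm (\<lambda>h k. xi \<phi> (a h k)) h k m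
        = (\<Sum>l<n. (cnj (c l h) * c l k) *\<^sub>C 1) - (\<Sum>l<n. star (b l h m) * b l k m)"
      and \<tau>: "\<tau> = (\<Sum>l<n. (norm (combination (c l)))\<^sup>2)"
      using dominated_representation[OF dom] by (elim exE conjE) (rule that)
    define G where "G = F \<union> F'"
    have G: "finite G" "F \<subseteq> G" "F' \<subseteq> G" using F F' by (auto simp: G_def)
    define t where "t h k = (\<Sum>l<n. cnj (c l h) * c l k)" for h k
    define x where "x h k = xi \<phi> (A h k)" for h k
    have sx: "star (x h k) = x k h" for h k
      by (simp add: x_def A_def xi_simps star_add star_star add.commute)
    have xw: "t h k *\<^sub>C 1 - entry (x h k) m = (\<Sum>l<n. star (b l h m) * b l k m)" for h k m
      using w[rule_format, of h k m]
      by (simp add: herm_def x_def A_def xi_simps plus_c0.rep_eq star_c0.rep_eq t_def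
        scaleC_sum_left)
    define R where "R = Re (mform F (\<lambda>h k. f (A h k)) (\<lambda>h. h))"
    have RG: "R = Re (mform G (\<lambda>h k. f (A h k)) (\<lambda>h. h))"
      unfolding R_def by (subst mform_superset[OF G(1,2)]) (use F in \<open>auto simp: A_def f_linear\<close>)
    define C where "C = (\<Sum>h\<in>G. \<Sum>k\<in>G. norm h * norm k)"
    have C0: "C \<ge> 0" unfolding C_def by (intro sum_nonneg) auto
    have bound: "R \<le> 4 * K * L * \<tau> + L * (K * (3 * \<epsilon>)) * C" if \<epsilon>: "\<epsilon> > 0" for \<epsilon>
    proof -
      define S where "S = (\<lambda>(h, k). x h k) ` (G \<times> G)"
      have S: "finite S" "S \<subseteq> range (xi \<phi>)" using G(1) by (auto simp: S_def x_def)
      obtain e where eX: "e \<in> range (xi \<phi>)" and ne: "norm e \<le> 2"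
        and e1: "\<And>x. x \<in> S \<Longrightarrow> norm (x - x * e) \<le> \<epsilon>"
        and e2: "\<And>x. x \<in> S \<Longrightarrow> star x \<in> S \<Longrightarrow> norm (x - star e * x) \<le> \<epsilon>"
        using approximate_compression[OF S \<epsilon>] by blast
      \<comment> \<open>The compression error is \<open>2 * \<epsilon>\<close> on the right, where
        \<open>norm e \<le> 2\<close> enters, plus \<open>\<epsilon>\<close> on the left.\<close>
      have "\<exists>d. xi \<phi> d = star e * x h k * e - x h k \<and> norm d \<le> K * (3 * \<epsilon>)" if hk: "h \<in> G" "k \<in> G"
          for h k
      proof -
        have xS: "x h k \<in> S" "x k h \<in> S" using hk by (auto simp: S_def)
        have xX: "x h k \<in> range (xi \<phi>)" by (simp add: x_def)
        have n1: "norm (star e * (x h k - x h k * e)) \<le> 2 * \<epsilon>"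
          by (rule order_trans[OF norm_mult_ineq mult_mono]) (use ne e1[OF xS(1)] in \<open>auto simp:
            norm_star\<close>)
        have "norm (star e * x h k * e - x h k) = norm (star e * (x h k - x h k * e) + (x h k -
            star e * x h k))"
          by (subst norm_minus_commute) (simp add: right_diff_distrib mult.assoc)
        also have "\<dots> \<le> 3 * \<epsilon>"
          using norm_triangle_ineq[of "star e * (x h k - x h k * e)" "x h k - star e * x h k"] n1
            e2[OF xS(1)] xS(2)
          by (simp add: sx)
        finally have n3: "norm (star e * x h k * e - x h k) \<le> 3 * \<epsilon>" .
        have "star e * x h k * e - x h k \<in> range (xi \<phi>)" by (intro cl eX xX)
        then obtain d where "xi \<phi> d = star e * x h k * e - x h k" "norm d
            \<le> K * norm (star e * x h k * e - x h k)"
          using K(2) by blast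
        then show ?thesis using mult_left_mono[OF n3 K(1)] by (intro exI[of _ d]) auto
      qed
      then obtain d where d: "\<And>h k. h \<in> G \<Longrightarrow> k \<in> G \<Longrightarrow> xi \<phi> (d h k) = star e * x h k * e - x h k"
        "\<And>h k. h \<in> G \<Longrightarrow> k \<in> G \<Longrightarrow> norm (d h k) \<le> K * (3 * \<epsilon>)" by metis
      have "star e * e \<in> range (xi \<phi>)" by (intro cl eX)
      then obtain p where p: "xi \<phi> p = star e * e" "norm p \<le> K * norm (star e * e)" using K(2)
          by blast
      have np: "norm (f p) \<le> 4 * K * L"
      proof -
        have "(norm e)\<^sup>2 \<le> 2\<^sup>2" using ne by (intro power_mono) auto
        then have "norm p \<le> K * 4" using p(2) K(1)
            by (simp add: cstar_identity mult_left_mono order_trans)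
        then have "L * norm p \<le> L * (K * 4)" using L(1) by (rule mult_left_mono)
        then show ?thesis using L(2)[of p] by (simp add: mult_ac)
      qed
      \<comment> \<open>The correction \<open>d\<close> lets \<open>y\<close> represent
        \<open>star e * (t - x) * e\<close> exactly, so that its coordinates are sums of
        squares.\<close>
      define y where "y h k = t h k *\<^sub>C p - A h k - d h k" for h k
      have "\<phi> m (y h k) = (\<Sum>l<n. star (b l h m * entry e m) * (b l k m * entry e m))"
        if hk: "h \<in> G" "k \<in> G" for h k m
      proof -
        have "\<phi> m (y h k) = t h k *\<^sub>C entry (star e * e) m - entry (star e * x h k * e) m"
          using entry_xi_phi[OF p(1), of m] entry_xi_phi[OF d(1)[OF hk], of m] entry_xi_phi[of
            "A h k" "x h k" m, OF x_def[symmetric]]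
          by (simp add: y_def phi_linear minus_c0.rep_eq)
        also have "\<dots> = star (entry e m) * (t h k *\<^sub>C 1 - entry (x h k) m) * entry e m"
          by (simp add: times_c0.rep_eq star_c0.rep_eq left_diff_distrib right_diff_distrib
            scaleC_mult_left scaleC_mult_right)
        also have "\<dots> = (\<Sum>l<n. star (b l h m * entry e m) * (b l k m * entry e m))"
          unfolding xw sum_distrib_left sum_distrib_right star_mult by (simp add: mult.assoc)
        finally show ?thesis .
      qed
      then have "0 \<le> Re (mform G (\<lambda>h k. f (y h k)) (\<lambda>h. h))"
        using gamma_positive_form[where F = G and y = y and n = n and b
          = "\<lambda>l h m. b l h m * entry e m" and v = "\<lambda>h. h"] G(1) by simp
      also have "mform G (\<lambda>h k. f (y h k)) (\<lambda>h. h) = mform G (\<lambda>h k. t h k *\<^sub>C f p) (\<lambda>h. h)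
          - mform G (\<lambda>h k. f (A h k)) (\<lambda>h. h) - mform G (\<lambda>h k. f (d h k)) (\<lambda>h. h)"
        unfolding y_def f_linear mform_diff ..
      finally have "R \<le> Re (mform G (\<lambda>h k. t h k *\<^sub>C f p) (\<lambda>h. h)) - Re (mform G (\<lambda>h k. f (d h k))
          (\<lambda>h. h))"
        unfolding RG by simp
      moreover have "Re (mform G (\<lambda>h k. t h k *\<^sub>C f p) (\<lambda>h. h)) \<le> 4 * K * L * \<tau>"
      proof -
        have "mform G (\<lambda>h k. t h k *\<^sub>C f p) (\<lambda>h. h)
            = (\<Sum>l<n. mform G (\<lambda>h k. (cnj (c l h) * c l k) *\<^sub>C f p) (\<lambda>h. h))"
          unfolding mform_def t_def scaleC_sum_left op_sum_apply cinner_sum_right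
          by (simp only: sum.swap[of _ "{..<n}" G])
        also have "\<dots> = (\<Sum>l<n. cinner (combination (c l)) (op_apply (f p) (combination (c l))))"
          by (intro sum.cong refl mform_rank_one G) (use cF G in auto)
        finally have "Re (mform G (\<lambda>h k. t h k *\<^sub>C f p) (\<lambda>h. h))
            = (\<Sum>l<n. Re (cinner (combination (c l)) (op_apply (f p) (combination (c l)))))" by simp
        also have "\<dots> \<le> (\<Sum>l<n. 4 * K * L * (norm (combination (c l)))\<^sup>2)"
        proof (rule sum_mono)
          fix l
          let ?u = "combination (c l)"
          have "Re (cinner ?u (op_apply (f p) ?u)) \<le> norm ?u * norm (op_apply (f p) ?u)"
            by (rule order_trans[OF complex_Re_le_cmod cinner_Cauchy_Schwarz])
          also have "\<dots> \<le> norm ?u * (4 * K * L * norm ?u)"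
            by (intro mult_left_mono order_trans[OF norm_op_apply] mult_right_mono np) auto
          finally show "Re (cinner ?u (op_apply (f p) ?u)) \<le> 4 * K * L * (norm ?u)\<^sup>2"
            by (simp add: power2_eq_square mult_ac)
        qed
        finally show ?thesis by (simp add: \<tau> sum_distrib_left)
      qed
      moreover have "- Re (mform G (\<lambda>h k. f (d h k)) (\<lambda>h. h)) \<le> L * (K * (3 * \<epsilon>)) * C"
      proof -
        have "norm (f (d h k)) \<le> L * (K * (3 * \<epsilon>))" if "h \<in> G" "k \<in> G" for h k
          using L(2)[of "d h k"] mult_left_mono[OF d(2)[OF that] L(1)] by linarith
        from norm_mform_le[of G "\<lambda>h k. f (d h k)", OF this, of "\<lambda>h. h"]
        show ?thesis using abs_Re_le_cmod[of "mform G (\<lambda>h k. f (d h k)) (\<lambda>h. h)"] unfolding C_def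
            by linarith
      qed
      ultimately show ?thesis by linarith
    qed
    have "R \<le> 4 * K * L * \<tau>"
    proof (rule field_le_epsilon)
      fix \<delta> :: real assume \<delta>: "\<delta> > 0"
      define Q where "Q = L * (K * 3) * C + 1"
      have Q: "Q > 0" unfolding Q_def using L K C0 by (simp add: add_nonneg_pos)
      have "L * (K * (3 * (\<delta> / Q))) * C = (Q - 1) * (\<delta> / Q)" by (simp add: Q_def)
      also have "\<dots> \<le> \<delta>" using Q \<delta> by (simp add: field_simps)
      finally show "R \<le> 4 * K * L * \<tau> + \<delta>" using bound[of "\<delta> / Q"] \<delta> Q by simp
    qed
    then show ?thesis by (simp add: R_def A_def)
  qed
  show ?thesis
  \<comment> \<open>The summand 1 makes the constant positive, since it is later divided by; this
    only weakens the bound, as \<tau> is nonnegative.\<close>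
  proof (intro exI[of _ "4 * K * L + 1"] conjI allI impI)
    show "4 * K * L + 1 > 0" using K L by (simp add: add_nonneg_pos)
    fix F :: "'h set" and a \<tau>
    assume F: "finite F" "\<forall>h k. h \<notin> F \<or> k \<notin> F \<longrightarrow> a h k
        = 0" and dom: "dominated (herm (\<lambda>h k. xi \<phi> (a h k))) \<tau>"
    have "Re (mform F (\<lambda>h k. f (a h k + star (a k h))) (\<lambda>h. h)) \<le> 4 * K * L * \<tau>"
      by (rule main[OF F(1) _ dom]) (use F(2) in blast)
    then show "Re (mform F (\<lambda>h k. f (a h k + star (a k h))) (\<lambda>h. h)) \<le> (4 * K * L + 1) * \<tau>"
      using dominated_nonneg[OF dom] by (simp add: distrib_right)
  qed
qed

end

section \<open>Functionals dominated by the scalar matrices\<close>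

lemma herm_add: "herm (v + w) = (\<lambda>h k m. herm v h k m + herm w h k m)"
  by (simp add: herm_def fun_eq_iff plus_c0.rep_eq star_add add_ac)

lemma herm_scaleR: "herm (r *\<^sub>R w) = (\<lambda>h k m. r *\<^sub>R herm w h k m)"
  by (simp add: herm_def fun_eq_iff scaleR_c0.rep_eq star_scaleR scaleR_add_right)

lemma herm_zero: "herm 0 = (\<lambda>h k m. 0)"
  by (simp add: herm_def fun_eq_iff zero_c0.rep_eq)

text \<open>Asking for both signs yields a subspace, on which the set of dominating values is
  nonempty; those values are never negative, so the infimum in \<open>dominating_value\<close> is a
  genuine one.\<close>

definition dominated_space :: "('h::complex_hilbert_space \<Rightarrow> 'h \<Rightarrow> 'a::unital_cstar_algebra c0) set"
    where
  "dominated_space = {w. (\<exists>r. dominated (herm w) r) \<and> (\<exists>r. dominated (herm (- w)) r)}"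

definition dominating_value :: "('h::complex_hilbert_space \<Rightarrow> 'h \<Rightarrow> 'a::unital_cstar_algebra c0) \<Rightarrow>
    real" where
  "dominating_value w = Inf {r. dominated (herm w) r}"

lemma dominated_herm_add:
  "dominated (herm v) q \<Longrightarrow> dominated (herm w) r \<Longrightarrow> dominated (herm (v + w)) (q + r)"
  unfolding herm_add by (rule dominated_add)

lemma dominated_herm_scaleR:
  "dominated (herm w) r \<Longrightarrow> 0 < t \<Longrightarrow> dominated (herm (t *\<^sub>R w)) (t * r)"
  unfolding herm_scaleR by (rule dominated_scaleR)

lemma dominated_spaceI: "dominated (herm w) q \<Longrightarrow> dominated (herm (- w)) r \<Longrightarrow> w \<in> dominated_space"
  unfolding dominated_space_def by auto

lemma dominated_spaceE:
  assumes "w \<in> dominated_space"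
  obtains q r where "dominated (herm w) q" "dominated (herm (- w)) r"
  using assms unfolding dominated_space_def by auto

lemma subspace_dominated_space: "subspace dominated_space"
proof (rule subspaceI)
  show zero: "0 \<in> dominated_space"
    by (rule dominated_spaceI[of _ 0 0]) (simp_all add: herm_zero dominated_zero)
  show "v + w \<in> dominated_space" if vw: "v \<in> dominated_space" "w \<in> dominated_space" for v w
  proof -
    obtain q r q' r' where d: "dominated (herm v) q" "dominated (herm (- v)) r"
      "dominated (herm w) q'" "dominated (herm (- w)) r'"
      using vw by (elim dominated_spaceE)
    show ?thesis
      by (rule dominated_spaceI[OF dominated_herm_add[OF d(1,3)]])
        (unfold minus_add_distrib, rule dominated_herm_add[OF d(2,4)])
  qed
  show "c *\<^sub>R w \<in> dominated_space" if w: "w \<in> dominated_space" for c w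
  proof -
    obtain q r where d: "dominated (herm w) q" "dominated (herm (- w)) r"
      using w by (elim dominated_spaceE)
    show ?thesis
    proof (cases c "0::real" rule: linorder_cases)
      case less
      then have "0 < - c" by simp
      from dominated_herm_scaleR[OF d(1) this] dominated_herm_scaleR[OF d(2) this]
      show ?thesis by (intro dominated_spaceI) simp_all
    next
      case equal
      then show ?thesis using zero by simp
    next
      case greater
      from dominated_herm_scaleR[OF d(1) this] dominated_herm_scaleR[OF d(2) this]
      show ?thesis by (intro dominated_spaceI) simp_all
    qed
  qed
qed

lemma dominating_value_le: "dominated (herm w) r \<Longrightarrow> dominating_value w \<le> r"
  unfolding dominating_value_def
  by (rule cInf_lower) (auto intro!: bdd_belowI[of _ 0] dominated_nonneg)

lemma dominating_value_greatest:
  "w \<in> dominated_space \<Longrightarrow> (\<And>r. dominated (herm w) r \<Longrightarrow> c \<le> r) \<Longrightarrow> c \<le> dominating_value w"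
  unfolding dominating_value_def by (rule cInf_greatest) (auto simp: dominated_space_def)

lemma dominating_value_add:
  assumes "v \<in> dominated_space" "w \<in> dominated_space"
  shows "dominating_value (v + w) \<le> dominating_value v + dominating_value w"
proof -
  have "dominating_value (v + w) - r \<le> dominating_value v" if r: "dominated (herm w) r" for r
  proof (rule dominating_value_greatest[OF assms(1)])
    fix q assume "dominated (herm v) q"
    from dominating_value_le[OF dominated_herm_add[OF this r]]
    show "dominating_value (v + w) - r \<le> q" by simp
  qed
  then have "dominating_value (v + w) - dominating_value v \<le> dominating_value w"
    by (intro dominating_value_greatest[OF assms(2)]) (simp add: algebra_simps)
  then show ?thesis by simp
qed

lemma dominating_value_scaleR:
  assumes w: "w \<in> dominated_space" and t: "0 < t"
  shows "dominating_value (t *\<^sub>R w) = t * dominating_value w"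
proof -
  have le: "dominating_value (t *\<^sub>R w) \<le> t * dominating_value w"
      if w: "w \<in> dominated_space" and t: "0 < t" for t w
  proof -
    have "dominating_value (t *\<^sub>R w) / t \<le> dominating_value w"
    proof (rule dominating_value_greatest[OF w])
      fix r assume "dominated (herm w) r"
      from dominating_value_le[OF dominated_herm_scaleR[OF this t]]
      show "dominating_value (t *\<^sub>R w) / t \<le> r" using t by (simp add: field_simps)
    qed
    then show ?thesis using t by (simp add: field_simps)
  qed
  have "t *\<^sub>R w \<in> dominated_space" by (rule subspace_scale[OF subspace_dominated_space w])
  from le[OF this, of "1 / t"] have "t * dominating_value w \<le> dominating_value (t *\<^sub>R w)"
    using t by (simp add: field_simps)
  then show ?thesis using le[OF w t] by simp
qed

lemma elementary_simps:
  "elementary u v (x + y) = elementary u v x + elementary u v y"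
  "elementary u v (r *\<^sub>R x) = r *\<^sub>R elementary u v x"
  "elementary u v (- x) = - elementary u v x"
  "elementary u (\<lambda>h. v h + v' h) x = elementary u v x + elementary u v' x"
  "elementary (\<lambda>h. u h + u' h) v x = elementary u v x + elementary u' v x"
  "elementary u (\<lambda>h. c * v h) x = elementary u v (c *\<^sub>C x)"
  "elementary (\<lambda>h. c * u h) v x = elementary u v (cnj c *\<^sub>C x)"
  by (simp_all add: elementary_def fun_eq_iff scaleC_add_right scaleC_minus_right
    scaleC_add_left[symmetric]
      linear_simps(5)[OF bounded_linear_scaleC_right] scaleC_scaleC distrib_left distrib_right
          mult_ac)

lemma dominated_elementary_scaled:
  fixes x :: "'a::unital_cstar_algebra c0" and u v :: "'h::complex_hilbert_space \<Rightarrow> complex"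
  assumes "finite {h. u h \<noteq> 0}" "finite {h. v h \<noteq> 0}" "norm x \<le> t" "0 < t"
  shows "dominated (herm (elementary u v x)) (t * ((norm (combination u))\<^sup>2 + (norm (combination
      v))\<^sup>2))"
proof -
  have "norm (x /\<^sub>R t) \<le> 1" using assms by (simp add: field_simps)
  from dominated_herm_scaleR[OF dominated_elementary[OF assms(1,2) this] assms(4)]
  show ?thesis using assms(4) by (simp add: elementary_simps)
qed

lemma elementary_in_dominated_space:
  fixes x :: "'a::unital_cstar_algebra c0" and u v :: "'h::complex_hilbert_space \<Rightarrow> complex"
  assumes "finite {h. u h \<noteq> 0}" "finite {h. v h \<noteq> 0}"
  shows "elementary u v x \<in> dominated_space"
proof -
  have t: "norm x \<le> norm x + 1" "0 < norm x + 1" using norm_ge_zero[of x] by linarith+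
  show ?thesis
    using dominated_elementary_scaled[OF assms t] dominated_elementary_scaled[OF assms, of "- x"
      "norm x + 1"] t
    by (intro dominated_spaceI) (auto simp: elementary_simps(3))
qed

definition basis_vector :: "'h \<Rightarrow> 'h \<Rightarrow> complex" where
  "basis_vector h = (\<lambda>g. if g = h then 1 else 0)"

lemma finite_basis_vector [simp]: "finite {g. basis_vector h g \<noteq> 0}"
  by (simp add: basis_vector_def)

lemma combination_basis_vector [simp]: "combination (basis_vector h) = h"
  by (simp add: combination_def basis_vector_def if_distrib[of "\<lambda>c. c *\<^sub>C _"])

lemma combination_add:
  assumes "finite {h. u h \<noteq> 0}" "finite {h. v h \<noteq> 0}"
  shows "combination (\<lambda>h. u h + v h) = combination u + combination v"
proof -
  let ?F = "{h. u h \<noteq> 0} \<union> {h. v h \<noteq> 0}"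
  have "combination (\<lambda>h. u h + v h) = (\<Sum>h\<in>?F. (u h + v h) *\<^sub>C h)" "combination u
      = (\<Sum>h\<in>?F. u h *\<^sub>C h)"
    "combination v = (\<Sum>h\<in>?F. v h *\<^sub>C h)"
    by (rule combination_superset; use assms in auto)+
  then show ?thesis by (simp add: scaleC_add_left sum.distrib)
qed

lemma combination_mult:
  assumes "finite {h. u h \<noteq> 0}"
  shows "combination (\<lambda>h. c * u h) = c *\<^sub>C combination u"
proof -
  have "combination (\<lambda>h. c * u h) = (\<Sum>h | u h \<noteq> 0. (c * u h) *\<^sub>C h)"
    by (rule combination_superset) (use assms in auto)
  then show ?thesis
    unfolding combination_def linear_sum[OF bounded_linear.linear[OF bounded_linear_scaleC_right]]
    by (simp only: scaleC_scaleC)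
qed

lemma finite_support_add: "finite {h. u h \<noteq> 0} \<Longrightarrow> finite {h. v h \<noteq> 0}
    \<Longrightarrow> finite {h. u h + v h \<noteq> (0::complex)}"
  by (rule finite_subset[of _ "{h. u h \<noteq> 0} \<union> {h. v h \<noteq> 0}"]) auto

lemma finite_support_mult: "finite {h. u h \<noteq> 0} \<Longrightarrow> finite {h. c * u h \<noteq> (0::complex)}"
  by (rule finite_subset[of _ "{h. u h \<noteq> 0}"]) auto

text \<open>The form is antilinear in \<open>h\<close>, so the Riesz representation is applied to
  its conjugate.\<close>

lemma bounded_form_operator:
  fixes B :: "'h::complex_hilbert_space \<Rightarrow> 'h \<Rightarrow> complex"
  assumes add: "\<And>h k k'. B h (k + k') = B h k + B h k'" "\<And>h h' k. B (h + h') k = B h k + B h' k"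
    and scale: "\<And>c h k. B h (c *\<^sub>C k) = c * B h k" "\<And>c h k. B (c *\<^sub>C h) k = cnj c * B h k"
    and bound: "\<And>h k. norm (B h k) \<le> C * norm h * norm k" and C: "C \<ge> 0"
  shows "\<exists>T. (\<forall>h k. cinner h (op_apply T k) = B h k) \<and> norm T \<le> C"
proof -
  have "\<exists>y. \<forall>h. cnj (B h k) = cinner y h" for k
  proof (rule riesz_representation)
    show "bounded_linear (\<lambda>h. cnj (B h k))"
    proof (rule bounded_linear_intro[where K = "C * norm k"])
      show "cnj (B (x + y) k) = cnj (B x k) + cnj (B y k)" for x y by (simp add: add)
      show "cnj (B (r *\<^sub>R x) k) = r *\<^sub>R cnj (B x k)" for r x
        using scale(2)[of "complex_of_real r" x k] by (simp add: scaleC_of_real scaleR_conv_of_real)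
      show "norm (cnj (B x k)) \<le> norm x * (C * norm k)" for x using bound[of x k]
          by (simp add: mult_ac)
    qed
  qed (simp add: scale)
  then obtain T where T: "\<And>h k. cnj (B h k) = cinner (T k) h" by metis
  have T': "cinner h (T k) = B h k" for h k
    using T[of h k] cinner_commute[of h "T k"] by (metis complex_cnj_cnj)
  have "norm (T k) \<le> C * norm k" for k
  proof (cases "T k = 0")
    case False
    have "(norm (T k))\<^sup>2 = norm (B (T k) k)" unfolding T'[symmetric] cinner_self norm_of_real
        by simp
    also have "\<dots> \<le> C * norm (T k) * norm k" by (rule bound)
    finally show ?thesis using False by (simp add: power2_eq_square mult_ac)
  qed (use C in simp)
  moreover have "clinear T"
    unfolding clinear_def
    by (intro conjI allI; rule cinner_extensionality) (simp_all add: T' add scale cinner_add_right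
      cinner_scaleC_right)
  ultimately have bc: "bounded_clinear T" by (auto simp: bounded_clinear_def)
  then have "norm (Bounded_op T) \<le> C"
    using \<open>\<And>k. norm (T k) \<le> C * norm k\<close> C by (intro norm_op_bound) (auto simp: Bounded_op_inverse)
  then show ?thesis using bc by (intro exI[of _ "Bounded_op T"]) (simp add: Bounded_op_inverse T')
qed

lemma sum_rotate:
  "(\<Sum>i\<in>I. \<Sum>j\<in>J. \<Sum>l\<in>L. g i j l) = (\<Sum>l\<in>L. \<Sum>i\<in>I. \<Sum>j\<in>J. (g i j l :: 'b::comm_monoid_add))"
  by (subst sum.swap[of _ I L], rule sum.cong[OF refl], rule sum.swap)

section \<open>From a dominated functional to a completely positive map\<close>

locale dominated_functional =
  fixes s :: "('h::complex_hilbert_space \<Rightarrow> 'h \<Rightarrow> 'a::unital_cstar_algebra c0) \<Rightarrow> real" and M :: real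
  assumes M_pos: "M > 0"
    and s_add: "\<And>v w. v \<in> dominated_space \<Longrightarrow> w \<in> dominated_space \<Longrightarrow> s (v + w) = s v + s w"
    and s_scaleR: "\<And>r w. w \<in> dominated_space \<Longrightarrow> s (r *\<^sub>R w) = r * s w"
    and s_le: "\<And>w. w \<in> dominated_space \<Longrightarrow> s w \<le> M * dominating_value w"
begin

lemma s_le_dominated: "w \<in> dominated_space \<Longrightarrow> dominated (herm w) r \<Longrightarrow> s w \<le> M * r"
  using s_le[of w] dominating_value_le[of w r] M_pos
    by (meson mult_left_mono less_imp_le order_trans)

lemma s_minus: "w \<in> dominated_space \<Longrightarrow> s (- w) = - s w"
  using s_scaleR[of w "- 1"] by simp

lemma s_zero: "s 0 = 0"
  using s_scaleR[OF subspace_0[OF subspace_dominated_space], of 0] by simp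

lemma s_sum: "(\<And>i. i \<in> I \<Longrightarrow> g i \<in> dominated_space) \<Longrightarrow> s (\<Sum>i\<in>I. g i) = (\<Sum>i\<in>I. s (g i))"
  by (induction I rule: infinite_finite_induct)
    (auto simp: s_zero s_add subspace_sum[OF subspace_dominated_space])

text \<open>Domination gives a bound by a sum of two squares. Scaling \<open>u\<close> by
  \<open>t\<close> and \<open>v\<close> by \<open>1 / t\<close> leaves the matrix unchanged, and the
  best \<open>t\<close> turns the sum into twice the product.\<close>

lemma s_elementary_bound:
  assumes u: "finite {h. u h \<noteq> 0}" and v: "finite {h. v h \<noteq> 0}"
  shows "\<bar>s (elementary u v x)\<bar> \<le> 2 * M * norm x * norm (combination u) * norm (combination v)"
proof -
  let ?a = "norm (combination u)" and ?b = "norm (combination v)"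
  have key: "s (elementary u v x) \<le> 2 * M * (norm x + \<epsilon>) * (?a + \<epsilon>) * (?b + \<epsilon>)" if \<epsilon>: "\<epsilon> > 0"
      for x \<epsilon>
  proof -
    \<comment> \<open>The ratio that balances the two squares; \<open>\<epsilon>\<close> keeps it
      positive and finite when one of the vectors is 0.\<close>
    define t where "t = sqrt ((?b + \<epsilon>) / (?a + \<epsilon>))"
    have pos: "?a + \<epsilon> > 0" "?b + \<epsilon> > 0" "norm x + \<epsilon> > 0" using \<epsilon> by (simp_all add: add_nonneg_pos)
    have t: "t > 0" using pos by (simp add: t_def)
    let ?u = "\<lambda>h. complex_of_real t * u h" and ?v = "\<lambda>h. complex_of_real (1 / t) * v h"
    have eq: "elementary ?u ?v x = elementary u v x"
      using t unfolding elementary_simps by (simp add: scaleC_scaleC)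
    note fin = finite_support_mult[OF u, of "complex_of_real t"] finite_support_mult[OF v, of
        "complex_of_real (1 / t)"]
    have "norm x \<le> norm x + \<epsilon>" using \<epsilon> by simp
    from s_le_dominated[OF elementary_in_dominated_space[OF fin] dominated_elementary_scaled[OF
        fin this pos(3)]]
    have "s (elementary u v x) \<le> M * ((norm x + \<epsilon>) * ((norm (combination ?u))\<^sup>2 + (norm
        (combination ?v))\<^sup>2))"
      unfolding eq .
    also have "(norm (combination ?u))\<^sup>2 = t\<^sup>2 * ?a\<^sup>2" unfolding combination_scaleR using t
        by (simp add: power_mult_distrib)
    also have "(norm (combination ?v))\<^sup>2 = ?b\<^sup>2 / t\<^sup>2" unfolding combination_scaleR using t
        by (simp add: power_mult_distrib power_divide)
    also have "t\<^sup>2 = (?b + \<epsilon>) / (?a + \<epsilon>)" using pos by (simp add: t_def)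
    also have "M * ((norm x + \<epsilon>) * ((?b + \<epsilon>) / (?a + \<epsilon>) * ?a\<^sup>2 + ?b\<^sup>2 / ((?b + \<epsilon>) / (?a + \<epsilon>))))
        \<le> M * ((norm x + \<epsilon>) * (2 * (?a + \<epsilon>) * (?b + \<epsilon>)))"
    proof (intro mult_left_mono)
      show "(?b + \<epsilon>) / (?a + \<epsilon>) * ?a\<^sup>2 + ?b\<^sup>2 / ((?b + \<epsilon>) / (?a + \<epsilon>)) \<le> 2 * (?a + \<epsilon>) * (?b + \<epsilon>)"
      proof -
      have "?a\<^sup>2 \<le> (?a + \<epsilon>)\<^sup>2" "?b\<^sup>2 \<le> (?b + \<epsilon>)\<^sup>2" using \<epsilon> by (auto intro!: power_mono)
      then have "(?b + \<epsilon>) / (?a + \<epsilon>) * ?a\<^sup>2 \<le> (?b + \<epsilon>) / (?a + \<epsilon>) * (?a + \<epsilon>)\<^sup>2"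
        "?b\<^sup>2 / ((?b + \<epsilon>) / (?a + \<epsilon>)) \<le> (?b + \<epsilon>)\<^sup>2 / ((?b + \<epsilon>) / (?a + \<epsilon>))"
        using pos by (auto intro!: mult_left_mono divide_right_mono)
      note le = add_mono[OF this]
      have eqs: "(?b + \<epsilon>) / (?a + \<epsilon>) * (?a + \<epsilon>)\<^sup>2 = (?a + \<epsilon>) * (?b + \<epsilon>)"
        "(?b + \<epsilon>)\<^sup>2 / ((?b + \<epsilon>) / (?a + \<epsilon>)) = (?a + \<epsilon>) * (?b + \<epsilon>)"
        using pos by (simp_all add: power2_eq_square)
      have dbl: "2 * (?a + \<epsilon>) * (?b + \<epsilon>) = (?a + \<epsilon>) * (?b + \<epsilon>) + (?a + \<epsilon>) * (?b + \<epsilon>)" by simp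
      show ?thesis using le unfolding eqs dbl .
      qed
    qed (use pos M_pos in auto)
    finally show ?thesis by (simp only: mult_ac)
  qed
  have "s (elementary u v x) \<le> 2 * M * norm x * ?a * ?b" for x
  proof (rule tendsto_lowerbound)
    show "((\<lambda>\<epsilon>. 2 * M * (norm x + \<epsilon>) * (?a + \<epsilon>) * (?b + \<epsilon>)) \<longlongrightarrow> 2 * M * norm x * ?a * ?b) (at_right
        0)"
      by (auto intro!: tendsto_eq_intros)
    show "\<forall>\<^sub>F \<epsilon> in at_right 0. s (elementary u v x) \<le> 2 * M * (norm x + \<epsilon>) * (?a + \<epsilon>) * (?b + \<epsilon>)"
      using key eventually_at_right_less[of 0] by (auto elim: eventually_mono)
  qed simp
  from this[of x] this[of "- x"] show ?thesis
    using s_minus[OF elementary_in_dominated_space[OF u v, of x]]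
      by (simp add: elementary_simps abs_le_iff)
qed

text \<open>By the preceding bound, formal vectors with value 0 are annihilated. This is where
  labels begin to behave like vectors, and linearity in the second index follows.\<close>

lemma s_elementary_cong_right:
  assumes u: "finite {h. u h \<noteq> 0}" and v: "finite {h. v h \<noteq> 0}" and v': "finite {h. v' h \<noteq> 0}"
    and eq: "combination v = combination v'"
  shows "s (elementary u v x) = s (elementary u v' x)"
proof -
  note mv = finite_support_mult[OF v', of "-1"]
  have "combination (\<lambda>h. v h + (-1) * v' h) = 0"
    unfolding combination_add[OF v mv] combination_mult[OF v'] eq
    using scaleC_of_real[of "-1" "combination v'"] by simp
  then have "s (elementary u (\<lambda>h. v h + (-1) * v' h) x) = 0"
    using s_elementary_bound[OF u finite_support_add[OF v mv], of x] by simp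
  moreover have "elementary u (\<lambda>h. v h + (-1) * v' h) x
      = elementary u v x + (- 1) *\<^sub>R elementary u v' x"
    unfolding elementary_simps(4,6) elementary_simps(2)[symmetric] using scaleC_of_real[of "-1" x]
      by simp
  ultimately have "0 = s (elementary u v x + (- 1) *\<^sub>R elementary u v' x)" by (simp only:)
  also have "\<dots> = s (elementary u v x) + s ((- 1) *\<^sub>R elementary u v' x)"
    by (intro s_add subspace_scale[OF subspace_dominated_space] elementary_in_dominated_space u v
      v')
  also have "s ((- 1) *\<^sub>R elementary u v' x) = (- 1) * s (elementary u v' x)"
    by (intro s_scaleR elementary_in_dominated_space u v')
  finally show ?thesis by simp
qed

lemma herm_star_elementary: "herm (elementary v u (star x)) = herm (elementary u v x)"
  by (simp add: herm_def elementary_def fun_eq_iff scaleC_c0.rep_eq star_c0.rep_eq star_scaleC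
    star_star mult.commute add.commute)

text \<open>The difference of the two matrices and its negative are sent to 0 by
  \<open>herm\<close>, so both are dominated with value 0.\<close>

lemma s_eqI_herm:
  assumes v: "v \<in> dominated_space" and w: "w \<in> dominated_space" and eq: "herm v = herm w"
  shows "s v = s w"
proof -
  have mv: "- v \<in> dominated_space" and mw: "- w \<in> dominated_space"
    using subspace_neg[OF subspace_dominated_space] v w by auto
  have um: "herm (- x) = (\<lambda>h k m. - herm x h k m)" for x :: "'h \<Rightarrow> 'h \<Rightarrow> 'a c0"
    using herm_scaleR[of "-1" x] by simp
  have "herm (v + - w) = (\<lambda>h k m. 0)" "herm (w + - v) = (\<lambda>h k m. 0)"
    by (simp_all only: herm_add um eq) simp_all
  then have "s (v + - w) \<le> 0" "s (w + - v) \<le> 0"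
    using s_le_dominated[of _ 0] dominated_zero subspace_add[OF subspace_dominated_space v mw]
      subspace_add[OF subspace_dominated_space w mv] by (metis mult_zero_right)+
  then show ?thesis using s_add[OF v mw] s_add[OF w mv] s_minus[OF v] s_minus[OF w] by simp
qed

lemma s_star: "finite {h. u h \<noteq> 0} \<Longrightarrow> finite {h. v h \<noteq> 0} \<Longrightarrow>
    s (elementary v u (star x)) = s (elementary u v x)"
  by (rule s_eqI_herm) (auto simp: elementary_in_dominated_space herm_star_elementary)

text \<open>Meant to be \<open>2 * Re (cinner h (op_apply (\<Psi> x) k))\<close> for the operator
  map \<Psi> still to be constructed.\<close>

definition coefficient :: "'a c0 \<Rightarrow> 'h \<Rightarrow> 'h \<Rightarrow> real" where
  "coefficient x h k = s (elementary (basis_vector h) (basis_vector k) x)"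

lemmas elem_in = elementary_in_dominated_space[OF finite_basis_vector finite_basis_vector]

lemma coefficient_add: "coefficient (x + y) h k = coefficient x h k + coefficient y h k"
  by (simp add: coefficient_def elementary_simps s_add elem_in)

lemma coefficient_scaleR: "coefficient (r *\<^sub>R x) h k = r * coefficient x h k"
  by (simp add: coefficient_def elementary_simps s_scaleR elem_in)

lemma coefficient_add_right: "coefficient x h (k + k') = coefficient x h k + coefficient x h k'"
proof -
  have "coefficient x h (k + k') = s (elementary (basis_vector h) (\<lambda>g. basis_vector k g +
      basis_vector k' g) x)"
    unfolding coefficient_def
    by (rule s_elementary_cong_right) (auto simp: combination_add intro!: finite_support_add)
  then show ?thesis by (simp add: elementary_simps s_add elem_in coefficient_def)
qed

lemma coefficient_scale_right: "coefficient x h (c *\<^sub>C k) = coefficient (c *\<^sub>C x) h k"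
proof -
  have "coefficient x h (c *\<^sub>C k) = s (elementary (basis_vector h) (\<lambda>g. c * basis_vector k g) x)"
    unfolding coefficient_def
    by (rule s_elementary_cong_right) (auto simp: combination_mult intro!: finite_support_mult)
  then show ?thesis by (simp add: elementary_simps coefficient_def)
qed

lemma coefficient_star: "coefficient (star x) h k = coefficient x k h"
  unfolding coefficient_def by (rule s_star) auto

lemma coefficient_bound: "\<bar>coefficient x h k\<bar> \<le> 2 * M * norm x * norm h * norm k"
  using s_elementary_bound[OF finite_basis_vector finite_basis_vector]
    by (simp add: coefficient_def)

text \<open>The factor 1/2 compensates for \<^const>\<open>herm\<close> adding the adjoint.\<close>

definition complex_form :: "'a c0 \<Rightarrow> 'h \<Rightarrow> 'h \<Rightarrow> complex" where
  "complex_form x h k = Complex (coefficient x h k / 2) (- coefficient (\<i> *\<^sub>C x) h k / 2)"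

lemma scaleC_Re_Im: "c *\<^sub>C (x::'b::complex_normed_space) = Re c *\<^sub>R x + Im c *\<^sub>R \<i> *\<^sub>C x"
proof -
  have "c *\<^sub>C x = (complex_of_real (Re c) + complex_of_real (Im c) * \<i>) *\<^sub>C x"
    by (simp add: complex_eq[symmetric] mult.commute)
  then show ?thesis unfolding scaleC_add_left scaleC_scaleC[symmetric] scaleC_of_real .
qed

lemma coefficient_scaleC: "coefficient (c *\<^sub>C x) h k
    = Re c * coefficient x h k + Im c * coefficient (\<i> *\<^sub>C x) h k"
  by (subst scaleC_Re_Im) (simp add: coefficient_add coefficient_scaleR)

text \<open>A complex-linear functional is determined by its real part through Im z = - Re (\<i> z),
  which is the origin of the second component of \<open>complex_form\<close>.\<close>

lemma complex_form_scale_arg: "complex_form (c *\<^sub>C x) h k = c * complex_form x h k"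
  by (simp add: complex_form_def scaleC_scaleC coefficient_scaleC[of "\<i> * c"]
    coefficient_scaleC[of c] complex_eq_iff field_simps)

lemma complex_form_add_arg: "complex_form (x + y) h k = complex_form x h k + complex_form y h k"
  by (simp add: complex_form_def scaleC_add_right coefficient_add complex_eq_iff add_divide_distrib)

lemma complex_form_star: "complex_form (star x) h k = cnj (complex_form x k h)"
proof -
  have "\<i> *\<^sub>C star x = star ((- \<i>) *\<^sub>C x)" by (simp add: star_scaleC)
  then show ?thesis
    using coefficient_scaleC[of "- \<i>" x k h]
      by (simp add: complex_form_def coefficient_star complex_eq_iff)
qed

lemma complex_form_right:
  "complex_form x h (k + k') = complex_form x h k + complex_form x h k'"
  "complex_form x h (c *\<^sub>C k) = c * complex_form x h k"
proof -
  show "complex_form x h (k + k') = complex_form x h k + complex_form x h k'"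
    by (simp add: complex_form_def coefficient_add_right complex_eq_iff add_divide_distrib)
  have "complex_form x h (c *\<^sub>C k) = complex_form (c *\<^sub>C x) h k"
    by (simp add: complex_form_def coefficient_scale_right scaleC_scaleC mult.commute)
  then show "complex_form x h (c *\<^sub>C k) = c * complex_form x h k"
      by (simp add: complex_form_scale_arg)
qed

lemma complex_form_left:
  "complex_form x (h + h') k = complex_form x h k + complex_form x h' k"
  "complex_form x (c *\<^sub>C h) k = cnj c * complex_form x h k"
  using complex_form_star[of "star x"] by (simp_all add: star_star complex_form_right)

lemma complex_form_bound: "norm (complex_form x h k) \<le> 2 * M * norm x * norm h * norm k"
  using cmod_le[of "complex_form x h k"] coefficient_bound[of x h k] coefficient_bound[of
    "\<i> *\<^sub>C x" h k]
  by (simp add: complex_form_def norm_scaleC)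

lemma form_operator_exists:
  "\<exists>\<Psi>. \<forall>x. (\<forall>h k. cinner h (op_apply (\<Psi> x) k) = complex_form x h k) \<and> norm (\<Psi> x) \<le> 2 * M * norm x"
proof -
  have "\<exists>T. (\<forall>h k. cinner h (op_apply T k) = complex_form x h k) \<and> norm T \<le> 2 * M * norm x" for x
    by (rule bounded_form_operator) (use M_pos complex_form_bound in \<open>auto simp:
      complex_form_right complex_form_left\<close>)
  then show ?thesis by metis
qed

text \<open>In the labels the matrix is \<open>star (\<beta> h) * \<beta> k\<close>, where
  \<open>\<beta>\<close> adds up the \<open>b i\<close> whose vectors \<open>v i\<close> coincide.
  Its negative arises from 0 by subtracting squares, hence is dominated with value 0.\<close>

lemma s_square_nonneg:
  fixes b :: "nat \<Rightarrow> 'a c0"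
  shows "0 \<le> (\<Sum>i<n. \<Sum>j<n. coefficient (star (b i) * b j) (v i) (v j))"
proof -
  define \<beta> where "\<beta> h = (\<Sum>i<n. basis_vector (v i) h *\<^sub>C b i)" for h
  define w where "w = (\<Sum>i<n. \<Sum>j<n. elementary (basis_vector (v i)) (basis_vector (v j)) (star (b
      i) * b j))"
  have w: "w h k = star (\<beta> h) * \<beta> k" for h k
    unfolding w_def \<beta>_def sum_fun_apply elementary_def star_sum sum_distrib_left sum_distrib_right
    by (subst sum.swap) (simp add: star_scaleC scaleC_mult_left scaleC_mult_right scaleC_scaleC
      mult.commute)
  have wD: "w \<in> dominated_space"
    unfolding w_def by (intro subspace_sum[OF subspace_dominated_space] elem_in)
  have "finite {h. (\<lambda>m. entry (\<beta> h) m) \<noteq> (\<lambda>m. 0)}"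
  proof (rule finite_subset)
    show "{h. (\<lambda>m. entry (\<beta> h) m) \<noteq> (\<lambda>m. 0)} \<subseteq> v ` {..<n}"
    proof (rule subsetI, rule ccontr)
      fix h assume h: "h \<in> {h. (\<lambda>m. entry (\<beta> h) m) \<noteq> (\<lambda>m. 0)}" "h \<notin> v ` {..<n}"
      then have "\<beta> h = 0" unfolding \<beta>_def by (intro sum.neutral) (auto simp: basis_vector_def)
      then show False using h by (simp add: zero_c0.rep_eq)
    qed
  qed simp
  note fin = this
  have "dominated (herm (- w)) 0"
  proof -
    \<comment> \<open>The square is subtracted twice because \<open>herm\<close> doubles a hermitian
      matrix.\<close>
    have "herm (- w) = (\<lambda>h k m. 0 - star (entry (\<beta> h) m) * entry (\<beta> k) m - star (entry (\<beta> h) m) *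
        entry (\<beta> k) m)"
      by (simp add: herm_def w fun_eq_iff uminus_c0.rep_eq times_c0.rep_eq star_c0.rep_eq
        star_minus star_mult star_star)
    then show ?thesis
      using dominated_square[OF dominated_square[OF dominated_zero fin] fin] by (simp only:)
  qed
  from s_le_dominated[OF subspace_neg[OF subspace_dominated_space wD] this]
  have "0 \<le> s w" using s_minus[OF wD] by simp
  also have "s w = (\<Sum>i<n. s (\<Sum>j<n. elementary (basis_vector (v i)) (basis_vector (v j)) (star (b
      i) * b j)))"
    unfolding w_def by (intro s_sum subspace_sum[OF subspace_dominated_space] elem_in)
  also have "\<dots> = (\<Sum>i<n. \<Sum>j<n. coefficient (star (b i) * b j) (v i) (v j))"
    unfolding coefficient_def by (intro sum.cong refl s_sum elem_in)
  finally show ?thesis .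
qed

theorem completely_positive_form_operator:
  "\<exists>\<Psi>. completely_positive \<Psi> \<and> (\<forall>x h k. cinner h (op_apply (\<Psi> x) k) = complex_form x h k)"
proof -
  obtain \<Psi> where \<Psi>: "\<And>x h k. cinner h (op_apply (\<Psi> x) k) = complex_form x h k"
    and n\<Psi>: "\<And>x. norm (\<Psi> x) \<le> 2 * M * norm x"
    using form_operator_exists by blast
  have clin: "clinear \<Psi>"
    unfolding clinear_def
    by (intro conjI allI; rule op_eqI; rule cinner_extensionality)
      (simp_all add: op_apply_simps cinner_add_right cinner_scaleC_right \<Psi> complex_form_add_arg
        complex_form_scale_arg)
  have star: "\<Psi> (star x) = star (\<Psi> x)" for x
  proof (rule op_eqI, rule cinner_extensionality)
    fix h k
    have "cinner h (op_apply (star (\<Psi> x)) k) = cnj (complex_form x k h)"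
      unfolding cinner_star_right by (metis \<Psi> cinner_commute)
    then show "cinner h (op_apply (\<Psi> (star x)) k) = cinner h (op_apply (star (\<Psi> x)) k)"
      by (simp add: \<Psi> complex_form_star)
  qed
  have sum: "\<Psi> (\<Sum>i\<in>I. g i) = (\<Sum>i\<in>I. \<Psi> (g i))" for I :: "nat set" and g
  proof (induction I rule: infinite_finite_induct)
    case (infinite A) then show ?case using clin unfolding clinear_def
        by (metis add_cancel_right_right sum.infinite)
  next
    case empty then show ?case using clin unfolding clinear_def
        by (metis add_cancel_right_right sum.empty)
  next
    case (insert x F) then show ?case using clin unfolding clinear_def by simp
  qed
  have "completely_positive \<Psi>"
    unfolding completely_positive_def
  proof (intro conjI allI ballI)
    show "bounded_clinear \<Psi>" using clin n\<Psi> by (auto simp: bounded_clinear_def)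
    show "star_map \<Psi>" using clin star by (auto simp: star_map_def)
    fix n and A :: "'a c0 mat" assume "A \<in> positive_mats n"
    then obtain B where A: "A \<in> carrier_mat n n"
      and B: "\<And>i j. i < n \<Longrightarrow> j < n \<Longrightarrow> A $$ (i, j) = (\<Sum>l<n. star (B l i) * B l j)"
      unfolding positive_mats_iff by blast
    \<comment> \<open>With \<open>l\<close> outermost, the real part of each summand is half of a
      sum as in \<open>s_square_nonneg\<close>, for the row \<open>B l\<close>.\<close>
    have eq: "mform {..<n} (\<lambda>i j. map_mat \<Psi> A $$ (i, j)) v
        = (\<Sum>l<n. \<Sum>i<n. \<Sum>j<n. complex_form (star (B l i) * B l j) (v i) (v j))" for v
    proof -
      have "mform {..<n} (\<lambda>i j. map_mat \<Psi> A $$ (i, j)) v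
        = (\<Sum>i<n. \<Sum>j<n. \<Sum>l<n. complex_form (star (B l i) * B l j) (v i) (v j))"
        unfolding mform_def using A by (intro sum.cong refl) (simp add: B sum op_sum_apply
          cinner_sum_right \<Psi>)
      also have "\<dots> = (\<Sum>l<n. \<Sum>i<n. \<Sum>j<n. complex_form (star (B l i) * B l j) (v i) (v j))"
        by (rule sum_rotate)
      finally show ?thesis .
    qed
    show "map_mat \<Psi> A \<in> positive_mats n"
    proof (subst positive_op_mats_iff, use A in simp, intro allI conjI)
      fix v
      have "star (map_mat \<Psi> A $$ (i, j)) = map_mat \<Psi> A $$ (j, i)" if "i < n" "j < n" for i j
        using that A by (simp add: star[symmetric] B star_sum star_mult star_star)
      from vip_star[of n "\<lambda>i j. map_mat \<Psi> A $$ (i, j)" v v, OF this]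
      have "vip n v (mapply n (\<lambda>i j. map_mat \<Psi> A $$ (i, j)) v)
          = cnj (vip n v (mapply n (\<lambda>i j. map_mat \<Psi> A $$ (i, j)) v))"
        unfolding vip_def cnj_sum by (simp flip: cinner_commute)
      then show "Im (mform {..<n} (\<lambda>i j. map_mat \<Psi> A $$ (i, j)) v) = 0"
        unfolding mform_vip by (simp add: complex_eq_iff)
      show "0 \<le> Re (mform {..<n} (\<lambda>i j. map_mat \<Psi> A $$ (i, j)) v)"
        unfolding eq Re_sum
        by (rule sum_nonneg)
          (use s_square_nonneg[where n = n and v = v] in \<open>simp add: complex_form_def
            sum_divide_distrib[symmetric]\<close>)
    qed
  qed
  then show ?thesis using \<Psi> by blast
qed

end

section \<open>The functional over X and its extension\<close>

context gamma_positive_map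
begin

definition graph_value :: "'h set \<Rightarrow> ('h \<Rightarrow> 'h \<Rightarrow> 'a) \<Rightarrow> real" where
  "graph_value F a = Re (mform F (\<lambda>h k. f (a h k + star (a k h))) (\<lambda>h. h))"

text \<open>A relation rather than a function: several \<open>a\<close> may have the same image
  under \<open>xi \<phi>\<close>, and \<open>F\<close> is any finite set containing the support.
  That the value depends on the image alone is left to the Hahn--Banach theorem.\<close>

definition functional_graph :: "(('h \<Rightarrow> 'h \<Rightarrow> 'a c0) \<times> real) set" where
  "functional_graph = {(\<lambda>h k. xi \<phi> (a h k), graph_value F a) | F a.
    finite F \<and> (\<forall>h k. h \<notin> F \<or> k \<notin> F \<longrightarrow> a h k = 0)}"

lemma graph_value_superset:
  "finite G \<Longrightarrow> F \<subseteq> G \<Longrightarrow> \<forall>h k. h \<notin> F \<or> k \<notin> F \<longrightarrow> a h k = 0 \<Longrightarrow> graph_value F a = graph_value G a"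
  unfolding graph_value_def by (subst mform_superset[of G F]) (auto simp: f_linear)

lemma subspace_functional_graph: "subspace functional_graph"
proof (rule subspaceI)
  have "graph_value {} (\<lambda>h k. 0) = 0" by (simp add: graph_value_def mform_def)
  then show "0 \<in> functional_graph"
    unfolding functional_graph_def
    by (intro CollectI exI[of _ "{}"] exI[of _ "\<lambda>h k. 0"]) (simp add: xi_simps zero_prod_def
      zero_fun_def)
next
  fix x y assume "x \<in> functional_graph" "y \<in> functional_graph"
  then obtain F a G b where F: "finite F" "\<forall>h k. h \<notin> F \<or> k \<notin> F \<longrightarrow> a h k = 0" "x
      = (\<lambda>h k. xi \<phi> (a h k), graph_value F a)"
    and G: "finite G" "\<forall>h k. h \<notin> G \<or> k \<notin> G \<longrightarrow> b h k = 0" "y = (\<lambda>h k. xi \<phi> (b h k), graph_value G b)"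
    unfolding functional_graph_def by blast
  let ?H = "F \<union> G"
  have eq: "graph_value F a = graph_value ?H a" "graph_value G b = graph_value ?H b"
    using F G by (auto intro!: graph_value_superset)
  have "graph_value ?H (\<lambda>h k. a h k + b h k) = graph_value ?H a + graph_value ?H b"
  proof -
    have "f (a h k + b h k + star (a k h + b k h)) = f (a h k + star (a k h)) + f (b h k + star (b
        k h))" for h k
      by (simp add: f_linear star_add)
    then show ?thesis by (simp add: graph_value_def mform_add)
  qed
  then show "x + y \<in> functional_graph"
    unfolding functional_graph_def F(3) G(3) eq using F G
    by (intro CollectI exI[of _ ?H] exI[of _ "\<lambda>h k. a h k + b h k"]) (auto simp: xi_simps
      plus_fun_def)
next
  fix c x assume "x \<in> functional_graph"
  then obtain F a where F: "finite F" "\<forall>h k. h \<notin> F \<or> k \<notin> F \<longrightarrow> a h k = 0" "x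
      = (\<lambda>h k. xi \<phi> (a h k), graph_value F a)"
    unfolding functional_graph_def by blast
  have "graph_value F (\<lambda>h k. c *\<^sub>R a h k) = c * graph_value F a"
  proof -
    have "f (c *\<^sub>R a h k + star (c *\<^sub>R a k h)) = c *\<^sub>R f (a h k + star (a k h))" for h k
      by (simp add: f_linear star_scaleR scaleR_add_right)
    then show ?thesis by (simp add: graph_value_def mform_scaleR)
  qed
  then show "c *\<^sub>R x \<in> functional_graph"
    unfolding functional_graph_def F(3) using F
    by (intro CollectI exI[of _ F] exI[of _ "\<lambda>h k. c *\<^sub>R a h k"]) (auto simp: xi_simps
      scaleR_fun_def)
qed

text \<open>Such a matrix is a finite sum of elementary ones at pairs of labels.\<close>

lemma finitely_supported_in_dominated_space:
  assumes F: "finite F" and supp: "\<And>h k. h \<notin> F \<or> k \<notin> F \<Longrightarrow> w h k = 0"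
  shows "w \<in> dominated_space"
proof -
  have "w = (\<Sum>h\<in>F. \<Sum>k\<in>F. elementary (basis_vector h) (basis_vector k) (w h k))"
  proof (intro ext)
    fix g l
    have "(\<Sum>h\<in>F. \<Sum>k\<in>F. elementary (basis_vector h) (basis_vector k) (w h k)) g l
      = (\<Sum>h\<in>F. \<Sum>k\<in>F. if k = l then if h = g then w g l else 0 else 0)"
      unfolding sum_fun_apply by (intro sum.cong refl) (auto simp: elementary_def basis_vector_def)
    also have "\<dots> = w g l" using F supp[of g l]
        by (cases "g \<in> F"; cases "l \<in> F") (simp_all add: sum.delta)
    finally show "w g l = (\<Sum>h\<in>F. \<Sum>k\<in>F. elementary (basis_vector h) (basis_vector k) (w h k)) g l"
        by simp
  qed
  also have "\<dots> \<in> dominated_space"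
    by (intro subspace_sum[OF subspace_dominated_space] elementary_in_dominated_space) auto
  finally show ?thesis .
qed

text \<open>The graph prescribes the extended functional on matrices with a single entry
  \<open>xi \<phi> a\<close>, and these determine all coefficients of the operator built from
  it.\<close>

theorem completely_positive_extension:
  "\<exists>\<Psi>. completely_positive \<Psi> \<and> (\<forall>a. \<Psi> (xi \<phi> a) = f a)"
proof -
  obtain M where M: "M > 0"
    and bound: "\<forall>F a \<tau>. finite F \<longrightarrow> (\<forall>h k. h \<notin> F \<or> k \<notin> F \<longrightarrow> a h k = 0) \<longrightarrow>
      dominated (herm (\<lambda>h k. xi \<phi> (a h k))) \<tau> \<longrightarrow> graph_value F a \<le> M * \<tau>"
    using graph_bound[folded graph_value_def] by (elim exE conjE) (rule that)
  have graph: "w \<in> dominated_space \<and> r \<le> M * dominating_value w"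
      if wr: "(w, r) \<in> functional_graph" for w r
  proof -
    obtain F a where F: "finite F" "\<forall>h k. h \<notin> F \<or> k \<notin> F \<longrightarrow> a h k = 0"
      and w: "w = (\<lambda>h k. xi \<phi> (a h k))" and r: "r = graph_value F a"
      using wr unfolding functional_graph_def by blast
    have wD: "w \<in> dominated_space"
      unfolding w by (rule finitely_supported_in_dominated_space[OF F(1)]) (use F(2) xi_simps(5)
        in auto)
    have "r / M \<le> dominating_value w"
    proof (rule dominating_value_greatest[OF wD])
      fix q assume "dominated (herm w) q"
      then have "r \<le> M * q" unfolding r w using bound[rule_format, OF F(1), of a q] F(2) by simp
      then show "r / M \<le> q" using M by (simp add: field_simps)
    qed
    then show ?thesis using wD M by (simp add: field_simps)
  qed
  have "\<exists>s. (\<forall>x\<in>dominated_space. \<forall>y\<in>dominated_space. s (x + y) = s x + s y) \<and>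
      (\<forall>t. \<forall>x\<in>dominated_space. s (t *\<^sub>R x) = t * s x) \<and>
      (\<forall>x\<in>dominated_space. s x \<le> M * dominating_value x) \<and> (\<forall>(v, r)\<in>functional_graph. s v = r)"
  proof (rule hahn_banach[OF subspace_dominated_space _ _ subspace_functional_graph])
    show "M * dominating_value (x + y) \<le> M * dominating_value x + M * dominating_value y"
      if "x \<in> dominated_space" "y \<in> dominated_space" for x y :: "'h \<Rightarrow> 'h \<Rightarrow> 'a c0"
      using dominating_value_add[OF that] M by (simp flip: distrib_left)
    show "M * dominating_value (t *\<^sub>R x) = t * (M * dominating_value x)"
      if "0 < t" "x \<in> dominated_space" for t and x :: "'h \<Rightarrow> 'h \<Rightarrow> 'a c0"
      by (simp add: dominating_value_scaleR[OF that(2,1)])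
  qed (rule graph)
  then obtain s where s: "\<forall>x\<in>dominated_space. \<forall>y\<in>dominated_space. s (x + y) = s x + s y"
      "\<forall>t. \<forall>x\<in>dominated_space. s (t *\<^sub>R x) = t * s x"
      "\<forall>x\<in>dominated_space. s x \<le> M * dominating_value x"
      and s_graph: "\<forall>(v, r)\<in>functional_graph. s v = r"
    by (elim exE conjE) (rule that)
  interpret dominated_functional s M
    by unfold_locales (use M s in blast)+
  have rank_one: "mform {h, k} (\<lambda>g l. (cnj (basis_vector h g) * basis_vector k l) *\<^sub>C T) (\<lambda>h. h)
      = cinner h (op_apply T k)"
    "mform {h, k} (\<lambda>g l. (cnj (basis_vector k g) * basis_vector h l) *\<^sub>C T) (\<lambda>h. h)
        = cinner k (op_apply T h)"
    for h k and T :: "'h bounded_op"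
  proof -
    have zero: "basis_vector h g = 0" if "g \<noteq> h" for g h :: 'h using that
        by (simp add: basis_vector_def)
    show "mform {h, k} (\<lambda>g l. (cnj (basis_vector h g) * basis_vector k l) *\<^sub>C T) (\<lambda>h. h)
        = cinner h (op_apply T k)"
      "mform {h, k} (\<lambda>g l. (cnj (basis_vector k g) * basis_vector h l) *\<^sub>C T) (\<lambda>h. h)
          = cinner k (op_apply T h)"
      by (subst mform_rank_one; simp add: zero)+
  qed
  have coeff: "coefficient (xi \<phi> a) h k = 2 * Re (cinner h (op_apply (f a) k))" for a h k
  proof -
    define a' where "a' g l = (cnj (basis_vector h g) * basis_vector k l) *\<^sub>C a" for g l
    have supp: "\<forall>g l. g \<notin> {h, k} \<or> l \<notin> {h, k} \<longrightarrow> a' g l = 0" by (auto simp: a'_def basis_vector_def)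
    have "elementary (basis_vector h) (basis_vector k) (xi \<phi> a) = (\<lambda>g l. xi \<phi> (a' g l))"
      by (simp add: elementary_def a'_def xi_simps)
    moreover have "(\<lambda>g l. xi \<phi> (a' g l), graph_value {h, k} a') \<in> functional_graph"
      unfolding functional_graph_def using supp by blast
    from bspec[OF s_graph this] have "s (\<lambda>g l. xi \<phi> (a' g l)) = graph_value {h, k} a'"
      by (simp only: prod.case)
    ultimately have "coefficient (xi \<phi> a) h k = graph_value {h, k} a'"
      unfolding coefficient_def by (simp only:)
    \<comment> \<open>Here \<open>f_star\<close> enters: the adjoint entry contributes the complex
      conjugate, so the real part is counted twice.\<close>
    also have "\<dots> = Re (mform {h, k} (\<lambda>g l. (cnj (basis_vector h g) * basis_vector k l) *\<^sub>C f a)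
        (\<lambda>h. h)
        + mform {h, k} (\<lambda>g l. (cnj (basis_vector k g) * basis_vector h l) *\<^sub>C star (f a)) (\<lambda>h. h))"
      unfolding graph_value_def mform_add[symmetric]
      by (simp add: a'_def f_linear star_scaleC f_star mult.commute)
    also have "\<dots> = Re (cinner h (op_apply (f a) k) + cinner k (op_apply (star (f a)) h))"
      unfolding rank_one ..
    also have "cinner k (op_apply (star (f a)) h) = cnj (cinner h (op_apply (f a) k))"
      unfolding cinner_star_right by (rule cinner_commute)
    finally show ?thesis by simp
  qed
  obtain \<Psi> where cp: "completely_positive \<Psi>" and \<Psi>: "\<forall>x h k. cinner h (op_apply (\<Psi> x) k)
      = complex_form x h k"
    using completely_positive_form_operator by (elim exE conjE) (rule that)
  have "complex_form (xi \<phi> a) h k = cinner h (op_apply (f a) k)" for a h k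
  proof -
    have "coefficient (\<i> *\<^sub>C xi \<phi> a) h k = 2 * Re (\<i> * cinner h (op_apply (f a) k))"
      using coeff[of "\<i> *\<^sub>C a" h k] by (simp add: xi_simps f_linear op_apply_simps
        cinner_scaleC_right)
    then show ?thesis by (simp add: complex_form_def coeff complex_eq_iff)
  qed
  then have "\<Psi> (xi \<phi> a) = f a" for a
    by (intro op_eqI cinner_extensionality) (simp add: \<Psi>)
  then show ?thesis using cp by blast
qed

end


section \<open>Coordinates of \<open>c\<^sub>0(A)\<close>\<close>

lift_definition single :: "nat \<Rightarrow> 'a::cstar_algebra \<Rightarrow> 'a c0" is "\<lambda>m x k. if k = m then x else 0"
proof -
  fix m and x :: 'a
  have "\<forall>\<^sub>F k in sequentially. (if k = m then x else 0) = 0"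
    by (rule eventually_sequentiallyI[of "Suc m"]) simp
  then show "(\<lambda>k. if k = m then x else 0) \<longlonglongrightarrow> 0" by (rule tendsto_eventually)
qed

lemma single_hom: "single m (x + y) = single m x + single m y" "single m (c *\<^sub>C x)
    = c *\<^sub>C single m x"
  "single m (x * y) = single m x * single m y" "single m (star x) = star (single m x)"
  by (auto intro!: c0_eqI simp: single.rep_eq plus_c0.rep_eq scaleC_c0.rep_eq times_c0.rep_eq
    star_c0.rep_eq)

lemma single_sum: "single m (\<Sum>i\<in>I. g i) = (\<Sum>i\<in>I. single m (g i))"
proof -
  have "single m 0 = 0" by (auto intro!: c0_eqI simp: single.rep_eq zero_c0.rep_eq)
  then show ?thesis by (induction I rule: infinite_finite_induct) (auto simp: single_hom)
qed

lemma norm_single_le: "norm (single m x) \<le> norm x"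
  by (rule norm_c0_le) (auto simp: single.rep_eq)

lemma single_sums: "(\<lambda>m. single m (entry x m)) sums x"
  unfolding sums_def
proof (rule LIMSEQ_I)
  fix e :: real assume e: "0 < e"
  have entry_sum: "entry (\<Sum>m<N. single m (entry x m)) k = (if k < N then entry x k else 0)" for N k
    by (induction N) (auto simp: zero_c0.rep_eq plus_c0.rep_eq single.rep_eq)
  obtain K where K: "\<And>k. k \<ge> K \<Longrightarrow> norm (entry x k) < e / 2"
    using LIMSEQ_D[OF entry_tendsto, of "e / 2" x] e by auto
  have le: "norm ((\<Sum>m<N. single m (entry x m)) - x) \<le> e / 2" if "N \<ge> K" for N
  proof (rule norm_c0_le)
    fix k
    show "norm (entry ((\<Sum>m<N. single m (entry x m)) - x) k) \<le> e / 2"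
      using e that K[of k] by (cases "k < N") (simp_all add: minus_c0.rep_eq entry_sum)
  qed
  show "\<exists>K. \<forall>N\<ge>K. norm ((\<Sum>m<N. single m (entry x m)) - x) < e"
  proof (intro exI[of _ K] allI impI)
    fix N assume "K \<le> N"
    from le[OF this] e show "norm ((\<Sum>m<N. single m (entry x m)) - x) < e" by linarith
  qed
qed

text \<open>The embedding \<open>single m\<close> is a *-homomorphism, so applied to the entries it
  takes factorisations to factorisations.\<close>

lemma completely_positive_single:
  fixes \<Psi> :: "'a::cstar_algebra c0 \<Rightarrow> 'b::cstar_algebra"
  assumes \<Psi>: "completely_positive \<Psi>"
  shows "completely_positive (\<lambda>x. \<Psi> (single m x))"
  unfolding completely_positive_def
proof (intro conjI allI ballI)
  obtain K where K: "\<And>x. norm (\<Psi> x) \<le> norm x * K" "K \<ge> 0"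
    using \<Psi> bounded_linear.nonneg_bounded unfolding completely_positive_def bounded_clinear_iff
      by blast
  have "norm (\<Psi> (single m x)) \<le> K * norm x" for x
    using K(1)[of "single m x"] mult_right_mono[OF norm_single_le[of m x] K(2)]
      by (simp add: mult.commute)
  then show "bounded_clinear (\<lambda>x. \<Psi> (single m x))"
    using \<Psi> unfolding completely_positive_def bounded_clinear_def clinear_def single_hom by blast
  show "star_map (\<lambda>x. \<Psi> (single m x))"
    using \<Psi> unfolding completely_positive_def star_map_def clinear_def single_hom by blast
  fix n and A :: "'a mat" assume "A \<in> positive_mats n"
  then obtain B where A: "A \<in> carrier_mat n n"
    and B: "\<And>i j. i < n \<Longrightarrow> j < n \<Longrightarrow> A $$ (i, j) = (\<Sum>l<n. star (B l i) * B l j)"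
    unfolding positive_mats_iff by blast
  have "map_mat (single m) A \<in> positive_mats n"
    unfolding positive_mats_iff
    by (intro conjI exI[of _ "\<lambda>l i. single m (B l i)"]) (use A in \<open>auto simp: B single_sum
      single_hom\<close>)
  then have "map_mat \<Psi> (map_mat (single m) A) \<in> positive_mats n"
    using \<Psi> unfolding completely_positive_def by blast
  also have "map_mat \<Psi> (map_mat (single m) A) = map_mat (\<lambda>x. \<Psi> (single m x)) A"
    by (rule eq_matI) auto
  finally show "map_mat (\<lambda>x. \<Psi> (single m x)) A \<in> positive_mats n" .
qed

section \<open>Forms of convergent series and the equivalence\<close>

lemma bounded_linear_cinner_apply: "bounded_linear (\<lambda>T. cinner x (op_apply T y))"
proof (rule bounded_linear_intro[where K = "norm x * norm y"])
  show "norm (cinner x (op_apply T y)) \<le> norm T * (norm x * norm y)" for T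
    using cinner_Cauchy_Schwarz[of x "op_apply T y"] mult_left_mono[OF norm_op_apply[of T y]
      norm_ge_zero[of x]]
    by (simp add: mult_ac)
qed (auto simp: op_apply_simps cinner_add_right cinner_scaleR_right scaleR_conv_of_real)

text \<open>Norm convergence in each entry makes the form of \<open>map_mat f A\<close> the sum of
  the forms of the positive matrices \<open>map_mat (\<psi> k) (map_mat (\<phi> k) A)\<close>, all
  of them real and nonnegative.\<close>

lemma decomposable_imp_positive:
  assumes dec: "decomposable \<phi> f" and A: "A \<in> Gamma_plus \<phi> n"
  shows "map_mat f A \<in> positive_mats n"
proof -
  obtain \<psi> where cp: "\<And>k. completely_positive (\<psi> k)" and sums: "\<And>a. (\<lambda>k. \<psi> k (\<phi> k a)) sums f a"
    using dec unfolding decomposable_def by blast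
  have A_car: "A \<in> carrier_mat n n" and A_pos: "\<And>k. map_mat (\<phi> k) A \<in> positive_mats n"
    using A by (auto simp: Gamma_plus_def)
  let ?q = "\<lambda>k v. mform {..<n} (\<lambda>i j. map_mat (\<psi> k) (map_mat (\<phi> k) A) $$ (i, j)) v"
  have "map_mat (\<psi> k) (map_mat (\<phi> k) A) \<in> positive_mats n" for k
    using cp A_pos unfolding completely_positive_def by blast
  then have q: "Im (?q k v) = 0" "0 \<le> Re (?q k v)" for k v
    using positive_op_mats_iff[of "map_mat (\<psi> k) (map_mat (\<phi> k) A)" n] A_car by auto
  have lim: "(\<lambda>k. ?q k v) sums mform {..<n} (\<lambda>i j. map_mat f A $$ (i, j)) v" for v
    unfolding mform_def
    by (intro sums_sum bounded_linear.sums[OF bounded_linear_cinner_apply]) (use A_car sums in auto)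
  show ?thesis
  proof (subst positive_op_mats_iff, use A_car in simp, intro allI conjI)
    fix v
    have "(\<lambda>k. Im (?q k v)) sums Im (mform {..<n} (\<lambda>i j. map_mat f A $$ (i, j)) v)"
      by (rule bounded_linear.sums[OF bounded_linear_Im lim])
    then show "Im (mform {..<n} (\<lambda>i j. map_mat f A $$ (i, j)) v) = 0"
      unfolding q using sums_unique2 sums_zero by blast
    have "(\<lambda>k. Re (?q k v)) sums Re (mform {..<n} (\<lambda>i j. map_mat f A $$ (i, j)) v)"
      by (rule bounded_linear.sums[OF bounded_linear_Re lim])
    then show "0 \<le> Re (mform {..<n} (\<lambda>i j. map_mat f A $$ (i, j)) v)"
      by (rule sums_le[OF q(2) sums_zero])
  qed
qed

theorem theorem3p5:
  fixes \<phi> :: "nat \<Rightarrow> 'a::unital_cstar_algebra \<Rightarrow> 'a"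
    and f :: "'a \<Rightarrow> 'h::complex_hilbert_space bounded_op"
  assumes "vanishing \<phi>"
    and "\<And>k. star_map (\<phi> k)"
    and "is_cstar_algebra (range (xi \<phi>))"
    and "bounded_clinear f"
  shows "decomposable \<phi> f \<longleftrightarrow>
    (\<forall>n. \<forall>A\<in>carrier_mat n n. A \<in> Gamma_plus \<phi> n \<longrightarrow> map_mat f A \<in> positive_mats n)"
proof
  assume dec: "decomposable \<phi> f"
  show "\<forall>n. \<forall>A\<in>carrier_mat n n. A \<in> Gamma_plus \<phi> n \<longrightarrow> map_mat f A \<in> positive_mats n"
    by (intro allI ballI impI decomposable_imp_positive[OF dec])
next
  assume pos: "\<forall>n. \<forall>A\<in>carrier_mat n n. A \<in> Gamma_plus \<phi> n \<longrightarrow> map_mat f A \<in> positive_mats n"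
  interpret gamma_positive_map \<phi> f
  proof
    show "map_mat f A \<in> positive_mats n" if "A \<in> Gamma_plus \<phi> n" for n A
      using that pos by (simp add: Gamma_plus_def)
  qed (fact assms)+
  obtain \<Psi> where cp: "completely_positive \<Psi>" and \<Psi>: "\<forall>a. \<Psi> (xi \<phi> a) = f a"
    using completely_positive_extension by (elim exE conjE) (rule that)
  have "bounded_linear \<Psi>"
    using cp by (simp add: completely_positive_def bounded_clinear_iff)
  then have "(\<lambda>k. \<Psi> (single k (entry (xi \<phi> a) k))) sums \<Psi> (xi \<phi> a)" for a
    by (rule bounded_linear.sums) (rule single_sums)
  then have "(\<lambda>k. \<Psi> (single k (\<phi> k a))) sums f a" for a
    by (simp only: \<Psi> entry_xi[OF assms(1)])
  then show "decomposable \<phi> f"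
    unfolding decomposable_def
    by (intro exI[of _ "\<lambda>k x. \<Psi> (single k x)"] conjI allI completely_positive_single[OF cp])
qed

end
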